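(* Let $M$ be a smooth Riemannian manifold, $\sigma>0$, $V_1,\dots,V_s:M\to\mathbb{R}$ $\mathcal{C}^2$ potential functions (associated with $s$ obstacles bounded by regular submanifolds $S_1,\dots,S_s$ of $M$), $x_0,x_1,\dots,x_N\in M$ distinct points not lying on any $S_r$, $0=T_0<T_1<\dots<T_N=T$ fixed times, and $v_0\in T_{x_0}M$, $v_N\in T_{x_N}M$. Let $\overline{\Omega}$ be the associated set of admissible curves and let $$J(x)=\int_0^T\frac12\left(\Big\|\frac{D^2x}{dt^2}(t)\Big\|^2+\sigma\Big\|\frac{dx}{dt}(t)\Big\|^2+\sum_{r=1}^sV_r(x(t))\right)dt .$$ If $x\in\overline{\Omega}$ is an extremizer of $J$ over $\overline{\Omega}$, then $x$ is $\mathcal{C}^2$ on $[0,T]$ and on each interval $[T_{i-1},T_i]$, $i=1,\dots,N$, it satisfies $$\frac{D^4x}{dt^4}+R\left(\frac{D^2x}{dt^2},\frac{dx}{dt}\right)\frac{dx}{dt}-\sigma\frac{D^2x}{dt^2}+\frac12\sum_{r=1}^s\mathrm{grad}\,V_r(x)=0 .$$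
   Context: $\langle\cdot,\cdot\rangle$ is the metric, $\nabla$ the Levi-Civita connection, $R(X,Y)Z=\nabla_X\nabla_YZ-\nabla_Y\nabla_XZ-\nabla_{[X,Y]}Z$ the curvature tensor. For a curve $x$, $\frac{D^{s+1}x}{dt^{s+1}}$ denotes the $s$-th covariant derivative along $x$ of the velocity field $\frac{dx}{dt}$. $V_r$ is the artificial potential used to repel curves from the obstacle bounded by $S_r$. Admissible set $\overline{\Omega}$: all $\mathcal{C}^1$ curves $x:[0,T]\to M$ that are smooth on each $[T_{i-1},T_i]$, $i=1,\dots,N$, and satisfy $x(T_i)=x_i$ for $i=1,\dots,N-1$, $x(0)=x_0$, $x(T)=x_N$, $\frac{dx}{dt}(0)=v_0$, $\frac{dx}{dt}(T)=v_N$. Admissible variation of $x\in\overline{\Omega}$: a $\mathcal{C}^1$ map $\alpha:(-\epsilon,\epsilon)\times[0,T]\to M$, $(r,t)\mapsto\alpha_r(t)$, smooth on each $(-\epsilon,\epsilon)\times[T_{i-1},T_i]$, with $\alpha_0=x$ and $\alpha_r\in\overline{\Omega}$ for every $r$. A curve $x\in\overline{\Omega}$ is an extremizer of a functional $J$ over $\overline{\Omega}$ if $\frac{d}{dr}J(\alpha_r)\big|_{r=0}=0$ for every admissible variation $\alpha$ of $x$. *)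

theory Defs
  imports "HOL-Analysis.Analysis" "HOL-Library.Function_Algebras" "HOL-Library.Extended_Nat"
begin

section \<open>Functions into a vector space\<close>

instantiation "fun" :: (type, real_vector) real_vector
begin

definition scaleR_fun :: "real \<Rightarrow> ('a \<Rightarrow> 'b) \<Rightarrow> 'a \<Rightarrow> 'b" where
  "scaleR_fun a f = (\<lambda>x. a *\<^sub>R f x)"

instance
  by standard (simp_all add: scaleR_fun_def plus_fun_def fun_eq_iff scaleR_add_right scaleR_add_left)

end


section \<open>Maps of class $C^k$ between Euclidean spaces\<close>

text \<open>On an open subset of a Euclidean space, a map is of class \<open>C\<^sup>n\<close> iff all its iterated directional
  derivatives up to order \<open>n\<close> exist and are continuous.\<close>

primrec cn_on_open :: "nat \<Rightarrow> 'a::euclidean_space set \<Rightarrow> ('a \<Rightarrow> 'b::real_normed_vector) \<Rightarrow> bool" where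
  "cn_on_open 0 S f \<longleftrightarrow> continuous_on S f"
| "cn_on_open (Suc n) S f \<longleftrightarrow>
     (\<forall>x\<in>S. f differentiable (at x)) \<and>
     (\<forall>v. cn_on_open n S (\<lambda>x. frechet_derivative f (at x) v))"

text \<open>On an arbitrary set (a closed interval, a strip \<open>(-\<epsilon>,\<epsilon>) \<times> [a,b]\<close>, \<dots>) a map is of class \<open>C\<^sup>k\<close> if near
  each point it extends to a \<open>C\<^sup>k\<close> map on an open set; \<open>k = \<infinity>\<close> means smooth. For open sets this is the
  usual notion.\<close>

definition ck_on :: "enat \<Rightarrow> 'a::euclidean_space set \<Rightarrow> ('a \<Rightarrow> 'b::real_normed_vector) \<Rightarrow> bool" where
  "ck_on k S f \<longleftrightarrow>
     (\<forall>p\<in>S. \<exists>W F. open W \<and> p \<in> W \<and> (\<forall>n. enat n \<le> k \<longrightarrow> cn_on_open n W F) \<and> (\<forall>q\<in>S \<inter> W. F q = f q))"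


section \<open>Smooth manifolds\<close>

text \<open>A chart is a domain together with a coordinate map; the values of the coordinate map outside the
  domain are irrelevant. The manifold is the whole type \<open>'m\<close>, of dimension \<open>DIM('e)\<close>.\<close>

type_synonym ('m, 'e) chart = "'m set \<times> ('m \<Rightarrow> 'e)"

definition chart_inv :: "('m, 'e) chart \<Rightarrow> 'e \<Rightarrow> 'm" where
  "chart_inv c = inv_into (fst c) (snd c)"

definition is_chart :: "('m::topological_space, 'e::euclidean_space) chart \<Rightarrow> bool" where
  "is_chart c \<longleftrightarrow> open (fst c) \<and> open (snd c ` fst c) \<and>
     homeomorphism (fst c) (snd c ` fst c) (snd c) (chart_inv c)"

definition transition :: "('m, 'e) chart \<Rightarrow> ('m, 'e) chart \<Rightarrow> 'e \<Rightarrow> 'e" where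
  "transition c d = snd d \<circ> chart_inv c"

definition compatible :: "('m, 'e::euclidean_space) chart \<Rightarrow> ('m, 'e) chart \<Rightarrow> bool" where
  "compatible c d \<longleftrightarrow>
     ck_on \<infinity> (snd c ` (fst c \<inter> fst d)) (transition c d) \<and>
     ck_on \<infinity> (snd d ` (fst c \<inter> fst d)) (transition d c)"

text \<open>A smooth structure is a maximal smooth atlas.\<close>

definition smooth_manifold ::
    "('m::{t2_space, second_countable_topology}, 'e::euclidean_space) chart set \<Rightarrow> bool" where
  "smooth_manifold A \<longleftrightarrow>
     (\<forall>c\<in>A. is_chart c) \<and> (\<Union>c\<in>A. fst c) = UNIV \<and> (\<forall>c\<in>A. \<forall>d\<in>A. compatible c d) \<and>
     (\<forall>c. is_chart c \<and> (\<forall>d\<in>A. compatible c d) \<longrightarrow> c \<in> A)"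

definition chart_at :: "('m, 'e) chart set \<Rightarrow> 'm \<Rightarrow> ('m, 'e) chart" where
  "chart_at A p = (SOME c. c \<in> A \<and> p \<in> fst c)"

definition ck_fun_on ::
    "enat \<Rightarrow> ('m, 'e::euclidean_space) chart set \<Rightarrow> 'm set \<Rightarrow> ('m \<Rightarrow> real) \<Rightarrow> bool" where
  "ck_fun_on k A U f \<longleftrightarrow> (\<forall>c\<in>A. ck_on k (snd c ` (fst c \<inter> U)) (f \<circ> chart_inv c))"

definition ck_map_on ::
    "enat \<Rightarrow> ('m, 'e::euclidean_space) chart set \<Rightarrow> 'a::euclidean_space set \<Rightarrow> ('a \<Rightarrow> 'm) \<Rightarrow> bool" where
  "ck_map_on k A S f \<longleftrightarrow>
     (\<forall>c\<in>A. \<forall>s\<in>S. f s \<in> fst c \<longrightarrow>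
        (\<exists>W. open W \<and> s \<in> W \<and> f ` (S \<inter> W) \<subseteq> fst c \<and> ck_on k (S \<inter> W) (snd c \<circ> f)))"

text \<open>Regular (embedded) submanifolds, via slice charts.\<close>

definition regular_submanifold :: "('m, 'e::euclidean_space) chart set \<Rightarrow> 'm set \<Rightarrow> bool" where
  "regular_submanifold A S \<longleftrightarrow>
     (\<exists>k. \<forall>p\<in>S. \<exists>c\<in>A. p \<in> fst c \<and>
        (\<exists>L. subspace L \<and> dim L = k \<and> snd c ` (fst c \<inter> S) = snd c ` fst c \<inter> L))"


section \<open>Tangent vectors and vector fields\<close>

text \<open>A tangent vector at \<open>p\<close> is given by its components in all charts around \<open>p\<close>, related by the
  Jacobians of the transition maps; in charts not around \<open>p\<close> the component is set to \<open>0\<close>.\<close>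

type_synonym ('m, 'e) tvec = "('m, 'e) chart \<Rightarrow> 'e"

definition tangent_space :: "('m, 'e::euclidean_space) chart set \<Rightarrow> 'm \<Rightarrow> ('m, 'e) tvec set" where
  "tangent_space A p = {v.
     (\<forall>c\<in>A. \<forall>d\<in>A. p \<in> fst c \<inter> fst d \<longrightarrow>
        v d = frechet_derivative (transition c d) (at (snd c p)) (v c)) \<and>
     (\<forall>c. \<not> (c \<in> A \<and> p \<in> fst c) \<longrightarrow> v c = 0)}"

text \<open>The vector field on \<open>fst c\<close> whose component in the chart \<open>c\<close> is the constant \<open>e\<close>, that is,
  a linear combination of the coordinate vector fields of \<open>c\<close> with constant coefficients.\<close>

definition coord_field ::
    "('m, 'e::euclidean_space) chart set \<Rightarrow> ('m, 'e) chart \<Rightarrow> 'e \<Rightarrow> 'm \<Rightarrow> ('m, 'e) tvec" where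
  "coord_field A c e p = (\<lambda>d.
     if d \<in> A \<and> p \<in> fst c \<inter> fst d then frechet_derivative (transition c d) (at (snd c p)) e else 0)"

definition smooth_vector_fields ::
    "('m, 'e::euclidean_space) chart set \<Rightarrow> 'm set \<Rightarrow> ('m \<Rightarrow> ('m, 'e) tvec) set" where
  "smooth_vector_fields A U = {X.
     (\<forall>p\<in>U. X p \<in> tangent_space A p) \<and>
     (\<forall>c\<in>A. ck_on \<infinity> (snd c ` (fst c \<inter> U)) (\<lambda>y. X (chart_inv c y) c))}"

text \<open>The derivative \<open>v(f)\<close> of \<open>f\<close> at \<open>p\<close> along \<open>v \<in> T\<^sub>pM\<close>; it does not depend on the chart.\<close>

definition dir_deriv ::
    "('m, 'e::euclidean_space) chart set \<Rightarrow> 'm \<Rightarrow> ('m, 'e) tvec \<Rightarrow> ('m \<Rightarrow> real) \<Rightarrow> real" where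
  "dir_deriv A p v f =
     (let c = chart_at A p in frechet_derivative (f \<circ> chart_inv c) (at (snd c p)) (v c))"

text \<open>In every chart, \<open>[X,Y] = DY \<cdot> X - DX \<cdot> Y\<close>, which corresponds to \<open>[X,Y] f = X(Y f) - Y(X f)\<close>.\<close>

definition lie_bracket ::
    "('m, 'e::euclidean_space) chart set \<Rightarrow> ('m \<Rightarrow> ('m, 'e) tvec) \<Rightarrow> ('m \<Rightarrow> ('m, 'e) tvec)
      \<Rightarrow> 'm \<Rightarrow> ('m, 'e) tvec" where
  "lie_bracket A X Y p = (\<lambda>c. if c \<in> A \<and> p \<in> fst c
     then frechet_derivative (\<lambda>y. Y (chart_inv c y) c) (at (snd c p)) (X p c)
        - frechet_derivative (\<lambda>y. X (chart_inv c y) c) (at (snd c p)) (Y p c)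
     else 0)"


section \<open>Riemannian metrics, the Levi-Civita connection and curvature\<close>

type_synonym ('m, 'e) metric = "'m \<Rightarrow> ('m, 'e) tvec \<Rightarrow> ('m, 'e) tvec \<Rightarrow> real"

definition riemannian_metric ::
    "('m::topological_space, 'e::euclidean_space) chart set \<Rightarrow> ('m, 'e) metric \<Rightarrow> bool" where
  "riemannian_metric A g \<longleftrightarrow>
     (\<forall>p. \<forall>u\<in>tangent_space A p. \<forall>v\<in>tangent_space A p.
        g p u v = g p v u \<and>
        (\<forall>w\<in>tangent_space A p. g p (u + v) w = g p u w + g p v w) \<and>
        (\<forall>a. g p (a *\<^sub>R u) v = a * g p u v) \<and>
        (u \<noteq> 0 \<longrightarrow> g p u u > 0)) \<and>
     (\<forall>U. open U \<longrightarrow> (\<forall>X\<in>smooth_vector_fields A U. \<forall>Y\<in>smooth_vector_fields A U.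
        ck_fun_on \<infinity> A U (\<lambda>p. g p (X p) (Y p))))"

definition gradient ::
    "('m, 'e::euclidean_space) chart set \<Rightarrow> ('m, 'e) metric \<Rightarrow> ('m \<Rightarrow> real) \<Rightarrow> 'm \<Rightarrow> ('m, 'e) tvec" where
  "gradient A g f p =
     (THE w. w \<in> tangent_space A p \<and> (\<forall>v\<in>tangent_space A p. g p w v = dir_deriv A p v f))"

text \<open>Connections act on the vector fields that are smooth on some open set, so that the coordinate
  fields of a chart are legitimate arguments. As \<open>f\<close> below may be the indicator function of \<open>U\<close>, which is
  smooth on \<open>U\<close>, the axioms entail that \<open>\<nabla>\<^sub>X Y\<close> on \<open>U\<close> depends only on \<open>X\<close> and \<open>Y\<close> on \<open>U\<close>.\<close>

type_synonym ('m, 'e) connection =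
  "('m \<Rightarrow> ('m, 'e) tvec) \<Rightarrow> ('m \<Rightarrow> ('m, 'e) tvec) \<Rightarrow> 'm \<Rightarrow> ('m, 'e) tvec"

definition affine_connection ::
    "('m::topological_space, 'e::euclidean_space) chart set \<Rightarrow> ('m, 'e) connection \<Rightarrow> bool" where
  "affine_connection A nabla \<longleftrightarrow>
     (\<forall>U. open U \<longrightarrow>
       (\<forall>X\<in>smooth_vector_fields A U. \<forall>Y\<in>smooth_vector_fields A U.
          nabla X Y \<in> smooth_vector_fields A U \<and>
          (\<forall>Z\<in>smooth_vector_fields A U. \<forall>p\<in>U.
             nabla (\<lambda>q. X q + Z q) Y p = nabla X Y p + nabla Z Y p \<and>
             nabla X (\<lambda>q. Y q + Z q) p = nabla X Y p + nabla X Z p) \<and>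
          (\<forall>f. ck_fun_on \<infinity> A U f \<longrightarrow> (\<forall>p\<in>U.
             nabla (\<lambda>q. f q *\<^sub>R X q) Y p = f p *\<^sub>R nabla X Y p \<and>
             nabla X (\<lambda>q. f q *\<^sub>R Y q) p = dir_deriv A p (X p) f *\<^sub>R Y p + f p *\<^sub>R nabla X Y p))))"

definition levi_civita_connection ::
    "('m::topological_space, 'e::euclidean_space) chart set \<Rightarrow> ('m, 'e) metric \<Rightarrow> ('m, 'e) connection
      \<Rightarrow> bool" where
  "levi_civita_connection A g nabla \<longleftrightarrow>
     affine_connection A nabla \<and>
     (\<forall>U. open U \<longrightarrow>
       (\<forall>X\<in>smooth_vector_fields A U. \<forall>Y\<in>smooth_vector_fields A U. \<forall>p\<in>U.
          nabla X Y p - nabla Y X p = lie_bracket A X Y p \<and>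
          (\<forall>Z\<in>smooth_vector_fields A U.
             dir_deriv A p (X p) (\<lambda>q. g q (Y q) (Z q)) = g p (nabla X Y p) (Z p) + g p (Y p) (nabla X Z p))))"

definition curvature_field ::
    "('m, 'e::euclidean_space) chart set \<Rightarrow> ('m, 'e) connection \<Rightarrow> ('m \<Rightarrow> ('m, 'e) tvec)
      \<Rightarrow> ('m \<Rightarrow> ('m, 'e) tvec) \<Rightarrow> ('m \<Rightarrow> ('m, 'e) tvec) \<Rightarrow> 'm \<Rightarrow> ('m, 'e) tvec" where
  "curvature_field A nabla X Y Z p =
     nabla X (nabla Y Z) p - nabla Y (nabla X Z) p - nabla (lie_bracket A X Y) Z p"

text \<open>\<open>R(u,v)w\<close> for tangent vectors at \<open>p\<close>: evaluate at \<open>p\<close> the field \<open>R(X,Y)Z\<close> for any smooth local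
  extensions; by tensoriality the choice made in \<open>extend_tvec\<close> is immaterial.\<close>

definition extend_tvec ::
    "('m, 'e::euclidean_space) chart set \<Rightarrow> 'm \<Rightarrow> ('m, 'e) tvec \<Rightarrow> 'm \<Rightarrow> ('m, 'e) tvec" where
  "extend_tvec A p v = coord_field A (chart_at A p) (v (chart_at A p))"

definition curvature_tensor ::
    "('m, 'e::euclidean_space) chart set \<Rightarrow> ('m, 'e) connection \<Rightarrow> 'm \<Rightarrow> ('m, 'e) tvec
      \<Rightarrow> ('m, 'e) tvec \<Rightarrow> ('m, 'e) tvec \<Rightarrow> ('m, 'e) tvec" where
  "curvature_tensor A nabla p u v w =
     curvature_field A nabla (extend_tvec A p u) (extend_tvec A p v) (extend_tvec A p w) p"


section \<open>Covariant derivatives along curves\<close>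

text \<open>Derivatives are taken within the parameter interval \<open>I\<close>, hence are one-sided at its endpoints.\<close>

definition velocity ::
    "('m, 'e::euclidean_space) chart set \<Rightarrow> real set \<Rightarrow> (real \<Rightarrow> 'm) \<Rightarrow> real \<Rightarrow> ('m, 'e) tvec" where
  "velocity A I x t = (\<lambda>c. if c \<in> A \<and> x t \<in> fst c
     then vector_derivative (\<lambda>s. snd c (x s)) (at t within I) else 0)"

text \<open>The covariant derivative of a field \<open>V\<close> along \<open>x\<close>. If \<open>V = \<Sum>\<^sub>j V\<^sup>j \<partial>\<^sub>j\<close> in a chart, then
  \<open>DV/dt = \<Sum>\<^sub>j ((V\<^sup>j)' \<partial>\<^sub>j + V\<^sup>j \<nabla>\<^bsub>dx/dt\<^esub> \<partial>\<^sub>j)\<close>; the second sum is the covariant derivative at \<open>x t\<close>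
  of the coordinate field with the constant coefficients \<open>V\<^sup>j(t)\<close>.\<close>

definition cov_deriv ::
    "('m, 'e::euclidean_space) chart set \<Rightarrow> ('m, 'e) connection \<Rightarrow> real set \<Rightarrow> (real \<Rightarrow> 'm)
      \<Rightarrow> (real \<Rightarrow> ('m, 'e) tvec) \<Rightarrow> real \<Rightarrow> ('m, 'e) tvec" where
  "cov_deriv A nabla I x V t = (\<lambda>c. if c \<in> A \<and> x t \<in> fst c
     then vector_derivative (\<lambda>s. V s c) (at t within I)
        + nabla (coord_field A c (velocity A I x t c)) (coord_field A c (V t c)) (x t) c
     else 0)"

text \<open>\<open>curve_deriv A nabla I x k\<close> is \<open>D\<^sup>kx/dt\<^sup>k\<close> for \<open>k \<ge> 1\<close>.\<close>

definition curve_deriv ::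
    "('m, 'e::euclidean_space) chart set \<Rightarrow> ('m, 'e) connection \<Rightarrow> real set \<Rightarrow> (real \<Rightarrow> 'm)
      \<Rightarrow> nat \<Rightarrow> real \<Rightarrow> ('m, 'e) tvec" where
  "curve_deriv A nabla I x k = (cov_deriv A nabla I x ^^ (k - 1)) (velocity A I x)"


section \<open>The variational problem\<close>

text \<open>\<open>\<tau> 0 < \<dots> < \<tau> N\<close> are the interpolation times, \<open>P 0, \<dots>, P N\<close> the interpolation points. Curves and
  variations are total functions of which only the restriction to \<open>[0,T]\<close> with \<open>T = \<tau> N\<close> matters.\<close>

definition admissible_curves ::
    "('m, 'e::euclidean_space) chart set \<Rightarrow> nat \<Rightarrow> (nat \<Rightarrow> real) \<Rightarrow> (nat \<Rightarrow> 'm)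
      \<Rightarrow> ('m, 'e) tvec \<Rightarrow> ('m, 'e) tvec \<Rightarrow> (real \<Rightarrow> 'm) set" where
  "admissible_curves A N \<tau> P v0 vN = {x.
     ck_map_on 1 A {0..\<tau> N} x \<and>
     (\<forall>i\<in>{1..N}. ck_map_on \<infinity> A {\<tau> (i - 1)..\<tau> i} x) \<and>
     (\<forall>i\<in>{0..N}. x (\<tau> i) = P i) \<and>
     velocity A {0..\<tau> N} x 0 = v0 \<and> velocity A {0..\<tau> N} x (\<tau> N) = vN}"

definition admissible_variation ::
    "('m, 'e::euclidean_space) chart set \<Rightarrow> nat \<Rightarrow> (nat \<Rightarrow> real) \<Rightarrow> (nat \<Rightarrow> 'm)
      \<Rightarrow> ('m, 'e) tvec \<Rightarrow> ('m, 'e) tvec \<Rightarrow> (real \<Rightarrow> 'm) \<Rightarrow> real \<Rightarrow> (real \<Rightarrow> real \<Rightarrow> 'm) \<Rightarrow> bool" where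
  "admissible_variation A N \<tau> P v0 vN x \<epsilon> \<alpha> \<longleftrightarrow>
     \<epsilon> > 0 \<and>
     ck_map_on 1 A ({-\<epsilon><..<\<epsilon>} \<times> {0..\<tau> N}) (\<lambda>(r, t). \<alpha> r t) \<and>
     (\<forall>i\<in>{1..N}. ck_map_on \<infinity> A ({-\<epsilon><..<\<epsilon>} \<times> {\<tau> (i - 1)..\<tau> i}) (\<lambda>(r, t). \<alpha> r t)) \<and>
     (\<forall>t\<in>{0..\<tau> N}. \<alpha> 0 t = x t) \<and>
     (\<forall>r\<in>{-\<epsilon><..<\<epsilon>}. \<alpha> r \<in> admissible_curves A N \<tau> P v0 vN)"

definition extremizer ::
    "('m, 'e::euclidean_space) chart set \<Rightarrow> nat \<Rightarrow> (nat \<Rightarrow> real) \<Rightarrow> (nat \<Rightarrow> 'm)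
      \<Rightarrow> ('m, 'e) tvec \<Rightarrow> ('m, 'e) tvec \<Rightarrow> ((real \<Rightarrow> 'm) \<Rightarrow> real) \<Rightarrow> (real \<Rightarrow> 'm) \<Rightarrow> bool" where
  "extremizer A N \<tau> P v0 vN J x \<longleftrightarrow>
     x \<in> admissible_curves A N \<tau> P v0 vN \<and>
     (\<forall>\<epsilon> \<alpha>. admissible_variation A N \<tau> P v0 vN x \<epsilon> \<alpha> \<longrightarrow>
        ((\<lambda>r. J (\<alpha> r)) has_real_derivative 0) (at 0))"

text \<open>At the interior knots, where a curve in the admissible set need not have a second derivative, the
  integrand has an arbitrary value; this does not affect the integral.\<close>

definition obstacle_functional ::
    "('m, 'e::euclidean_space) chart set \<Rightarrow> ('m, 'e) metric \<Rightarrow> ('m, 'e) connection \<Rightarrow> real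
      \<Rightarrow> nat \<Rightarrow> (nat \<Rightarrow> 'm \<Rightarrow> real) \<Rightarrow> real \<Rightarrow> (real \<Rightarrow> 'm) \<Rightarrow> real" where
  "obstacle_functional A g nabla \<sigma> s V T x =
     integral {0..T} (\<lambda>t. 1/2 *
       (g (x t) (curve_deriv A nabla {0..T} x 2 t) (curve_deriv A nabla {0..T} x 2 t)
        + \<sigma> * g (x t) (velocity A {0..T} x t) (velocity A {0..T} x t)
        + (\<Sum>r=1..s. V r (x t))))"

end

theory Submission
  imports Defs
begin

text \<open>
  Vary the extremizer \<open>x\<close> inside one chart \<open>c\<close> only: with \<open>y = snd c \<circ> x\<close>, a smooth \<open>\<phi>\<close> supported in an
  interval on which \<open>x\<close> stays in the chart, and a constant vector \<open>e\<close>, the curves \<open>y + r \<phi> e\<close> form an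
  admissible variation as soon as \<open>\<phi>\<close> vanishes at the interpolation times. Such variations suffice, and along
  them the energy is the integral of a Lagrangian on a Euclidean space.

  In coordinates let \<open>v = y'\<close>, let \<open>D\<close> be the covariant derivative along the curve and let \<open>H = D v\<close>. For
  a displacement \<open>\<eta>\<close> the first variation has the integrand
  \<open>G(H, D\<^sup>2\<eta> + R(\<eta>,v)v) + \<sigma> G(v, D\<eta>) + dW(\<eta>)/2\<close>, where \<open>W\<close> is the sum of the potentials: commuting
  the variation past \<open>D\<close> in \<open>H = D v\<close> costs a curvature term. The pair symmetry of the
  curvature tensor gives \<open>G(H, R(\<eta>,v)v) = G(R(H,v)v, \<eta>)\<close>, and metric compatibility moves the derivatives
  off \<open>\<eta>\<close>. On every interval between interpolation times the first variation is therefore the integral of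
  \<open>G(D\<^sup>2H + R(H,v)v - \<sigma> H + grad W/2, \<eta>)\<close> plus the boundary values of
  \<open>G(H, D\<eta>) - G(DH, \<eta>) + \<sigma> G(v, \<eta>)\<close> (lemmas \<open>bdry_derivative\<close> and \<open>first_variation\<close>; lemma
  \<open>stationarity\<close> is the resulting identity for an extremizer).

  Bumps \<open>\<phi>\<close> between two interpolation times give the Euler-Lagrange equation in the interior of each
  interval, and continuity extends it to the endpoints (\<open>weak_EL_zero\<close>). At an interior interpolation time
  \<open>\<tau> i\<close> one has to take \<open>\<phi>(\<tau> i) = 0\<close>, but \<open>\<phi>'(\<tau> i)\<close> is free. Only the term \<open>G(H, D\<eta>)\<close> survives, so the
  one-sided limits of \<open>H\<close> agree (\<open>acceleration_matches\<close>). As \<open>x\<close> is \<open>C\<^sup>1\<close>, its coordinate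
  representation then has equal one-sided second derivatives, and the two smooth halves glue to a \<open>C\<^sup>2\<close> map.

  The rest relates the invariant notions to coordinates. A connection is local and is given in a chart by
  its Christoffel symbols (\<open>nabla_in_chart\<close>); covariant derivatives of tangent fields along a curve are
  tangent (\<open>cov_deriv_tangent\<close>). Hence the Euler-Lagrange expression is a tangent vector, and it vanishes
  once its component in a single chart does; the chart is the one in which the curvature tensor
  (\<open>curvature_in_chart\<close>) and the gradient (\<open>gradient_tangent\<close>) are defined.
\<close>



section \<open>Calculus of $C^k$ maps\<close>

lemma frechet_derivative_cong_open:
  assumes "open S" "x \<in> S" "\<And>y. y \<in> S \<Longrightarrow> f y = g y"
  shows "frechet_derivative f (at x) = frechet_derivative g (at x)"
proof -
  have "(f has_derivative D) (at x) \<longleftrightarrow> (g has_derivative D) (at x)" for D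
    using has_derivative_transform_within_open[OF _ assms(1,2), of f D UNIV g]
      has_derivative_transform_within_open[OF _ assms(1,2), of g D UNIV f] assms(3) by auto
  thus ?thesis unfolding frechet_derivative_def by simp
qed

lemma cn_on_open_mono_set: "cn_on_open n S f \<Longrightarrow> T \<subseteq> S \<Longrightarrow> cn_on_open n T f"
  by (induction n arbitrary: f) (auto intro: continuous_on_subset)

lemma cn_on_open_SucD: "cn_on_open (Suc n) S f \<Longrightarrow> cn_on_open n S f"
proof (induction n arbitrary: f)
  case 0
  then show ?case
    by (metis cn_on_open.simps continuous_at_imp_continuous_on differentiable_imp_continuous_within)
next
  case (Suc n)
  from Suc.prems show ?case using Suc.IH by simp
qed

lemma cn_on_open_le: "cn_on_open n S f \<Longrightarrow> m \<le> n \<Longrightarrow> cn_on_open m S f"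
  by (rotate_tac 1, induction rule: inc_induct) (simp_all add: cn_on_open_SucD del: cn_on_open.simps)

lemma cn_on_open_cong:
  assumes "open S" "\<And>x. x \<in> S \<Longrightarrow> f x = g x"
  shows "cn_on_open n S f \<longleftrightarrow> cn_on_open n S g"
  using assms(2)
proof (induction n arbitrary: f g)
  case 0
  then show ?case by (simp cong: continuous_on_cong)
next
  case (Suc n)
  have "f differentiable (at x) \<longleftrightarrow> g differentiable (at x)" if "x \<in> S" for x
    using has_derivative_transform_within_open[OF _ assms(1) that, of f _ UNIV g]
      has_derivative_transform_within_open[OF _ assms(1) that, of g _ UNIV f] Suc.prems
    unfolding differentiable_def by metis
  moreover have "cn_on_open n S (\<lambda>x. frechet_derivative f (at x) v)
      \<longleftrightarrow> cn_on_open n S (\<lambda>x. frechet_derivative g (at x) v)" for v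
    by (rule Suc.IH) (simp add: frechet_derivative_cong_open[OF assms(1) _ Suc.prems])
  ultimately show ?case by simp
qed

lemma cn_on_open_locally:
  assumes "\<And>p. p \<in> S \<Longrightarrow> \<exists>W. open W \<and> p \<in> W \<and> cn_on_open n W f"
  shows "cn_on_open n S f"
  using assms
proof (induction n arbitrary: f)
  case 0
  show ?case unfolding cn_on_open.simps continuous_on_eq_continuous_within
  proof
    fix p assume "p \<in> S"
    then obtain W where "open W" "p \<in> W" "continuous_on W f" using 0 by auto
    then show "continuous (at p within S) f"
      by (simp add: continuous_on_eq_continuous_at continuous_at_imp_continuous_within)
  qed
next
  case (Suc n)
  show ?case unfolding cn_on_open.simps
  proof (intro conjI ballI allI)
    fix p assume "p \<in> S"
    then show "f differentiable at p" using Suc.prems[of p] by auto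
  next
    fix v
    show "cn_on_open n S (\<lambda>x. frechet_derivative f (at x) v)"
      by (rule Suc.IH) (use Suc.prems in fastforce)
  qed
qed

lemma cn_on_open_const: "cn_on_open n S (\<lambda>x. c)"
  by (induction n arbitrary: c) (auto simp: frechet_derivative_const)

lemma cn_on_open_bounded_linear:
  assumes "bounded_linear f"
  shows "cn_on_open n S f"
proof (cases n)
  case 0
  then show ?thesis using assms by (simp add: linear_continuous_on)
next
  case (Suc m)
  have "(f has_derivative f) (at x)" for x
    using assms by (rule bounded_linear_imp_has_derivative)
  then have "frechet_derivative f (at x) = f" for x
    by (rule frechet_derivative_at[symmetric])
  moreover have "f differentiable (at x)" for x
    using assms by (simp add: bounded_linear_imp_differentiable)
  ultimately show ?thesis using Suc by (simp add: cn_on_open_const)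
qed

lemma cn_on_open_add:
  "cn_on_open n S f \<Longrightarrow> cn_on_open n S g \<Longrightarrow> open S \<Longrightarrow> cn_on_open n S (\<lambda>x. f x + g x)"
proof (induction n arbitrary: f g)
  case 0
  then show ?case by (simp add: continuous_on_add)
next
  case (Suc n)
  have "cn_on_open n S (\<lambda>x. frechet_derivative f (at x) v + frechet_derivative g (at x) v)" for v
    using Suc by simp
  moreover have "frechet_derivative (\<lambda>x. f x + g x) (at x) v
      = frechet_derivative f (at x) v + frechet_derivative g (at x) v" if "x \<in> S" for x v
  proof -
    have "((\<lambda>x. f x + g x) has_derivative
        (\<lambda>v. frechet_derivative f (at x) v + frechet_derivative g (at x) v)) (at x)"
      using Suc.prems that by (intro has_derivative_add) (auto simp: frechet_derivative_works)
    from frechet_derivative_at[OF this] show ?thesis by metis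
  qed
  ultimately show ?case
    using Suc.prems by (simp add: differentiable_add cn_on_open_cong[OF \<open>open S\<close>, of
        "\<lambda>x. frechet_derivative (\<lambda>x. f x + g x) (at x) _"
        "\<lambda>x. frechet_derivative f (at x) _ + frechet_derivative g (at x) _"])
qed

lemma cn_on_open_sum:
  assumes "open S" "\<And>i. i \<in> I \<Longrightarrow> cn_on_open n S (f i)"
  shows "cn_on_open n S (\<lambda>x. \<Sum>i\<in>I. f i x)"
  using assms(2)
  by (induction I rule: infinite_finite_induct) (auto intro: cn_on_open_const cn_on_open_add assms(1))

lemma frechet_derivative_bounded_bilinear:
  assumes "bounded_bilinear pr" "f differentiable (at x)" "g differentiable (at x)"
  shows "((\<lambda>x. pr (f x) (g x)) has_derivative
      (\<lambda>v. pr (f x) (frechet_derivative g (at x) v) + pr (frechet_derivative f (at x) v) (g x))) (at x)"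
  by (rule bounded_bilinear.FDERIV[OF assms(1)])
    (use assms(2,3) in \<open>simp_all add: frechet_derivative_works\<close>)

lemma cn_on_open_bilinear:
  assumes "bounded_bilinear pr" "open S"
  shows "cn_on_open n S f \<Longrightarrow> cn_on_open n S g \<Longrightarrow> cn_on_open n S (\<lambda>x. pr (f x) (g x))"
proof (induction n arbitrary: f g)
  case 0
  then show ?case using bounded_bilinear.continuous_on[OF assms(1)] by simp
next
  case (Suc n)
  note D = frechet_derivative_bounded_bilinear[OF assms(1)]
  have "cn_on_open n S (\<lambda>x. pr (f x) (frechet_derivative g (at x) v)
      + pr (frechet_derivative f (at x) v) (g x))" for v
    using Suc.prems assms(2) Suc.prems[THEN cn_on_open_SucD]
    by (intro cn_on_open_add Suc.IH) auto
  moreover have "frechet_derivative (\<lambda>x. pr (f x) (g x)) (at x) v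
      = pr (f x) (frechet_derivative g (at x) v)
      + pr (frechet_derivative f (at x) v) (g x)" if "x \<in> S" for x v
    using frechet_derivative_at[OF D, symmetric, of f x g] Suc.prems that by (auto dest: fun_cong)
  moreover have "(\<lambda>x. pr (f x) (g x)) differentiable (at x)" if "x \<in> S" for x
    using D[of f x g] Suc.prems that by (auto simp: differentiable_def)
  ultimately show ?case
    by (simp add: cn_on_open_cong[OF \<open>open S\<close>, of
        "\<lambda>x. frechet_derivative (\<lambda>x. pr (f x) (g x)) (at x) _"
        "\<lambda>x. pr (f x) (frechet_derivative g (at x) _) + pr (frechet_derivative f (at x) _) (g x)"])
qed

text \<open>In a basis the chain rule reads \<open>D(g \<circ> f) v = \<Sum>\<^sub>b (Df v \<bullet> b) Dg b\<close>. The right-hand side is built by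
  products and a composition from maps of one class less, which gives the induction.\<close>

lemma cn_on_open_compose:
  fixes f :: "'a::euclidean_space \<Rightarrow> 'b::euclidean_space" and g :: "'b \<Rightarrow> 'c::real_normed_vector"
  assumes "open S" "open T" "f ` S \<subseteq> T"
  shows "cn_on_open n T g \<Longrightarrow> cn_on_open n S f \<Longrightarrow> cn_on_open n S (\<lambda>x. g (f x))"
proof (induction n arbitrary: g)
  case 0
  then show ?case using continuous_on_compose2[of T g S f] assms(3) by auto
next
  case (Suc n)
  have df: "f differentiable (at x)" if "x \<in> S" for x using Suc.prems that by simp
  have dg: "g differentiable (at (f x))" if "x \<in> S" for x using Suc.prems that assms(3) by auto
  have D: "((\<lambda>x. g (f x)) has_derivative
      (\<lambda>v. frechet_derivative g (at (f x)) (frechet_derivative f (at x) v))) (at x)" if "x \<in> S" for x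
    by (rule has_derivative_compose)
      (use df[OF that] dg[OF that] in \<open>simp_all add: frechet_derivative_works\<close>)
  have eq: "frechet_derivative (\<lambda>x. g (f x)) (at x) v
      = (\<Sum>b\<in>Basis. (frechet_derivative f (at x) v \<bullet> b) *\<^sub>R frechet_derivative g (at (f x)) b)"
    if "x \<in> S" for x v
  proof -
    have lin: "linear (frechet_derivative g (at (f x)))"
      using dg[OF that] linear_frechet_derivative by blast
    have "frechet_derivative (\<lambda>x. g (f x)) (at x) v
        = frechet_derivative g (at (f x)) (frechet_derivative f (at x) v)"
      by (simp add: frechet_derivative_at[OF D[OF that], symmetric])
    also have "\<dots> = frechet_derivative g (at (f x)) (\<Sum>b\<in>Basis. (frechet_derivative f (at x) v \<bullet> b) *\<^sub>R b)"
      by (simp add: euclidean_representation)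
    finally show ?thesis by (simp add: linear_sum[OF lin] linear_cmul[OF lin])
  qed
  have "cn_on_open n S (\<lambda>x. \<Sum>b\<in>Basis.
      (frechet_derivative f (at x) v \<bullet> b) *\<^sub>R frechet_derivative g (at (f x)) b)" for v
  proof (intro cn_on_open_sum cn_on_open_bilinear[OF bounded_bilinear_scaleR] assms(1))
    fix b :: 'b
    show "cn_on_open n S (\<lambda>x. frechet_derivative f (at x) v \<bullet> b)"
      using cn_on_open_bilinear[OF bounded_bilinear_inner assms(1), of n _ "\<lambda>_. b"] Suc.prems
      by (auto simp: cn_on_open_const)
    show "cn_on_open n S (\<lambda>x. frechet_derivative g (at (f x)) b)"
      by (rule Suc.IH) (use Suc.prems Suc.prems(2)[THEN cn_on_open_SucD] in auto)
  qed
  then have "cn_on_open n S (\<lambda>x. frechet_derivative (\<lambda>x. g (f x)) (at x) v)" for v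
    using cn_on_open_cong[OF assms(1), of "\<lambda>x. frechet_derivative (\<lambda>x. g (f x)) (at x) v", OF eq]
    by simp
  with D show ?case by (auto simp: differentiable_def)
qed

lemma ck_onE:
  assumes "ck_on k S f" "p \<in> S"
  obtains W F where "open W" "p \<in> W" "\<And>n. enat n \<le> k \<Longrightarrow> cn_on_open n W F" "\<And>q. q \<in> S \<Longrightarrow> q \<in> W \<Longrightarrow> F q = f q"
proof -
  from bspec[OF assms(1)[unfolded ck_on_def] assms(2)] obtain W F where
    "open W" "p \<in> W" "\<forall>n. enat n \<le> k \<longrightarrow> cn_on_open n W F" "\<forall>q\<in>S \<inter> W. F q = f q"
    by (elim exE conjE)
  then show thesis by (intro that[of W F]) simp_all
qed

lemma ck_on_subset:
  assumes "ck_on k S f" "T \<subseteq> S"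
  shows "ck_on k T f"
  unfolding ck_on_def
proof
  fix p assume "p \<in> T"
  then have "p \<in> S" using assms(2) by blast
  obtain W F where "open W" "p \<in> W" "\<And>n. enat n \<le> k \<Longrightarrow> cn_on_open n W F"
    "\<And>q. q \<in> S \<Longrightarrow> q \<in> W \<Longrightarrow> F q = f q" using ck_onE[OF assms(1) \<open>p \<in> S\<close>] by metis
  then show "\<exists>W F. open W \<and> p \<in> W \<and> (\<forall>n. enat n \<le> k \<longrightarrow> cn_on_open n W F) \<and> (\<forall>q\<in>T \<inter> W. F q = f q)"
    using assms(2) by (intro exI[of _ W] exI[of _ F]) auto
qed

lemma ck_on_mono:
  assumes "ck_on k S f" "l \<le> k"
  shows "ck_on l S f"
  unfolding ck_on_def
proof
  fix p assume "p \<in> S"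
  obtain W F where "open W" "p \<in> W" "\<And>n. enat n \<le> k \<Longrightarrow> cn_on_open n W F"
    "\<And>q. q \<in> S \<Longrightarrow> q \<in> W \<Longrightarrow> F q = f q" using ck_onE[OF assms(1) \<open>p \<in> S\<close>] by metis
  then show "\<exists>W F. open W \<and> p \<in> W \<and> (\<forall>n. enat n \<le> l \<longrightarrow> cn_on_open n W F) \<and> (\<forall>q\<in>S \<inter> W. F q = f q)"
    using assms(2) by (intro exI[of _ W] exI[of _ F]) (auto intro: order_trans)
qed

lemma ck_on_cong: "(\<And>x. x \<in> S \<Longrightarrow> f x = g x) \<Longrightarrow> ck_on k S f \<longleftrightarrow> ck_on k S g"
  unfolding ck_on_def by simp

lemma ck_on_open_iff:
  assumes "open S"
  shows "ck_on k S f \<longleftrightarrow> (\<forall>n. enat n \<le> k \<longrightarrow> cn_on_open n S f)"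
proof
  assume L: "ck_on k S f"
  show "\<forall>n. enat n \<le> k \<longrightarrow> cn_on_open n S f"
  proof (intro allI impI cn_on_open_locally)
    fix n p assume n: "enat n \<le> k" and "p \<in> S"
    obtain W F where W: "open W" "p \<in> W" "cn_on_open n W F" "\<And>q. q \<in> S \<Longrightarrow> q \<in> W \<Longrightarrow> F q = f q"
      using ck_onE[OF L \<open>p \<in> S\<close>] n by (metis (full_types))
    have "cn_on_open n (S \<inter> W) F" using W(3) by (rule cn_on_open_mono_set) auto
    then have "cn_on_open n (S \<inter> W) f"
      using cn_on_open_cong[of "S \<inter> W" F f n] W assms by auto
    then show "\<exists>W. open W \<and> p \<in> W \<and> cn_on_open n W f"
      using \<open>p \<in> S\<close> W assms by (intro exI[of _ "S \<inter> W"]) auto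
  qed
next
  assume "\<forall>n. enat n \<le> k \<longrightarrow> cn_on_open n S f"
  then show "ck_on k S f" unfolding ck_on_def using assms by blast
qed

lemma ck_on_locally:
  assumes "\<And>p. p \<in> S \<Longrightarrow> \<exists>W. open W \<and> p \<in> W \<and> ck_on k (S \<inter> W) f"
  shows "ck_on k S f"
  unfolding ck_on_def
proof
  fix p assume "p \<in> S"
  then obtain W where W: "open W" "p \<in> W" "ck_on k (S \<inter> W) f" using assms by metis
  obtain V F where V: "open V" "p \<in> V" "\<And>n. enat n \<le> k \<Longrightarrow> cn_on_open n V F"
    "\<And>q. q \<in> S \<inter> W \<Longrightarrow> q \<in> V \<Longrightarrow> F q = f q"
    using ck_onE[OF W(3) IntI[OF \<open>p \<in> S\<close> W(2)]] by metis
  show "\<exists>W F. open W \<and> p \<in> W \<and> (\<forall>n. enat n \<le> k \<longrightarrow> cn_on_open n W F) \<and> (\<forall>q\<in>S \<inter> W. F q = f q)"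
    using V W by (intro exI[of _ "V \<inter> W"] exI[of _ F]) (auto intro: cn_on_open_mono_set)
qed

lemma ck_on_continuous: "ck_on k S f \<Longrightarrow> continuous_on S f"
proof -
  assume L: "ck_on k S f"
  show ?thesis unfolding continuous_on_eq_continuous_within
  proof
    fix p assume "p \<in> S"
    obtain W F where W: "open W" "p \<in> W" "cn_on_open 0 W F" "\<And>q. q \<in> S \<Longrightarrow> q \<in> W \<Longrightarrow> F q = f q"
    proof -
      have "enat 0 \<le> k" by (simp flip: zero_enat_def)
      then show ?thesis using ck_onE[OF L \<open>p \<in> S\<close>] that by (metis (full_types))
    qed
    then have "continuous (at p within S) F"
      by (simp add: continuous_on_eq_continuous_at continuous_at_imp_continuous_within)
    then have "(F \<longlongrightarrow> f p) (at p within S)"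
      using W(4)[OF \<open>p \<in> S\<close> W(2)] by (simp add: continuous_within)
    moreover have "\<forall>\<^sub>F x in at p within S. F x = f x"
      unfolding eventually_at_topological using W by (intro exI[of _ W]) simp
    ultimately show "continuous (at p within S) f"
      unfolding continuous_within by (rule Lim_transform_eventually)
  qed
qed

lemma ck_on_const: "ck_on k S (\<lambda>x. c)"
  unfolding ck_on_def
  by (intro ballI exI[of _ UNIV] exI[of _ "\<lambda>x. c"]) (auto intro: cn_on_open_const)

lemma ck_on_bounded_linear: "bounded_linear f \<Longrightarrow> ck_on k S f"
  unfolding ck_on_def
  by (intro ballI exI[of _ UNIV] exI[of _ f]) (auto intro: cn_on_open_bounded_linear)

text \<open>Local extensions of two maps are defined on different neighbourhoods; on the intersection any
  operation that preserves the class on open sets can be applied to them.\<close>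

lemma ck_on_lift2:
  fixes f :: "'a::euclidean_space \<Rightarrow> 'b::real_normed_vector" and g :: "'a \<Rightarrow> 'c::real_normed_vector"
    and h :: "'b \<Rightarrow> 'c \<Rightarrow> 'd::real_normed_vector"
  assumes f: "ck_on k S f" and g: "ck_on k S g"
    and h: "\<And>n W (F :: 'a \<Rightarrow> 'b) G. open W \<Longrightarrow> cn_on_open n W F \<Longrightarrow> cn_on_open n W G \<Longrightarrow> cn_on_open n W (\<lambda>x. h (F x) (G x))"
  shows "ck_on k S (\<lambda>x. h (f x) (g x))"
  unfolding ck_on_def
proof
  fix p assume "p \<in> S"
  obtain W F where W: "open W" "p \<in> W" "\<And>n. enat n \<le> k \<Longrightarrow> cn_on_open n W F"
    "\<And>q. q \<in> S \<Longrightarrow> q \<in> W \<Longrightarrow> F q = f q" using ck_onE[OF f \<open>p \<in> S\<close>] by blast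
  obtain W' F' where W': "open W'" "p \<in> W'" "\<And>n. enat n \<le> k \<Longrightarrow> cn_on_open n W' F'"
    "\<And>q. q \<in> S \<Longrightarrow> q \<in> W' \<Longrightarrow> F' q = g q" using ck_onE[OF g \<open>p \<in> S\<close>] by blast
  have "cn_on_open n (W \<inter> W') (\<lambda>x. h (F x) (F' x))" if "enat n \<le> k" for n
    by (rule h[where F=F and G=F']) (use W W' that in \<open>auto intro: cn_on_open_mono_set\<close>)
  then show "\<exists>W F. open W \<and> p \<in> W \<and> (\<forall>n. enat n \<le> k \<longrightarrow> cn_on_open n W F) \<and>
      (\<forall>q\<in>S \<inter> W. F q = h (f q) (g q))"
    using W W' by (intro exI[of _ "W \<inter> W'"] exI[of _ "\<lambda>x. h (F x) (F' x)"]) auto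
qed

lemma ck_on_add: "ck_on k S f \<Longrightarrow> ck_on k S g \<Longrightarrow> ck_on k S (\<lambda>x. f x + g x)"
  by (rule ck_on_lift2) (auto intro: cn_on_open_add)

lemma ck_on_bilinear:
  "bounded_bilinear pr \<Longrightarrow> ck_on k S f \<Longrightarrow> ck_on k S g \<Longrightarrow> ck_on k S (\<lambda>x. pr (f x) (g x))"
  by (rule ck_on_lift2) (auto intro: cn_on_open_bilinear)

lemmas ck_on_scaleR = ck_on_bilinear[OF bounded_bilinear_scaleR]
lemmas ck_on_mult = ck_on_bilinear[OF bounded_bilinear_mult]
lemmas ck_on_inner = ck_on_bilinear[OF bounded_bilinear_inner]

lemma ck_on_sum:
  assumes "\<And>i. i \<in> I \<Longrightarrow> ck_on k S (f i)"
  shows "ck_on k S (\<lambda>x. \<Sum>i\<in>I. f i x)"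
  using assms
  by (induction I rule: infinite_finite_induct) (auto intro: ck_on_const ck_on_add)

lemma ck_on_compose:
  fixes f :: "'a::euclidean_space \<Rightarrow> 'b::euclidean_space" and g :: "'b \<Rightarrow> 'c::real_normed_vector"
  assumes "ck_on k T g" "ck_on k S f" "f ` S \<subseteq> T"
  shows "ck_on k S (\<lambda>x. g (f x))"
  unfolding ck_on_def
proof
  fix p assume "p \<in> S"
  obtain W F where W: "open W" "p \<in> W" "\<And>n. enat n \<le> k \<Longrightarrow> cn_on_open n W F"
    "\<And>q. q \<in> S \<Longrightarrow> q \<in> W \<Longrightarrow> F q = f q" using ck_onE[OF assms(2) \<open>p \<in> S\<close>] by blast
  obtain W' F' where W': "open W'" "f p \<in> W'" "\<And>n. enat n \<le> k \<Longrightarrow> cn_on_open n W' F'"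
    "\<And>q. q \<in> T \<Longrightarrow> q \<in> W' \<Longrightarrow> F' q = g q"
    using ck_onE[OF assms(1), of "f p"] \<open>p \<in> S\<close> assms(3) by blast
  have "continuous_on W F" using W(3)[of 0] by (simp add: zero_enat_def[symmetric])
  then have op: "open (F -` W' \<inter> W)" using W(1) W'(1)
    by (simp add: continuous_on_open_vimage)
  have "cn_on_open n (F -` W' \<inter> W) (\<lambda>x. F' (F x))" if "enat n \<le> k" for n
    by (rule cn_on_open_compose[OF op W'(1)])
      (use W W' that in \<open>auto intro: cn_on_open_mono_set\<close>)
  then show "\<exists>W F. open W \<and> p \<in> W \<and> (\<forall>n. enat n \<le> k \<longrightarrow> cn_on_open n W F) \<and>
      (\<forall>q\<in>S \<inter> W. F q = g (f q))"
    using W W' op assms(3) \<open>p \<in> S\<close>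
    by (intro exI[of _ "F -` W' \<inter> W"] exI[of _ "\<lambda>x. F' (F x)"]) auto
qed

lemma ck_on_differentiable:
  assumes "ck_on k S f" "open S" "x \<in> S" "1 \<le> k"
  shows "f differentiable (at x)"
  using assms ck_on_open_iff[of S k f] by (metis One_nat_def cn_on_open.simps(2) one_enat_def)

lemma ck_on_frechet_derivative:
  assumes "ck_on \<infinity> S f" "open S"
  shows "ck_on \<infinity> S (\<lambda>x. frechet_derivative f (at x) v)"
  using assms unfolding ck_on_open_iff[OF assms(2)] by (metis cn_on_open.simps(2) enat_ord_code(3))

lemma ck_on_frechet_derivative_Suc:
  assumes "ck_on (enat (Suc n)) S f" "open S"
  shows "ck_on (enat n) S (\<lambda>x. frechet_derivative f (at x) v)"
  using assms cn_on_open_le unfolding ck_on_open_iff[OF assms(2)]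
  by (metis cn_on_open.simps(2) enat_ord_simps(1) order_refl)

text \<open>In one variable, on a set without isolated points, the derivative within the set agrees with that
  of any local extension; hence it inherits a class \<open>C\<^sup>k\<close> in the extension sense.\<close>

lemma ck_on_vector_derivative:
  fixes f :: "real \<Rightarrow> 'b::real_normed_vector"
  assumes f: "ck_on k S f" and lim: "\<And>t. t \<in> S \<Longrightarrow> at t within S \<noteq> bot" and k: "1 \<le> k"
  shows has_vector_derivative_within_ck_on: 
      "t \<in> S \<Longrightarrow> (f has_vector_derivative vector_derivative f (at t within S)) (at t within S)"
    and "(\<And>n. enat n \<le> l \<Longrightarrow> enat (Suc n) \<le> k) \<Longrightarrow> ck_on l S (\<lambda>t. vector_derivative f (at t within S))"
proof -
  have key: "\<exists>W F. open W \<and> p \<in> W \<and> (\<forall>m. enat m \<le> k \<longrightarrow> cn_on_open m W F) \<and>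
     (\<forall>q\<in>S \<inter> W. (f has_vector_derivative frechet_derivative F (at q) 1) (at q within S))"
    if p: "p \<in> S" for p
  proof -
    obtain W F where W: "open W" "p \<in> W" "\<And>m. enat m \<le> k \<Longrightarrow> cn_on_open m W F"
      "\<And>q. q \<in> S \<Longrightarrow> q \<in> W \<Longrightarrow> F q = f q" using ck_onE[OF f p] by blast
    have "(f has_vector_derivative frechet_derivative F (at q) 1) (at q within S)"
      if q: "q \<in> S" "q \<in> W" for q
    proof -
      have "cn_on_open (Suc 0) W F" using W(3)[of "Suc 0"] k by (simp add: one_enat_def)
      then have "F differentiable (at q)" using q by simp
      then have "(F has_derivative frechet_derivative F (at q)) (at q)"
        by (simp add: frechet_derivative_works)
      moreover have "frechet_derivative F (at q) = (\<lambda>x. x *\<^sub>R frechet_derivative F (at q) 1)"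
        using linear_frechet_derivative[OF \<open>F differentiable (at q)\<close>] linear_cmul
        by (metis mult.right_neutral real_scaleR_def)
      ultimately have "(F has_vector_derivative frechet_derivative F (at q) 1) (at q)"
        unfolding has_vector_derivative_def by simp
      then have "(F has_vector_derivative frechet_derivative F (at q) 1) (at q within S)"
        by (rule has_vector_derivative_at_within)
      moreover have "\<forall>\<^sub>F x in nhds q. x \<in> S \<longrightarrow> F x = f x"
        unfolding eventually_nhds using W(1,4) q by blast
      ultimately show ?thesis
        using has_vector_derivative_cong_ev W(4) q by blast
    qed
    then show ?thesis using W by (intro exI[of _ W] exI[of _ F]) auto
  qed
  show "(f has_vector_derivative vector_derivative f (at t within S)) (at t within S)" if "t \<in> S" for t
    using key[OF that] lim[OF that] that vector_derivative_within by (metis IntI)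
  show "ck_on l S (\<lambda>t. vector_derivative f (at t within S))"
    if l: "\<And>n. enat n \<le> l \<Longrightarrow> enat (Suc n) \<le> k"
    unfolding ck_on_def
  proof
    fix p assume "p \<in> S"
    obtain W F where W: "open W" "p \<in> W" "\<And>m. enat m \<le> k \<Longrightarrow> cn_on_open m W F"
     "\<And>q. q\<in>S \<inter> W \<Longrightarrow> (f has_vector_derivative frechet_derivative F (at q) 1) (at q within S)"
      using key[OF \<open>p \<in> S\<close>] by metis
    show "\<exists>W F. open W \<and> p \<in> W \<and> (\<forall>m. enat m \<le> l \<longrightarrow> cn_on_open m W F) \<and>
      (\<forall>q\<in>S \<inter> W. F q = vector_derivative f (at q within S))"
    proof (intro exI[of _ W] exI[of _ "\<lambda>q. frechet_derivative F (at q) 1"] conjI allI impI ballI)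
      fix m assume "enat m \<le> l"
      then show "cn_on_open m W (\<lambda>q. frechet_derivative F (at q) 1)"
        using W(3)[OF l, of m] by simp
    next
      fix q assume "q \<in> S \<inter> W"
      then show "frechet_derivative F (at q) 1 = vector_derivative f (at q within S)"
        using vector_derivative_within[OF lim[of q] W(4)] by simp
    qed (use W in auto)
  qed
qed

lemma frechet_derivative_line:
  assumes "f differentiable (at (p + s *\<^sub>R u))"
  shows "((\<lambda>s. f (p + s *\<^sub>R u)) has_vector_derivative frechet_derivative f (at (p + s *\<^sub>R u)) u) (at s within S)"
proof -
  have "((\<lambda>s. p + s *\<^sub>R u) has_derivative (\<lambda>h. h *\<^sub>R u)) (at s within S)"
    by (auto intro!: derivative_eq_intros)
  from has_derivative_compose[OF this, of f "frechet_derivative f (at (p + s *\<^sub>R u))"] assms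
  have "((\<lambda>s. f (p + s *\<^sub>R u)) has_derivative
      (\<lambda>h. frechet_derivative f (at (p + s *\<^sub>R u)) (h *\<^sub>R u))) (at s within S)"
    by (simp add: frechet_derivative_works)
  then show ?thesis
    using linear_cmul[OF linear_frechet_derivative[OF assms]] by (simp add: has_vector_derivative_def)
qed

text \<open>The mean value theorem, first along \<open>u\<close> for the difference of \<open>f\<close> along \<open>v\<close>, then along \<open>v\<close> for the
  derivative of \<open>f\<close> along \<open>u\<close>.\<close>

lemma second_difference_mean_value:
  fixes f :: "'a::euclidean_space \<Rightarrow> real"
  assumes f: "cn_on_open 2 W f" and "s > 0"
    and sub: "\<And>a b. 0 \<le> a \<Longrightarrow> a \<le> s \<Longrightarrow> 0 \<le> b \<Longrightarrow> b \<le> s \<Longrightarrow> x + a *\<^sub>R u + b *\<^sub>R v \<in> W"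
  shows "\<exists>a b. 0 \<le> a \<and> a \<le> s \<and> 0 \<le> b \<and> b \<le> s \<and>
    f (x + s *\<^sub>R u + s *\<^sub>R v) - f (x + s *\<^sub>R u) - f (x + s *\<^sub>R v) + f x
      = s\<^sup>2 * frechet_derivative (\<lambda>z. frechet_derivative f (at z) u) (at (x + a *\<^sub>R u + b *\<^sub>R v)) v"
proof -
  let ?fu = "\<lambda>z. frechet_derivative f (at z) u"
  have f2: "cn_on_open (Suc (Suc 0)) W f" using f by (simp add: numeral_2_eq_2)
  have df: "f differentiable (at z)" if "z \<in> W" for z using f2 that by simp
  have dfu: "?fu differentiable (at z)" if "z \<in> W" for z using f2 that by simp
  define h where "h a = f (x + s *\<^sub>R v + a *\<^sub>R u) - f (x + a *\<^sub>R u)" for a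
  have "(h has_real_derivative (?fu (x + s *\<^sub>R v + a *\<^sub>R u) - ?fu (x + a *\<^sub>R u))) (at a)"
    if "0 \<le> a" "a \<le> s" for a
  proof -
    have "x + s *\<^sub>R v + a *\<^sub>R u \<in> W" "x + a *\<^sub>R u \<in> W"
      using sub[of a s] sub[of a 0] that \<open>s > 0\<close> by (simp_all add: add_ac)
    then show ?thesis
      unfolding h_def has_real_derivative_iff_has_vector_derivative
      by (intro has_vector_derivative_diff frechet_derivative_line df)
  qed
  from MVT2[OF \<open>s > 0\<close> this] obtain a where a: "0 < a" "a < s"
    "h s - h 0 = s * (?fu (x + s *\<^sub>R v + a *\<^sub>R u) - ?fu (x + a *\<^sub>R u))" by auto
  define k where "k b = ?fu (x + a *\<^sub>R u + b *\<^sub>R v)" for b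
  have "(k has_real_derivative frechet_derivative ?fu (at (x + a *\<^sub>R u + b *\<^sub>R v)) v) (at b)"
    if "0 \<le> b" "b \<le> s" for b
    unfolding k_def has_real_derivative_iff_has_vector_derivative
    using sub[of a b] a that by (intro frechet_derivative_line dfu) auto
  from MVT2[OF \<open>s > 0\<close> this] obtain b where b: "0 < b" "b < s"
    "k s - k 0 = s * frechet_derivative ?fu (at (x + a *\<^sub>R u + b *\<^sub>R v)) v" by auto
  have "f (x + s *\<^sub>R u + s *\<^sub>R v) - f (x + s *\<^sub>R u) - f (x + s *\<^sub>R v) + f x = h s - h 0"
    by (simp add: h_def add_ac)
  also have "\<dots> = s * (k s - k 0)" unfolding a(3) k_def by (simp add: add_ac)
  also have "\<dots> = s\<^sup>2 * frechet_derivative ?fu (at (x + a *\<^sub>R u + b *\<^sub>R v)) v"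
    unfolding b(3) by (simp add: power2_eq_square)
  finally show ?thesis using a b by (intro exI[of _ a] exI[of _ b]) simp
qed

text \<open>The second difference is symmetric in the two directions, so that the two mixed derivatives agree at
  points which are arbitrarily close to \<open>x\<close>; by continuity they agree at \<open>x\<close>.\<close>

lemma mixed_derivatives_commute:
  fixes f :: "'a::euclidean_space \<Rightarrow> real"
  assumes f: "cn_on_open 2 W f" and W: "open W" "x \<in> W"
  shows "frechet_derivative (\<lambda>z. frechet_derivative f (at z) u) (at x) v
       = frechet_derivative (\<lambda>z. frechet_derivative f (at z) v) (at x) u"
proof -
  let ?D = "\<lambda>u v z. frechet_derivative (\<lambda>z. frechet_derivative f (at z) u) (at z) v"
  have cont: "continuous (at x) (?D u v)" for u v
    using f W by (simp add: numeral_2_eq_2 continuous_on_eq_continuous_at)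
  have "\<bar>?D u v x - ?D v u x\<bar> < 2 * e" if "e > 0" for e
  proof -
    have "\<exists>d>0. \<forall>z. dist z x < d \<longrightarrow> z \<in> W \<and> \<bar>?D u v z - ?D u v x\<bar> < e \<and> \<bar>?D v u z - ?D v u x\<bar> < e"
    proof -
      obtain d1 where d1: "d1 > 0" "\<And>z. dist z x < d1 \<Longrightarrow> z \<in> W" using W open_dist by metis
      obtain d2 where d2: "d2 > 0" "\<And>z. dist z x < d2 \<Longrightarrow> \<bar>?D u v z - ?D u v x\<bar> < e"
        using cont[of u v] \<open>e > 0\<close> unfolding continuous_at dist_real_def tendsto_iff eventually_at
        by (metis (no_types, lifting) continuous_at_eps_delta cont dist_real_def)
      obtain d3 where d3: "d3 > 0" "\<And>z. dist z x < d3 \<Longrightarrow> \<bar>?D v u z - ?D v u x\<bar> < e"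
        by (metis (no_types, lifting) continuous_at_eps_delta cont dist_real_def \<open>e > 0\<close>)
      show ?thesis using d1 d2 d3 by (intro exI[of _ "min d1 (min d2 d3)"]) auto
    qed
    then obtain d where d: "d > 0" "\<And>z. dist z x < d \<Longrightarrow> z \<in> W"
      "\<And>z. dist z x < d \<Longrightarrow> \<bar>?D u v z - ?D u v x\<bar> < e"
      "\<And>z. dist z x < d \<Longrightarrow> \<bar>?D v u z - ?D v u x\<bar> < e" by metis
    \<comment> \<open>small enough for the parallelogram spanned by \<open>s u\<close> and \<open>s v\<close> at \<open>x\<close> to lie in the ball of radius \<open>d\<close>\<close>
    define n where "n = norm u + norm v + 1"
    define s where "s = d / (2 * n)"
    have "n > 0" unfolding n_def by (smt (verit) norm_ge_zero)
    then have s: "s > 0" and s': "s * n = d / 2" unfolding s_def using d(1) by simp_all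
    have near: "dist (x + a *\<^sub>R u + b *\<^sub>R v) x < d" if "0 \<le> a" "a \<le> s" "0 \<le> b" "b \<le> s" for a b
    proof -
      have "dist (x + a *\<^sub>R u + b *\<^sub>R v) x = norm (a *\<^sub>R u + b *\<^sub>R v)" by (simp add: dist_norm)
      also have "\<dots> \<le> a * norm u + b * norm v" using that by (metis abs_of_nonneg norm_scaleR norm_triangle_ineq)
      also have "\<dots> \<le> s * norm u + s * norm v" using that by (intro add_mono mult_right_mono) auto
      also have "\<dots> < d" using s s' d(1) by (simp add: n_def algebra_simps)
      finally show ?thesis .
    qed
    have near': "dist (x + a *\<^sub>R v + b *\<^sub>R u) x < d" if "0 \<le> a" "a \<le> s" "0 \<le> b" "b \<le> s" for a b
      using near[of b a] that by (simp add: add_ac)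
    obtain a b where ab: "0 \<le> a" "a \<le> s" "0 \<le> b" "b \<le> s"
      "f (x + s *\<^sub>R u + s *\<^sub>R v) - f (x + s *\<^sub>R u) - f (x + s *\<^sub>R v) + f x
        = s\<^sup>2 * ?D u v (x + a *\<^sub>R u + b *\<^sub>R v)"
      using second_difference_mean_value[OF f s, of x u v, OF d(2)[OF near]] by blast
    obtain a' b' where ab': "0 \<le> a'" "a' \<le> s" "0 \<le> b'" "b' \<le> s"
      "f (x + s *\<^sub>R v + s *\<^sub>R u) - f (x + s *\<^sub>R v) - f (x + s *\<^sub>R u) + f x
        = s\<^sup>2 * ?D v u (x + a' *\<^sub>R v + b' *\<^sub>R u)"
      using second_difference_mean_value[OF f s, of x v u, OF d(2)[OF near']] by blast
    have "s\<^sup>2 * ?D u v (x + a *\<^sub>R u + b *\<^sub>R v) = s\<^sup>2 * ?D v u (x + a' *\<^sub>R v + b' *\<^sub>R u)"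
    proof -
      have "f (x + s *\<^sub>R v + s *\<^sub>R u) = f (x + s *\<^sub>R u + s *\<^sub>R v)" by (simp add: add_ac)
      then show ?thesis using ab(5) ab'(5) by linarith
    qed
    then have "?D u v (x + a *\<^sub>R u + b *\<^sub>R v) = ?D v u (x + b' *\<^sub>R u + a' *\<^sub>R v)" using s by (simp add: add_ac)
    then show ?thesis
      using d(3)[OF near[OF ab(1-4)]] d(4)[OF near[OF ab'(3,4,1,2)]] by linarith
  qed
  from this[of "\<bar>?D u v x - ?D v u x\<bar> / 2"] show ?thesis by fastforce
qed


section \<open>Families of multilinear maps along curves\<close>

lemma has_vector_derivative_transform_eventually:
  assumes "(f has_vector_derivative D) (at t within S)"
    and "\<forall>\<^sub>F s in nhds t. s \<in> S \<longrightarrow> f s = g s" and "f t = g t"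
  shows "(g has_vector_derivative D) (at t within S)"
  using has_vector_derivative_cong_ev[OF assms(2,3)] assms(1) by simp

text \<open>Linear and bilinear maps depending on a point are handled through their coefficients in the standard
  basis. The linear case is the bilinear one with the scalar \<open>1\<close> in the other slot.\<close>

lemma linear_family_expand:
  fixes L :: "'e::euclidean_space \<Rightarrow> 'c::real_vector"
  assumes "linear L"
  shows "L u = (\<Sum>i\<in>Basis. (u \<bullet> i) *\<^sub>R L i)"
proof -
  have "L u = L (\<Sum>i\<in>Basis. (u \<bullet> i) *\<^sub>R i)" by (simp add: euclidean_representation)
  then show ?thesis by (simp add: linear_sum[OF assms] linear_cmul[OF assms])
qed

lemma bilinear_family_expand:
  fixes B :: "'d::euclidean_space \<Rightarrow> 'f::euclidean_space \<Rightarrow> 'c::real_vector"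
  assumes "bilinear B"
  shows "B u v = (\<Sum>i\<in>Basis. \<Sum>j\<in>Basis. ((u \<bullet> i) * (v \<bullet> j)) *\<^sub>R B i j)"
proof -
  have l: "linear (B e)" "linear (\<lambda>e. B e f)" for e f using assms by (auto simp: bilinear_def)
  show ?thesis
    using linear_family_expand[OF l(2), of u v] linear_family_expand[OF l(1), of _ v]
    by (simp add: scaleR_sum_right)
qed

lemma bilinear_scaleR_family: "linear L \<Longrightarrow> bilinear (\<lambda>r. (*\<^sub>R) r \<circ> L)"
  by (auto simp: bilinear_def o_def linear_add linear_cmul algebra_simps intro!: linearI)

lemma bilinear_family_continuous_on:
  fixes B :: "'e::topological_space \<Rightarrow> 'd::euclidean_space \<Rightarrow> 'f::euclidean_space \<Rightarrow> 'c::real_normed_vector"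
  assumes lin: "\<And>y. y \<in> U \<Longrightarrow> bilinear (B y)" and B: "\<And>e f. continuous_on U (\<lambda>y. B y e f)"
    and z: "continuous_on S z" "\<And>s. s \<in> S \<Longrightarrow> z s \<in> U" and u: "continuous_on S u" and v: "continuous_on S v"
  shows "continuous_on S (\<lambda>s. B (z s) (u s) (v s))"
proof -
  have "continuous_on S (\<lambda>s. \<Sum>i\<in>Basis. \<Sum>j\<in>Basis. ((u s \<bullet> i) * (v s \<bullet> j)) *\<^sub>R B (z s) i j)"
    using continuous_on_compose2[OF B z(1)] z(2) by (intro continuous_intros u v) auto
  then show ?thesis
    by (rule continuous_on_eq) (rule bilinear_family_expand[OF lin[OF z(2)], symmetric])
qed

lemma linear_family_continuous_on:
  fixes L :: "'e::topological_space \<Rightarrow> 'd::euclidean_space \<Rightarrow> 'c::real_normed_vector"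
  assumes lin: "\<And>y. y \<in> U \<Longrightarrow> linear (L y)" and L: "\<And>e. continuous_on U (\<lambda>y. L y e)"
    and z: "continuous_on S z" "\<And>s. s \<in> S \<Longrightarrow> z s \<in> U" and u: "continuous_on S u"
  shows "continuous_on S (\<lambda>s. L (z s) (u s))"
  using bilinear_family_continuous_on[where B="\<lambda>y r. (*\<^sub>R) r \<circ> L y", OF bilinear_scaleR_family[OF lin] _ z
      continuous_on_const[of _ "1::real"] u] continuous_on_scaleR[OF continuous_on_const L] by (simp add: o_def)

lemma bilinear_family_derivative:
  fixes B :: "'e::euclidean_space \<Rightarrow> 'd::euclidean_space \<Rightarrow> 'f::euclidean_space \<Rightarrow> 'c::real_normed_vector"
  assumes U: "open U" and lin: "\<And>y. y \<in> U \<Longrightarrow> bilinear (B y)"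
    and dB: "\<And>y e f. y \<in> U \<Longrightarrow> (\<lambda>y. B y e f) differentiable (at y)"
    and z: "(z has_vector_derivative z') (at t within S)" and zt: "z t \<in> U"
    and u: "(u has_vector_derivative u') (at t within S)"
    and v: "(v has_vector_derivative v') (at t within S)"
  shows "((\<lambda>s. B (z s) (u s) (v s)) has_vector_derivative
      (frechet_derivative (\<lambda>y. B y (u t) (v t)) (at (z t)) z' + B (z t) u' (v t) + B (z t) (u t) v'))
      (at t within S)"
proof -
  define D where "D e f = frechet_derivative (\<lambda>y. B y e f) (at (z t))" for e f
  have D: "((\<lambda>y. B y e f) has_derivative D e f) (at (z t))" for e f
    unfolding D_def using dB[OF zt] by (simp add: frechet_derivative_works)
  have Dz: "((\<lambda>s. B (z s) e f) has_vector_derivative D e f z') (at t within S)" for e f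
    using has_derivative_compose[OF z[unfolded has_vector_derivative_def] D[of e f]]
    by (simp add: has_vector_derivative_def linear_cmul[OF has_derivative_linear[OF D]])
  have "((\<lambda>y. \<Sum>i\<in>Basis. \<Sum>j\<in>Basis. ((u t \<bullet> i) * (v t \<bullet> j)) *\<^sub>R B y i j) has_derivative
      (\<lambda>h. \<Sum>i\<in>Basis. \<Sum>j\<in>Basis. ((u t \<bullet> i) * (v t \<bullet> j)) *\<^sub>R D i j h)) (at (z t))"
    by (intro has_derivative_sum has_derivative_scaleR_right D)
  then have "((\<lambda>y. B y (u t) (v t)) has_derivative
      (\<lambda>h. \<Sum>i\<in>Basis. \<Sum>j\<in>Basis. ((u t \<bullet> i) * (v t \<bullet> j)) *\<^sub>R D i j h)) (at (z t))"
    by (rule has_derivative_transform_within_open[OF _ U zt]) (rule bilinear_family_expand[OF lin, symmetric])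
  then have Du: "D (u t) (v t) z' = (\<Sum>i\<in>Basis. \<Sum>j\<in>Basis. ((u t \<bullet> i) * (v t \<bullet> j)) *\<^sub>R D i j z')"
    unfolding D_def[of "u t" "v t"] by (rule fun_cong[OF frechet_derivative_at[symmetric]])
  have comp: "((\<lambda>s. f s \<bullet> i) has_real_derivative f' \<bullet> i) (at t within S)"
    if "(f has_vector_derivative f') (at t within S)" for f f' and i :: "'a::euclidean_space"
    using bounded_linear.has_vector_derivative[OF bounded_linear_inner_left that]
    by (simp add: has_real_derivative_iff_has_vector_derivative)
  have "((\<lambda>s. \<Sum>i\<in>Basis. \<Sum>j\<in>Basis. ((u s \<bullet> i) * (v s \<bullet> j)) *\<^sub>R B (z s) i j) has_vector_derivative
      (\<Sum>i\<in>Basis. \<Sum>j\<in>Basis. ((u t \<bullet> i) * (v t \<bullet> j)) *\<^sub>R D i j z'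
        + ((u' \<bullet> i) * (v t \<bullet> j) + (v' \<bullet> j) * (u t \<bullet> i)) *\<^sub>R B (z t) i j)) (at t within S)"
    by (intro has_vector_derivative_sum has_vector_derivative_scaleR DERIV_mult comp u v Dz)
  then have "((\<lambda>s. B (z s) (u s) (v s)) has_vector_derivative
      (\<Sum>i\<in>Basis. \<Sum>j\<in>Basis. ((u t \<bullet> i) * (v t \<bullet> j)) *\<^sub>R D i j z'
        + ((u' \<bullet> i) * (v t \<bullet> j) + (v' \<bullet> j) * (u t \<bullet> i)) *\<^sub>R B (z t) i j)) (at t within S)"
  proof (rule has_vector_derivative_transform_eventually)
    have "continuous (at t within S) z" using z by (rule has_vector_derivative_continuous)
    then have "\<forall>\<^sub>F s in at t within S. z s \<in> U"
      using U zt by (simp add: continuous_within topological_tendstoD)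
    then have "\<forall>\<^sub>F s in nhds t. s \<in> S \<longrightarrow> z s \<in> U"
      unfolding eventually_at_filter by (rule eventually_mono) (use zt in auto)
    then show "\<forall>\<^sub>F s in nhds t. s \<in> S \<longrightarrow>
        (\<Sum>i\<in>Basis. \<Sum>j\<in>Basis. ((u s \<bullet> i) * (v s \<bullet> j)) *\<^sub>R B (z s) i j) = B (z s) (u s) (v s)"
      by (rule eventually_mono) (simp add: bilinear_family_expand[OF lin, of _ "u _", symmetric])
  qed (rule bilinear_family_expand[OF lin[OF zt], symmetric])
  then show ?thesis
    unfolding bilinear_family_expand[OF lin[OF zt], of u'] bilinear_family_expand[OF lin[OF zt], of _ v']
      D_def[symmetric] Du
    by (simp add: sum.distrib scaleR_add_left mult.commute add_ac)
qed

lemma linear_family_derivative: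
  fixes L :: "'e::euclidean_space \<Rightarrow> 'd::euclidean_space \<Rightarrow> 'c::real_normed_vector"
  assumes U: "open U" and lin: "\<And>y. y \<in> U \<Longrightarrow> linear (L y)"
    and dL: "\<And>y e. y \<in> U \<Longrightarrow> (\<lambda>y. L y e) differentiable (at y)"
    and z: "(z has_vector_derivative z') (at t within S)" and zt: "z t \<in> U"
    and u: "(u has_vector_derivative u') (at t within S)"
  shows "((\<lambda>s. L (z s) (u s)) has_vector_derivative
      (frechet_derivative (\<lambda>y. L y (u t)) (at (z t)) z' + L (z t) u')) (at t within S)"
  using bilinear_family_derivative[where B="\<lambda>y r. (*\<^sub>R) r \<circ> L y", OF U bilinear_scaleR_family[OF lin] _ z zt
      has_vector_derivative_const[of "1::real"] u] differentiable_scaleR[OF differentiable_const dL] by (simp add: o_def)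


section \<open>Riemannian geometry in one coordinate system\<close>

text \<open>A metric and its Christoffel symbols on an open set \<open>U\<close>, as bilinear maps depending on the point. The
  last axiom is the coordinate form of \<open>\<nabla>g = 0\<close>.\<close>

locale coord_metric =
  fixes U :: "'e::euclidean_space set" and G :: "'e \<Rightarrow> 'e \<Rightarrow> 'e \<Rightarrow> real" and Gam :: "'e \<Rightarrow> 'e \<Rightarrow> 'e \<Rightarrow> 'e"
  assumes open_U: "open U"
    and bilin_G: "y \<in> U \<Longrightarrow> bilinear (G y)"
    and sym_G: "y \<in> U \<Longrightarrow> G y u v = G y v u"
    and pos_G: "y \<in> U \<Longrightarrow> u \<noteq> 0 \<Longrightarrow> 0 < G y u u"
    and smooth_G: "ck_on \<infinity> U (\<lambda>y. G y u v)"
    and bilin_Gam: "y \<in> U \<Longrightarrow> bilinear (Gam y)"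
    and sym_Gam: "y \<in> U \<Longrightarrow> Gam y u v = Gam y v u"
    and smooth_Gam: "ck_on \<infinity> U (\<lambda>y. Gam y u v)"
    and compat: "y \<in> U \<Longrightarrow>
      frechet_derivative (\<lambda>z. G z u v) (at y) w = G y (Gam y w u) v + G y u (Gam y w v)"
begin

text \<open>The direction of differentiation comes first.\<close>

definition dGam :: "'e \<Rightarrow> 'e \<Rightarrow> 'e \<Rightarrow> 'e \<Rightarrow> 'e" where
  "dGam y w u v = frechet_derivative (\<lambda>z. Gam z u v) (at y) w"

text \<open>The coordinate expression of the curvature tensor \<open>R(a,b)c\<close>.\<close>

definition Riem :: "'e \<Rightarrow> 'e \<Rightarrow> 'e \<Rightarrow> 'e \<Rightarrow> 'e" where
  "Riem y a b c = dGam y a b c - dGam y b a c + Gam y a (Gam y b c) - Gam y b (Gam y a c)"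

lemma G_diff: "y \<in> U \<Longrightarrow> (\<lambda>z. G z u v) differentiable (at y)"
  using ck_on_differentiable[OF smooth_G open_U] by simp

lemma Gam_diff: "y \<in> U \<Longrightarrow> (\<lambda>z. Gam z u v) differentiable (at y)"
  using ck_on_differentiable[OF smooth_Gam open_U] by simp

lemma G_linear: "y \<in> U \<Longrightarrow> linear (G y u)" "y \<in> U \<Longrightarrow> linear (\<lambda>u. G y u v)"
  using bilin_G by (auto simp: bilinear_def)

lemmas G_simps = bilinear_ladd[OF bilin_G] bilinear_radd[OF bilin_G] bilinear_lsub[OF bilin_G]
  bilinear_rsub[OF bilin_G] bilinear_lmul[OF bilin_G] bilinear_rmul[OF bilin_G] bilinear_lneg[OF bilin_G]
  bilinear_rneg[OF bilin_G] bilinear_lzero[OF bilin_G] bilinear_rzero[OF bilin_G]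

lemmas Gam_simps = bilinear_ladd[OF bilin_Gam] bilinear_radd[OF bilin_Gam] bilinear_lsub[OF bilin_Gam]
  bilinear_rsub[OF bilin_Gam] bilinear_lmul[OF bilin_Gam] bilinear_rmul[OF bilin_Gam]
  bilinear_lneg[OF bilin_Gam] bilinear_rneg[OF bilin_Gam] bilinear_lzero[OF bilin_Gam] bilinear_rzero[OF bilin_Gam]

lemma Gam_derivative_along:
  assumes "(z has_vector_derivative z') (at t within S)" "z t \<in> U"
    "(u has_vector_derivative u') (at t within S)" "(v has_vector_derivative v') (at t within S)"
  shows "((\<lambda>s. Gam (z s) (u s) (v s)) has_vector_derivative
    (dGam (z t) z' (u t) (v t) + Gam (z t) u' (v t) + Gam (z t) (u t) v')) (at t within S)"
  unfolding dGam_def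
  by (rule bilinear_family_derivative[OF open_U bilin_Gam Gam_diff assms])

text \<open>The product rule for covariant derivatives along the curve \<open>z\<close>: compatibility absorbs the derivative
  of the coefficients of \<open>G\<close>.\<close>

lemma G_derivative_along:
  assumes "(z has_vector_derivative z') (at t within S)" "z t \<in> U"
    "(u has_vector_derivative u') (at t within S)" "(v has_vector_derivative v') (at t within S)"
  shows "((\<lambda>s. G (z s) (u s) (v s)) has_vector_derivative
    (G (z t) (u' + Gam (z t) z' (u t)) (v t) + G (z t) (u t) (v' + Gam (z t) z' (v t)))) (at t within S)"
  using bilinear_family_derivative[OF open_U bilin_G G_diff assms]
  by (simp add: compat[OF assms(2)] G_simps[OF assms(2)] algebra_simps)

lemma dGam_sym: "y \<in> U \<Longrightarrow> dGam y w u v = dGam y w v u"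
  unfolding dGam_def
  by (rule fun_cong[OF frechet_derivative_cong_open[OF open_U]]) (auto simp: sym_Gam)

lemma dGam_linear:
  assumes y: "y \<in> U"
  shows "linear (\<lambda>w. dGam y w u v)" "bilinear (dGam y w)"
proof -
  show 1: "linear (\<lambda>w. dGam y w u v)" for u v
    unfolding dGam_def using linear_frechet_derivative[OF Gam_diff[OF y]] by simp
  have D: "((\<lambda>z. Gam z u v) has_derivative (\<lambda>w. dGam y w u v)) (at y)" for u v
    unfolding dGam_def using Gam_diff[OF y] by (simp add: frechet_derivative_works)
  have add: "dGam y w (u + u') v = dGam y w u v + dGam y w u' v" for u u' v
  proof -
    have "((\<lambda>z. Gam z (u + u') v) has_derivative (\<lambda>w. dGam y w u v + dGam y w u' v)) (at y)"
      by (rule has_derivative_transform_within_open[OF has_derivative_add[OF D D] open_U y])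
        (simp add: Gam_simps)
    from frechet_derivative_at[OF this] show ?thesis unfolding dGam_def by metis
  qed
  have scale: "dGam y w (r *\<^sub>R u) v = r *\<^sub>R dGam y w u v" for r u v
  proof -
    have "((\<lambda>z. Gam z (r *\<^sub>R u) v) has_derivative (\<lambda>w. r *\<^sub>R dGam y w u v)) (at y)"
      by (rule has_derivative_transform_within_open[OF has_derivative_scaleR_right[OF D] open_U y])
        (simp add: Gam_simps)
    from frechet_derivative_at[OF this] show ?thesis unfolding dGam_def by metis
  qed
  have l: "linear (\<lambda>u. dGam y w u v)" for v
    by (rule linearI) (simp_all add: add scale)
  have r: "linear (dGam y w u)" for u
  proof (rule linearI)
    fix b c :: 'e and k :: real
    have "dGam y w u (b + c) = dGam y w b u + dGam y w c u"
      by (rule trans[OF dGam_sym[OF y] add])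
    then show "dGam y w u (b + c) = dGam y w u b + dGam y w u c"
      by (simp only: dGam_sym[OF y, of w b u] dGam_sym[OF y, of w c u])
    have "dGam y w u (k *\<^sub>R b) = k *\<^sub>R dGam y w b u"
      by (rule trans[OF dGam_sym[OF y] scale])
    then show "dGam y w u (k *\<^sub>R b) = k *\<^sub>R dGam y w u b"
      by (simp only: dGam_sym[OF y, of w b u])
  qed
  show "bilinear (dGam y w)"
    unfolding bilinear_def by (intro conjI allI l r)
qed

lemma Riem_swap: "Riem y a b c = - Riem y b a c"
  by (simp add: Riem_def)

lemma Riem_Bianchi: "y \<in> U \<Longrightarrow> Riem y a b c + Riem y b c a + Riem y c a b = 0"
  by (simp add: Riem_def dGam_sym[of y a c b] dGam_sym[of y b c a] dGam_sym[of y c b a]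
      sym_Gam[of y c b] sym_Gam[of y c a] sym_Gam[of y b a])

text \<open>Differentiating the compatibility of \<open>G\<close> with the connection once more, the commutation of the
  second derivatives of \<open>G\<close> says that curvature operators are skew.\<close>

lemma Riem_skew:
  assumes y: "y \<in> U"
  shows "G y (Riem y a b c) d = - G y c (Riem y a b d)"
proof -
  have second: "frechet_derivative (\<lambda>z. frechet_derivative (\<lambda>z. G z c d) (at z) b) (at y) a
    = G y (dGam y a b c + Gam y a (Gam y b c)) d + G y (Gam y b c) (Gam y a d)
      + G y (Gam y a c) (Gam y b d) + G y c (dGam y a b d + Gam y a (Gam y b d))" for a b
  proof -
    let ?f = "\<lambda>z. frechet_derivative (\<lambda>z. G z c d) (at z) b"
    let ?k = "\<lambda>z. G z (Gam z b c) d + G z c (Gam z b d)"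
    have f: "?f differentiable (at y)"
      using ck_on_differentiable[OF ck_on_frechet_derivative[OF smooth_G open_U] open_U y] by simp
    have l: "((\<lambda>s. y + s *\<^sub>R a) has_vector_derivative a) (at 0)"
      by (auto intro!: derivative_eq_intros)
    have g: "((\<lambda>s. Gam (y + s *\<^sub>R a) b e) has_vector_derivative dGam y a b e) (at 0)" for e
      using Gam_derivative_along[OF l _ has_vector_derivative_const has_vector_derivative_const, of b e] y
      by (simp add: Gam_simps)
    have "((\<lambda>s. ?k (y + s *\<^sub>R a)) has_vector_derivative
      (G y (dGam y a b c + Gam y a (Gam y b c)) d + G y (Gam y b c) (Gam y a d))
      + (G y (Gam y a c) (Gam y b d) + G y c (dGam y a b d + Gam y a (Gam y b d)))) (at 0)"
      using G_derivative_along[OF l _ g has_vector_derivative_const, of c d]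
        G_derivative_along[OF l _ has_vector_derivative_const g, of c d] y
      by (intro has_vector_derivative_add) simp_all
    moreover have "((\<lambda>s. ?f (y + s *\<^sub>R a)) has_vector_derivative frechet_derivative ?f (at y) a) (at 0)"
      using frechet_derivative_line[of ?f y 0 a UNIV] f by simp
    moreover have "\<forall>\<^sub>F s in nhds 0. s \<in> UNIV \<longrightarrow> ?f (y + s *\<^sub>R a) = ?k (y + s *\<^sub>R a)"
    proof -
      have "open ((\<lambda>s::real. y + s *\<^sub>R a) -` U)" by (intro open_vimage open_U continuous_intros)
      then have "\<forall>\<^sub>F s in nhds 0. y + s *\<^sub>R a \<in> U"
        unfolding eventually_nhds by (intro exI[of _ "(\<lambda>s::real. y + s *\<^sub>R a) -` U"]) (use y in auto)
      then show ?thesis by (rule eventually_mono) (simp add: compat)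
    qed
    ultimately show ?thesis
      using vector_derivative_unique_at[OF has_vector_derivative_transform_eventually[of
            "\<lambda>s. ?f (y + s *\<^sub>R a)" _ 0 UNIV "\<lambda>s. ?k (y + s *\<^sub>R a)"]] compat[OF y]
      by (simp add: add.assoc)
  qed
  have "cn_on_open 2 U (\<lambda>z. G z c d)" using ck_on_open_iff[OF open_U, of \<infinity> "\<lambda>z. G z c d"] smooth_G by simp
  from mixed_derivatives_commute[OF this open_U y, of b a] second[of a b] second[of b a]
  show ?thesis by (simp add: Riem_def G_simps[OF y] algebra_simps)
qed

text \<open>The classical combination of four instances of the Bianchi identity, in which the skew symmetries
  cancel all terms but the two that are compared.\<close>

lemma Riem_pair_symmetric:
  assumes y: "y \<in> U"
  shows "G y (Riem y a b c) d = G y (Riem y c d a) b"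
proof -
  define K where "K a b c d = G y (Riem y a b c) d" for a b c d
  have sw: "K a b c d = - K b a c d" for a b c d
    unfolding K_def by (subst Riem_swap) (simp add: G_simps[OF y])
  have sk: "K a b c d = - K a b d c" for a b c d
    unfolding K_def using Riem_skew[OF y, of a b c d] sym_G[OF y, of c "Riem y a b d"] by (simp only:)
  have bi: "K a b c d + K b c a d + K c a b d = 0" for a b c d
    using arg_cong[OF Riem_Bianchi[OF y, of a b c], of "\<lambda>e. G y e d"] by (simp add: K_def G_simps[OF y])
  have "K a b c d + K b c a d + K c a b d = 0" by (rule bi)
  moreover have "K b c a d + K c d a b + K b d c a = 0"
    using bi[of b c d a] sk[of b c d a] sk[of c d b a] sw[of d b c a] by linarith
  moreover have "K c d a b + K a d b c + K c a b d = 0"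
    using bi[of c d a b] sw[of d a c b] sk[of a d c b] sw[of a c d b] sk[of c a d b] by linarith
  moreover have "K a d b c + K a b c d + K b d c a = 0"
    using bi[of d a b c] sw[of d a b c] sk[of a b d c] sk[of b d a c] by linarith
  ultimately have "K a b c d = K c d a b" by linarith
  then show ?thesis by (simp only: K_def)
qed


lemma continuous_G: "continuous_on S z \<Longrightarrow> (\<And>s. s \<in> S \<Longrightarrow> z s \<in> U) \<Longrightarrow> continuous_on S u \<Longrightarrow>
    continuous_on S v \<Longrightarrow> continuous_on S (\<lambda>s. G (z s) (u s) (v s))"
  by (rule bilinear_family_continuous_on[OF bilin_G ck_on_continuous[OF smooth_G]])

lemma continuous_Gam: "continuous_on S z \<Longrightarrow> (\<And>s. s \<in> S \<Longrightarrow> z s \<in> U) \<Longrightarrow> continuous_on S u \<Longrightarrow>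
    continuous_on S v \<Longrightarrow> continuous_on S (\<lambda>s. Gam (z s) (u s) (v s))"
  by (rule bilinear_family_continuous_on[OF bilin_Gam ck_on_continuous[OF smooth_Gam]])

lemma continuous_dGam:
  assumes z: "continuous_on S z" "\<And>s. s \<in> S \<Longrightarrow> z s \<in> U" and w: "continuous_on S w"
    and uv: "continuous_on S u" "continuous_on S v"
  shows "continuous_on S (\<lambda>s. dGam (z s) (w s) (u s) (v s))"
proof -
  have "continuous_on U (\<lambda>y. dGam y i e f)" for i e f
    unfolding dGam_def by (rule ck_on_continuous[OF ck_on_frechet_derivative[OF smooth_Gam open_U]])
  then have "continuous_on S (\<lambda>s. \<Sum>i\<in>Basis. (w s \<bullet> i) *\<^sub>R dGam (z s) i (u s) (v s))"
    by (intro continuous_intros w bilinear_family_continuous_on[OF dGam_linear(2) _ z uv])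
  then show ?thesis
    by (rule continuous_on_eq)
      (simp add: linear_family_expand[OF dGam_linear(1)[OF z(2)], of _ "w _", symmetric])
qed

section \<open>The first variation in coordinates\<close>

text \<open>The Lagrangian at position \<open>y\<close>, velocity \<open>v\<close> and coordinate acceleration \<open>a\<close>, and its derivative in
  the direction \<open>(e, e1, e2)\<close>; thanks to compatibility the latter involves \<open>G\<close> only through its values.\<close>

definition acc :: "'e \<Rightarrow> 'e \<Rightarrow> 'e \<Rightarrow> 'e" where
  "acc y v a = a + Gam y v v"

definition Lag :: "real \<Rightarrow> ('e \<Rightarrow> real) \<Rightarrow> 'e \<Rightarrow> 'e \<Rightarrow> 'e \<Rightarrow> real" where
  "Lag \<sigma> W y v a = 1/2 * (G y (acc y v a) (acc y v a) + \<sigma> * G y v v + W y)"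

definition dLag :: "real \<Rightarrow> ('e \<Rightarrow> real) \<Rightarrow> 'e \<Rightarrow> 'e \<Rightarrow> 'e \<Rightarrow> 'e \<Rightarrow> 'e \<Rightarrow> 'e \<Rightarrow> real" where
  "dLag \<sigma> W y v a e e1 e2 =
     G y (acc y v a) (e2 + dGam y e v v + 2 *\<^sub>R Gam y v e1 + Gam y e (acc y v a))
     + \<sigma> * G y v (e1 + Gam y e v) + 1/2 * frechet_derivative W (at y) e"

lemma Lag_has_derivative:
  assumes W: "ck_on 2 U W" and y: "y + r *\<^sub>R e \<in> U"
  shows "((\<lambda>r. Lag \<sigma> W (y + r *\<^sub>R e) (v + r *\<^sub>R e1) (a + r *\<^sub>R e2)) has_real_derivative
    dLag \<sigma> W (y + r *\<^sub>R e) (v + r *\<^sub>R e1) (a + r *\<^sub>R e2) e e1 e2) (at r within R)"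
proof -
  define z where "z r = y + r *\<^sub>R e" for r
  define u where "u r = v + r *\<^sub>R e1" for r
  define b where "b r = a + r *\<^sub>R e2" for r
  note zub = z_def[abs_def] u_def[abs_def] b_def[abs_def]
  have z: "(z has_vector_derivative e) (at r within R)" and u: "(u has_vector_derivative e1) (at r within R)"
    and b: "(b has_vector_derivative e2) (at r within R)"
    unfolding zub by (auto intro!: derivative_eq_intros)
  have zU: "z r \<in> U" using y by (simp add: z_def)
  have Wd: "W differentiable (at (z r))" using ck_on_differentiable[OF W open_U zU] by (simp add: one_enat_def numeral_eq_enat)
  have "((\<lambda>r. W (z r)) has_vector_derivative frechet_derivative W (at (z r)) e) (at r within R)"
    unfolding z_def by (rule frechet_derivative_line) (use Wd in \<open>simp add: z_def\<close>)
  moreover have H: "((\<lambda>r. acc (z r) (u r) (b r)) has_vector_derivative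
      e2 + (dGam (z r) e (u r) (u r) + Gam (z r) e1 (u r) + Gam (z r) (u r) e1)) (at r within R)"
    unfolding acc_def by (intro has_vector_derivative_add b Gam_derivative_along z zU u)
  note d1 = G_derivative_along[OF z zU H H] and d2 = G_derivative_along[OF z zU u u]
  moreover note has_vector_derivative_mult_right[OF has_vector_derivative_add[OF has_vector_derivative_add[OF
        d1 has_vector_derivative_mult_right[OF d2, of \<sigma>]] calculation(1)], of "1/2"]
  ultimately have "((\<lambda>r. Lag \<sigma> W (z r) (u r) (b r)) has_vector_derivative
     dLag \<sigma> W (z r) (u r) (b r) e e1 e2) (at r within R)"
    unfolding Lag_def
    by (simp add: dLag_def G_simps[OF zU] sym_Gam[OF zU, of e1] sym_G[OF zU, of _ "u r"]
        sym_G[OF zU, of _ "acc (z r) (u r) (b r)"] algebra_simps scaleR_2)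
  then show ?thesis unfolding zub has_real_derivative_iff_has_vector_derivative .
qed

lemma continuous_acc: "continuous_on S z \<Longrightarrow> (\<And>s. s \<in> S \<Longrightarrow> z s \<in> U) \<Longrightarrow> continuous_on S u \<Longrightarrow>
    continuous_on S b \<Longrightarrow> continuous_on S (\<lambda>s. acc (z s) (u s) (b s))"
  unfolding acc_def by (intro continuous_intros continuous_Gam)

lemma continuous_Lag:
  assumes "continuous_on U W" "continuous_on S z" "\<And>s. s \<in> S \<Longrightarrow> z s \<in> U" "continuous_on S u" "continuous_on S b"
  shows "continuous_on S (\<lambda>s. Lag \<sigma> W (z s) (u s) (b s))"
  unfolding Lag_def using assms
  by (intro continuous_intros continuous_G continuous_acc continuous_on_compose2[OF assms(1)]) auto

lemma continuous_dW:
  assumes W: "ck_on 2 U W" and z: "continuous_on S z" "\<And>s. s \<in> S \<Longrightarrow> z s \<in> U" and "continuous_on S e"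
  shows "continuous_on S (\<lambda>s. frechet_derivative W (at (z s)) (e s))"
proof (rule linear_family_continuous_on[OF _ _ z assms(4)])
  have W1: "ck_on (enat (Suc 1)) U W" using W by (simp add: numeral_eq_enat numeral_2_eq_2)
  show "linear (frechet_derivative W (at y))" if "y \<in> U" for y
    using ck_on_differentiable[OF W open_U that]
    by (auto simp: one_enat_def numeral_eq_enat intro: linear_frechet_derivative)
  show "continuous_on U (\<lambda>y. frechet_derivative W (at y) e)" for e
    using ck_on_continuous[OF ck_on_frechet_derivative_Suc[OF W1 open_U]] .
qed

lemma continuous_dLag:
  assumes W: "ck_on 2 U W" and z: "continuous_on S z" "\<And>s. s \<in> S \<Longrightarrow> z s \<in> U"
    and c: "continuous_on S u" "continuous_on S b" "continuous_on S e" "continuous_on S e1" "continuous_on S e2"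
  shows "continuous_on S (\<lambda>s. dLag \<sigma> W (z s) (u s) (b s) (e s) (e1 s) (e2 s))"
  unfolding dLag_def using assms
  by (intro continuous_intros continuous_G continuous_acc continuous_Gam continuous_dGam continuous_dW[OF W]) auto

text \<open>With \<open>D\<close> the covariant derivative along the curve and \<open>H = D v\<close>, the derivative of the Lagrangian in the
  direction \<open>\<eta>\<close> is \<open>G(H, D\<^sup>2\<eta> + R(\<eta>,v)v) + \<sigma> G(v, D\<eta>) + dW(\<eta>)/2\<close>. By the pair symmetry of the
  curvature and metric compatibility it equals the pairing of the Euler-Lagrange expression with \<open>\<eta>\<close> plus the
  time derivative of the boundary term \<open>G(H, D\<eta>) - G(DH, \<eta>) + \<sigma> G(v, \<eta>)\<close>.\<close>

definition EL :: "real \<Rightarrow> ('e \<Rightarrow> real) \<Rightarrow> 'e \<Rightarrow> 'e \<Rightarrow> 'e \<Rightarrow> 'e \<Rightarrow> 'e \<Rightarrow> real" where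
  "EL \<sigma> W y v H D4 e = G y (D4 + Riem y H v v - \<sigma> *\<^sub>R H) e + 1/2 * frechet_derivative W (at y) e"

definition bdry :: "real \<Rightarrow> 'e \<Rightarrow> 'e \<Rightarrow> 'e \<Rightarrow> 'e \<Rightarrow> 'e \<Rightarrow> 'e \<Rightarrow> real" where
  "bdry \<sigma> y v H D3 e e1 = G y H (e1 + Gam y v e) - G y D3 e + \<sigma> * G y v e"

lemma bdry_derivative:
  assumes yU: "y t \<in> U"
    and y: "(y has_vector_derivative v t) (at t within I)" and v: "(v has_vector_derivative a t) (at t within I)"
    and H: "H t = acc (y t) (v t) (a t)" "(H has_vector_derivative H') (at t within I)"
    and D3: "D3 t = H' + Gam (y t) (v t) (H t)" "(D3 has_vector_derivative D3') (at t within I)"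
    and D4: "D4 = D3' + Gam (y t) (v t) (D3 t)"
    and e: "(e has_vector_derivative e1 t) (at t within I)" "(e1 has_vector_derivative e2) (at t within I)"
  shows "((\<lambda>t. bdry \<sigma> (y t) (v t) (H t) (D3 t) (e t) (e1 t)) has_real_derivative
    dLag \<sigma> W (y t) (v t) (a t) (e t) (e1 t) e2 - EL \<sigma> W (y t) (v t) (H t) D4 (e t)) (at t within I)"
proof -
  have De: "((\<lambda>t. e1 t + Gam (y t) (v t) (e t)) has_vector_derivative
      e2 + (dGam (y t) (v t) (v t) (e t) + Gam (y t) (a t) (e t) + Gam (y t) (v t) (e1 t))) (at t within I)"
    by (intro has_vector_derivative_add e Gam_derivative_along y yU v)
  have sR: "G (y t) (Riem (y t) (H t) (v t) (v t)) (e t) = G (y t) (H t) (Riem (y t) (e t) (v t) (v t))"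
  proof -
    have "G (y t) (Riem (y t) (e t) (v t) (v t)) (H t) = G (y t) (Riem (y t) (v t) (H t) (e t)) (v t)"
      by (rule Riem_pair_symmetric[OF yU])
    also have "\<dots> = - G (y t) (Riem (y t) (H t) (v t) (e t)) (v t)"
      by (subst Riem_swap) (simp add: G_simps[OF yU])
    also have "\<dots> = G (y t) (Riem (y t) (H t) (v t) (v t)) (e t)"
      using Riem_skew[OF yU, of "H t" "v t" "v t" "e t"] sym_G[OF yU] by simp
    finally show ?thesis using sym_G[OF yU] by simp
  qed
  note has_vector_derivative_add[OF has_vector_derivative_diff[OF
        G_derivative_along[OF y yU H(2) De] G_derivative_along[OF y yU D3(2) e(1)]]
      has_vector_derivative_mult_right[OF G_derivative_along[OF y yU v e(1)], of \<sigma>]]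
  moreover have "G (y t) (H' + Gam (y t) (v t) (H t)) (e1 t + Gam (y t) (v t) (e t)) +
      G (y t) (H t) (e2 + (dGam (y t) (v t) (v t) (e t) + Gam (y t) (a t) (e t) + Gam (y t) (v t) (e1 t)) +
        Gam (y t) (v t) (e1 t + Gam (y t) (v t) (e t))) -
      (G (y t) (D3' + Gam (y t) (v t) (D3 t)) (e t) + G (y t) (D3 t) (e1 t + Gam (y t) (v t) (e t))) +
      \<sigma> * (G (y t) (a t + Gam (y t) (v t) (v t)) (e t) + G (y t) (v t) (e1 t + Gam (y t) (v t) (e t))) =
      dLag \<sigma> W (y t) (v t) (a t) (e t) (e1 t) e2 - EL \<sigma> W (y t) (v t) (H t) D4 (e t)"
  proof -
    \<comment> \<open>\<open>D\<^sup>2 e + R(e,v)v\<close> is the covariant derivative of the acceleration in the direction of the variation\<close>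
    have "e2 + (dGam (y t) (v t) (v t) (e t) + Gam (y t) (a t) (e t) + Gam (y t) (v t) (e1 t)) +
        Gam (y t) (v t) (e1 t + Gam (y t) (v t) (e t)) + Riem (y t) (e t) (v t) (v t)
      = e2 + dGam (y t) (e t) (v t) (v t) + 2 *\<^sub>R Gam (y t) (v t) (e1 t) + Gam (y t) (e t) (H t)"
      by (simp add: Riem_def H(1) acc_def Gam_simps[OF yU] dGam_sym[OF yU, of "v t" "v t" "e t"]
          sym_Gam[OF yU, of "a t" "e t"] sym_Gam[OF yU, of "v t" "e t"] scaleR_2)
    from arg_cong[OF this, of "G (y t) (H t)"]
    have "G (y t) (H t) (e2 + (dGam (y t) (v t) (v t) (e t) + Gam (y t) (a t) (e t) + Gam (y t) (v t) (e1 t)) +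
        Gam (y t) (v t) (e1 t + Gam (y t) (v t) (e t))) + G (y t) (H t) (Riem (y t) (e t) (v t) (v t))
      = G (y t) (H t) (e2 + dGam (y t) (e t) (v t) (v t) + 2 *\<^sub>R Gam (y t) (v t) (e1 t) + Gam (y t) (e t) (H t))"
      by (simp only: bilinear_radd[OF bilin_G[OF yU]])
    moreover have "a t + Gam (y t) (v t) (v t) = H t" by (simp add: H(1) acc_def)
    moreover have "G (y t) (D4 + Riem (y t) (H t) (v t) (v t) - \<sigma> *\<^sub>R H t) (e t)
      = G (y t) D4 (e t) + G (y t) (H t) (Riem (y t) (e t) (v t) (v t)) - \<sigma> * G (y t) (H t) (e t)"
      by (simp add: G_simps[OF yU] sR)
    ultimately show ?thesis
      unfolding dLag_def EL_def D3(1)[symmetric] D4[symmetric] H(1)[symmetric]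
      by (simp only: sym_Gam[OF yU, of "v t" "e t"] distrib_left)
  qed
  ultimately have "((\<lambda>t. bdry \<sigma> (y t) (v t) (H t) (D3 t) (e t) (e1 t)) has_vector_derivative
    dLag \<sigma> W (y t) (v t) (a t) (e t) (e1 t) e2 - EL \<sigma> W (y t) (v t) (H t) D4 (e t)) (at t within I)"
    unfolding bdry_def by simp
  then show ?thesis unfolding has_real_derivative_iff_has_vector_derivative .
qed

text \<open>Differentiation under the integral sign, followed by the fundamental theorem of calculus for the total
  derivative found in \<open>bdry_derivative\<close>.\<close>

lemma first_variation:
  assumes pq: "p \<le> q" and W: "ck_on 2 U W"
    and yU: "\<And>t. t \<in> {p..q} \<Longrightarrow> y t \<in> U"
    and y: "\<And>t. t \<in> {p..q} \<Longrightarrow> (y has_vector_derivative v t) (at t within {p..q})"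
    and v: "\<And>t. t \<in> {p..q} \<Longrightarrow> (v has_vector_derivative a t) (at t within {p..q})"
    and a: "continuous_on {p..q} a"
    and H: "\<And>t. t \<in> {p..q} \<Longrightarrow> H t = acc (y t) (v t) (a t)"
      "\<And>t. t \<in> {p..q} \<Longrightarrow> (H has_vector_derivative H' t) (at t within {p..q})"
    and D3: "\<And>t. t \<in> {p..q} \<Longrightarrow> D3 t = H' t + Gam (y t) (v t) (H t)"
      "\<And>t. t \<in> {p..q} \<Longrightarrow> (D3 has_vector_derivative D3' t) (at t within {p..q})"
    and D4: "\<And>t. t \<in> {p..q} \<Longrightarrow> D4 t = D3' t + Gam (y t) (v t) (D3 t)" "continuous_on {p..q} D4"
    and e: "\<And>t. t \<in> {p..q} \<Longrightarrow> (e has_vector_derivative e1 t) (at t within {p..q})"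
      "\<And>t. t \<in> {p..q} \<Longrightarrow> (e1 has_vector_derivative e2 t) (at t within {p..q})"
    and e2: "continuous_on {p..q} e2"
    and \<epsilon>: "\<epsilon> > 0" "\<And>r t. \<bar>r\<bar> \<le> \<epsilon> \<Longrightarrow> t \<in> {p..q} \<Longrightarrow> y t + r *\<^sub>R e t \<in> U"
  shows "((\<lambda>r. integral {p..q} (\<lambda>t. Lag \<sigma> W (y t + r *\<^sub>R e t) (v t + r *\<^sub>R e1 t) (a t + r *\<^sub>R e2 t)))
    has_real_derivative
      (bdry \<sigma> (y q) (v q) (H q) (D3 q) (e q) (e1 q) - bdry \<sigma> (y p) (v p) (H p) (D3 p) (e p) (e1 p)
       + integral {p..q} (\<lambda>t. EL \<sigma> W (y t) (v t) (H t) (D4 t) (e t)))) (at 0)"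
    and "\<And>r. \<bar>r\<bar> \<le> \<epsilon> \<Longrightarrow>
      (\<lambda>t. Lag \<sigma> W (y t + r *\<^sub>R e t) (v t + r *\<^sub>R e1 t) (a t + r *\<^sub>R e2 t)) integrable_on {p..q}"
    and "continuous_on {p..q} (\<lambda>t. EL \<sigma> W (y t) (v t) (H t) (D4 t) x)"
proof -
  let ?L = "\<lambda>r t. Lag \<sigma> W (y t + r *\<^sub>R e t) (v t + r *\<^sub>R e1 t) (a t + r *\<^sub>R e2 t)"
    and ?Q = "\<lambda>t. bdry \<sigma> (y t) (v t) (H t) (D3 t) (e t) (e1 t)"
    and ?E = "\<lambda>t. EL \<sigma> W (y t) (v t) (H t) (D4 t) (e t)"
  have cy: "continuous_on {p..q} y" and cv: "continuous_on {p..q} v" and ce: "continuous_on {p..q} e"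
    and ce1: "continuous_on {p..q} e1" and cH: "continuous_on {p..q} H"
    using y v e H(2) by (blast intro: continuous_on_vector_derivative)+
  note c = cy cv ce ce1 a e2
  have cW: "continuous_on U W" using ck_on_continuous[OF W] .
  show int: "(?L r) integrable_on {p..q}"
    if "\<bar>r\<bar> \<le> \<epsilon>" for r
    using \<epsilon>(2)[OF that]
    by (intro integrable_continuous_interval continuous_Lag[OF cW] continuous_intros c) auto
  have cEL: "continuous_on {p..q} (\<lambda>t. EL \<sigma> W (y t) (v t) (H t) (D4 t) (w t))"
    if "continuous_on {p..q} w" for w
    unfolding EL_def Riem_def using yU
    by (intro continuous_intros continuous_G continuous_Gam continuous_dGam continuous_dW[OF W] cy cv cH D4(2) that)
  show "continuous_on {p..q} (\<lambda>t. EL \<sigma> W (y t) (v t) (H t) (D4 t) x)"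
    by (rule cEL) (rule continuous_on_const)
  let ?dl = "\<lambda>r t. dLag \<sigma> W (y t + r *\<^sub>R e t) (v t + r *\<^sub>R e1 t) (a t + r *\<^sub>R e2 t) (e t) (e1 t) (e2 t)"
  have "((\<lambda>r. integral (cbox p q) (?L r))
    has_field_derivative integral (cbox p q) (?dl 0)) (at 0 within {-\<epsilon>..\<epsilon>})"
  proof (rule leibniz_rule_field_derivative)
    show "((\<lambda>r. ?L r t) has_real_derivative ?dl r t)
        (at r within {-\<epsilon>..\<epsilon>})" if "r \<in> {-\<epsilon>..\<epsilon>}" "t \<in> cbox p q" for r t
      using \<epsilon>(2)[of r t] that by (intro Lag_has_derivative W) auto
    show "continuous_on ({-\<epsilon>..\<epsilon>} \<times> cbox p q) (\<lambda>(r, t). ?dl r t)"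
    proof -
      have s: "continuous_on ({-\<epsilon>..\<epsilon>} \<times> {p..q}) (\<lambda>x. f (snd x))" if "continuous_on {p..q} f"
        for f :: "real \<Rightarrow> 'e"
        by (rule continuous_on_compose2[OF that]) (auto intro!: continuous_intros)
      show ?thesis
        unfolding case_prod_beta box_real
        using \<epsilon>(2)
        by (intro continuous_dLag[OF W] continuous_intros s c) auto
    qed
  qed (use int \<epsilon>(1) in \<open>auto simp: box_real\<close>)
  then have "((\<lambda>r. integral {p..q} (?L r))
    has_real_derivative integral {p..q} (?dl 0)) (at 0)"
    using \<epsilon>(1) at_within_Icc_at[of "-\<epsilon>" 0 \<epsilon>] by (simp only: box_real)
  moreover have "integral {p..q} (?dl 0) =
    (?Q q - ?Q p + integral {p..q} ?E)"
  proof -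
    have "((\<lambda>t. ?dl 0 t - ?E t) has_integral (?Q q - ?Q p)) {p..q}"
      unfolding scaleR_zero_left add_0_right
    proof (intro fundamental_theorem_of_calculus pq)
      fix t assume t: "t \<in> {p..q}"
      show "(?Q has_vector_derivative dLag \<sigma> W (y t) (v t) (a t) (e t) (e1 t) (e2 t) - ?E t) (at t within {p..q})"
        unfolding has_real_derivative_iff_has_vector_derivative[symmetric]
        by (rule bdry_derivative[where y=y and v=v and a=a and H=H and ?D3.0=D3 and e=e and ?e1.0=e1, OF yU[OF t] y[OF t] v[OF t] H(1)[OF t] H(2)[OF t] D3(1)[OF t] D3(2)[OF t]
            D4(1)[OF t] e(1)[OF t] e(2)[OF t]])
    qed
    moreover have "?E integrable_on {p..q}"
      by (intro integrable_continuous_interval cEL ce)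
    ultimately have "(?dl 0 has_integral (?Q q - ?Q p + integral {p..q} ?E)) {p..q}"
      using has_integral_add[of "\<lambda>t. ?dl 0 t - ?E t" _ _ ?E] by (simp add: integrable_integral)
    then show ?thesis by (rule integral_unique)
  qed
  ultimately show "((\<lambda>r. integral {p..q} (?L r))
    has_real_derivative
      (?Q q - ?Q p + integral {p..q} ?E)) (at 0)" by simp
qed

end


section \<open>Charts, tangent vectors and vector fields\<close>

lemma sum_fun_apply: "(\<Sum>i\<in>I. f i) c = (\<Sum>i\<in>I. f i c)"
  by (induction I rule: infinite_finite_induct) auto

locale smooth_atlas =
  fixes A :: "('m::{t2_space, second_countable_topology}, 'e::euclidean_space) chart set"
  assumes atlas: "smooth_manifold A"
begin

lemma is_chart: "c \<in> A \<Longrightarrow> is_chart c"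
  using atlas by (simp add: smooth_manifold_def)

lemma open_chart: "c \<in> A \<Longrightarrow> open (fst c)"
  using is_chart by (simp add: is_chart_def)

lemma homeo: "c \<in> A \<Longrightarrow> homeomorphism (fst c) (snd c ` fst c) (snd c) (chart_inv c)"
  using is_chart by (simp add: is_chart_def)

lemma open_image: "c \<in> A \<Longrightarrow> open (snd c ` fst c)"
  using is_chart by (simp add: is_chart_def)

lemma chart_inv_left: "c \<in> A \<Longrightarrow> p \<in> fst c \<Longrightarrow> chart_inv c (snd c p) = p"
  using homeo by (auto simp: homeomorphism_def)

lemma chart_inv_right: "c \<in> A \<Longrightarrow> y \<in> snd c ` fst c \<Longrightarrow> snd c (chart_inv c y) = y"
  by (auto simp: chart_inv_left)

lemma chart_inv_in: "c \<in> A \<Longrightarrow> y \<in> snd c ` (fst c \<inter> V) \<Longrightarrow> chart_inv c y \<in> fst c \<and> chart_inv c y \<in> V"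
  by (auto simp: chart_inv_left)

lemma chart_inv_in': "c \<in> A \<Longrightarrow> y \<in> snd c ` fst c \<Longrightarrow> chart_inv c y \<in> fst c"
  by (auto simp: chart_inv_left)

lemma open_image_Int:
  assumes "c \<in> A" "open V"
  shows "open (snd c ` (fst c \<inter> V))"
proof -
  have "openin (top_of_set (snd c ` fst c)) (snd c ` (fst c \<inter> V))"
    using homeomorphism_imp_open_map[OF homeo[OF assms(1)]] assms(2) by (simp add: openin_open_Int)
  then show ?thesis using open_image[OF assms(1)] openin_open_eq by blast
qed

lemma chart_ex: "\<exists>c\<in>A. p \<in> fst c"
  using atlas unfolding smooth_manifold_def by (metis UNIV_I UN_E)

lemma chart_at: "chart_at A p \<in> A" "p \<in> fst (chart_at A p)"
proof -
  have "chart_at A p \<in> A \<and> p \<in> fst (chart_at A p)"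
    unfolding chart_at_def by (rule someI_ex) (use chart_ex in blast)
  then show "chart_at A p \<in> A" "p \<in> fst (chart_at A p)" by auto
qed

lemma transition_smooth:
  assumes "c \<in> A" "d \<in> A"
  shows "ck_on \<infinity> (snd c ` (fst c \<inter> fst d)) (transition c d)"
proof -
  have "compatible c d" using atlas assms unfolding smooth_manifold_def by metis
  then show ?thesis by (simp add: compatible_def)
qed

lemma transition_apply: "c \<in> A \<Longrightarrow> p \<in> fst c \<Longrightarrow> transition c d (snd c p) = snd d p"
  by (simp add: transition_def chart_inv_left)

lemma transition_differentiable:
  assumes "c \<in> A" "d \<in> A" "p \<in> fst c" "p \<in> fst d"
  shows "transition c d differentiable (at (snd c p))"
  using assms by (intro ck_on_differentiable[OF transition_smooth open_image_Int[OF _ open_chart]]) auto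

lemma transition_linear:
  assumes "c \<in> A" "d \<in> A" "p \<in> fst c" "p \<in> fst d"
  shows "linear (frechet_derivative (transition c d) (at (snd c p)))"
  using transition_differentiable[OF assms] by (rule linear_frechet_derivative)

lemma transition_chain:
  assumes cdf: "c \<in> A" "d \<in> A" "f \<in> A" and p: "p \<in> fst c" "p \<in> fst d" "p \<in> fst f"
  shows "frechet_derivative (transition c f) (at (snd c p)) e
    = frechet_derivative (transition d f) (at (snd d p)) (frechet_derivative (transition c d) (at (snd c p)) e)"
proof -
  have D1: "(transition c d has_derivative frechet_derivative (transition c d) (at (snd c p))) (at (snd c p))"
    using transition_differentiable[of c d p] assms by (simp add: frechet_derivative_works)
  have D2: "(transition d f has_derivative frechet_derivative (transition d f) (at (snd d p))) (at (transition c d (snd c p)))"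
    using transition_differentiable[of d f p] assms by (simp add: frechet_derivative_works transition_apply)
  have "open (snd c ` (fst c \<inter> (fst d \<inter> fst f)))"
    by (intro open_image_Int open_Int open_chart cdf)
  then have "(transition c f has_derivative (\<lambda>e. frechet_derivative (transition d f) (at (snd d p))
      (frechet_derivative (transition c d) (at (snd c p)) e))) (at (snd c p))"
    by (rule has_derivative_transform_within_open[OF has_derivative_compose[OF D1 D2]])
      (use assms in \<open>auto simp: transition_apply\<close>)
  from frechet_derivative_at[OF this] show ?thesis by metis
qed

lemma transition_self:
  assumes "c \<in> A" "p \<in> fst c"
  shows "frechet_derivative (transition c c) (at (snd c p)) e = e"
proof -
  have "(transition c c has_derivative (\<lambda>e. e)) (at (snd c p))"
    by (rule has_derivative_transform_within_open[OF has_derivative_ident open_image[OF assms(1)]])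
      (use assms in \<open>auto simp: transition_apply\<close>)
  from frechet_derivative_at[OF this] show ?thesis by metis
qed

lemma tangent_change:
  "v \<in> tangent_space A p \<Longrightarrow> c \<in> A \<Longrightarrow> d \<in> A \<Longrightarrow> p \<in> fst c \<Longrightarrow> p \<in> fst d \<Longrightarrow>
    v d = frechet_derivative (transition c d) (at (snd c p)) (v c)"
  unfolding tangent_space_def by blast

lemma tangent_off: "v \<in> tangent_space A p \<Longrightarrow> \<not> (c \<in> A \<and> p \<in> fst c) \<Longrightarrow> v c = 0"
  unfolding tangent_space_def by blast

text \<open>Identities between tangent vectors can be checked in one chart, since the Jacobians of the transition
  maps determine the other components.\<close>

lemma tangent_eqI:
  assumes u: "u \<in> tangent_space A p" and v: "v \<in> tangent_space A p" and c: "c \<in> A" "p \<in> fst c" and eq: "u c = v c"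
  shows "u = v"
proof
  fix d
  show "u d = v d"
  proof (cases "d \<in> A \<and> p \<in> fst d")
    case True
    then show ?thesis using tangent_change[OF u c(1) _ c(2)] tangent_change[OF v c(1) _ c(2)] eq by simp
  next
    case False
    then show ?thesis using tangent_off[OF u] tangent_off[OF v] by simp
  qed
qed

lemma tangentI:
  assumes "\<And>c d. c \<in> A \<Longrightarrow> d \<in> A \<Longrightarrow> p \<in> fst c \<Longrightarrow> p \<in> fst d \<Longrightarrow>
      v d = frechet_derivative (transition c d) (at (snd c p)) (v c)"
    and "\<And>c. \<not> (c \<in> A \<and> p \<in> fst c) \<Longrightarrow> v c = 0"
  shows "v \<in> tangent_space A p"
  unfolding tangent_space_def using assms by blast

lemma tangent_zero: "0 \<in> tangent_space A p"
  by (rule tangentI) (simp_all add: linear_0[OF transition_linear])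

lemma tangent_add:
  assumes "u \<in> tangent_space A p" "v \<in> tangent_space A p"
  shows "u + v \<in> tangent_space A p"
proof (rule tangentI)
  fix c d assume cd: "c \<in> A" "d \<in> A" "p \<in> fst c" "p \<in> fst d"
  show "(u + v) d = frechet_derivative (transition c d) (at (snd c p)) ((u + v) c)"
    by (simp add: linear_add[OF transition_linear[OF cd]] tangent_change[OF assms(1) cd] tangent_change[OF assms(2) cd])
qed (simp add: tangent_off[OF assms(1)] tangent_off[OF assms(2)])

lemma tangent_scaleR:
  assumes "u \<in> tangent_space A p"
  shows "r *\<^sub>R u \<in> tangent_space A p"
proof (rule tangentI)
  fix c d assume cd: "c \<in> A" "d \<in> A" "p \<in> fst c" "p \<in> fst d"
  show "(r *\<^sub>R u) d = frechet_derivative (transition c d) (at (snd c p)) ((r *\<^sub>R u) c)"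
    by (simp add: scaleR_fun_def linear_cmul[OF transition_linear[OF cd]] tangent_change[OF assms(1) cd])
qed (simp add: scaleR_fun_def tangent_off[OF assms])

lemma tangent_diff: "u \<in> tangent_space A p \<Longrightarrow> v \<in> tangent_space A p \<Longrightarrow> u - v \<in> tangent_space A p"
  using tangent_add[OF _ tangent_scaleR[of v p "-1"], of u] by simp

lemma tangent_sum: "(\<And>i. i \<in> I \<Longrightarrow> u i \<in> tangent_space A p) \<Longrightarrow> (\<Sum>i\<in>I. u i) \<in> tangent_space A p"
  by (induction I rule: infinite_finite_induct) (auto intro: tangent_zero tangent_add)

lemma coord_field_self: "c \<in> A \<Longrightarrow> p \<in> fst c \<Longrightarrow> coord_field A c e p c = e"
  by (simp add: coord_field_def transition_self)

lemma coord_field_tangent: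
  assumes "c \<in> A" "p \<in> fst c"
  shows "coord_field A c e p \<in> tangent_space A p"
  by (rule tangentI) (use assms in \<open>auto simp: coord_field_def intro: transition_chain\<close>)

lemma coord_field_components:
  assumes "v \<in> tangent_space A p" "c \<in> A" "p \<in> fst c"
  shows "coord_field A c (v c) p = v"
  by (rule tangent_eqI[OF coord_field_tangent[OF assms(2,3)] assms]) (simp add: coord_field_self assms)

lemma coord_field_linear:
  assumes "c \<in> A" "p \<in> fst c"
  shows "linear (\<lambda>e. coord_field A c e p d)"
proof (cases "d \<in> A \<and> p \<in> fst d")
  case True
  then show ?thesis using transition_linear[of c d p] assms by (simp add: coord_field_def)
next
  case False
  then have "(\<lambda>e. coord_field A c e p d) = (\<lambda>e. 0)" by (auto simp: coord_field_def)
  then show ?thesis by (simp add: linear_zero)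
qed

lemma coord_field_component_smooth:
  assumes "c \<in> A" "d \<in> A"
  shows "ck_on \<infinity> (snd d ` (fst d \<inter> fst c)) (\<lambda>y. coord_field A c e (chart_inv d y) d)"
proof -
  have "ck_on \<infinity> (snd d ` (fst d \<inter> fst c)) (\<lambda>y. frechet_derivative (transition c d) (at (transition d c y)) e)"
    by (rule ck_on_compose[OF ck_on_frechet_derivative[OF transition_smooth[OF assms]
            open_image_Int[OF assms(1) open_chart[OF assms(2)]]] transition_smooth[OF assms(2,1)]])
      (use assms in \<open>auto simp: transition_apply\<close>)
  then show ?thesis
    by (rule iffD1[OF ck_on_cong, rotated]) (use assms in \<open>auto simp: coord_field_def chart_inv_left transition_apply\<close>)
qed

lemma svfI:
  assumes "\<And>p. p \<in> U \<Longrightarrow> X p \<in> tangent_space A p"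
    and "\<And>c. c \<in> A \<Longrightarrow> ck_on \<infinity> (snd c ` (fst c \<inter> U)) (\<lambda>y. X (chart_inv c y) c)"
  shows "X \<in> smooth_vector_fields A U"
  unfolding smooth_vector_fields_def using assms by blast

lemma coord_field_svf:
  assumes "c \<in> A" "U \<subseteq> fst c"
  shows "coord_field A c e \<in> smooth_vector_fields A U"
proof (rule svfI)
  show "coord_field A c e p \<in> tangent_space A p" if "p \<in> U" for p
    using assms that by (intro coord_field_tangent) auto
  show "ck_on \<infinity> (snd d ` (fst d \<inter> U)) (\<lambda>y. coord_field A c e (chart_inv d y) d)" if "d \<in> A" for d
    by (rule ck_on_subset[OF coord_field_component_smooth[OF assms(1) that]]) (use assms(2) in auto)
qed

lemma svf_tangent: "X \<in> smooth_vector_fields A U \<Longrightarrow> p \<in> U \<Longrightarrow> X p \<in> tangent_space A p"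
  unfolding smooth_vector_fields_def by blast

lemma svf_smooth: "X \<in> smooth_vector_fields A U \<Longrightarrow> c \<in> A \<Longrightarrow>
    ck_on \<infinity> (snd c ` (fst c \<inter> U)) (\<lambda>y. X (chart_inv c y) c)"
  unfolding smooth_vector_fields_def by blast

lemma svf_subset:
  assumes "X \<in> smooth_vector_fields A U" "V \<subseteq> U"
  shows "X \<in> smooth_vector_fields A V"
proof (rule svfI)
  show "X p \<in> tangent_space A p" if "p \<in> V" for p
    using svf_tangent[OF assms(1)] assms(2) that by blast
  show "ck_on \<infinity> (snd c ` (fst c \<inter> V)) (\<lambda>y. X (chart_inv c y) c)" if "c \<in> A" for c
    by (rule ck_on_subset[OF svf_smooth[OF assms(1) that]]) (use assms(2) in auto)
qed

lemma svf_zero: "(\<lambda>q. 0) \<in> smooth_vector_fields A U"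
  by (rule svfI) (simp_all add: tangent_zero ck_on_const)

lemma svf_add:
  assumes "X \<in> smooth_vector_fields A U" "Y \<in> smooth_vector_fields A U"
  shows "(\<lambda>q. X q + Y q) \<in> smooth_vector_fields A U"
  by (rule svfI) (simp_all add: svf_tangent[OF assms(1)] svf_tangent[OF assms(2)] tangent_add ck_on_add
      svf_smooth[OF assms(1)] svf_smooth[OF assms(2)])

lemma svf_scale:
  assumes "X \<in> smooth_vector_fields A U" "ck_fun_on \<infinity> A U f"
  shows "(\<lambda>q. f q *\<^sub>R X q) \<in> smooth_vector_fields A U"
proof (rule svfI)
  show "ck_on \<infinity> (snd c ` (fst c \<inter> U)) (\<lambda>y. (f (chart_inv c y) *\<^sub>R X (chart_inv c y)) c)" if "c \<in> A" for c
    unfolding scaleR_fun_def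
    using assms(2) that by (intro ck_on_scaleR svf_smooth[OF assms(1)]) (auto simp: ck_fun_on_def o_def)
qed (simp add: svf_tangent[OF assms(1)] tangent_scaleR)

lemma svf_sum: "(\<And>i. i \<in> I \<Longrightarrow> X i \<in> smooth_vector_fields A U) \<Longrightarrow>
    (\<lambda>q. \<Sum>i\<in>I. X i q) \<in> smooth_vector_fields A U"
  by (induction I rule: infinite_finite_induct) (auto intro: svf_zero svf_add)

lemma component_ck_fun_on:
  assumes X: "X \<in> smooth_vector_fields A U" and c: "c \<in> A" "U \<subseteq> fst c"
  shows "ck_fun_on \<infinity> A U (\<lambda>q. X q c \<bullet> i)"
  unfolding ck_fun_on_def
proof
  fix d assume d: "d \<in> A"
  have "ck_on \<infinity> (snd d ` (fst d \<inter> U)) (\<lambda>y. X (chart_inv c (transition d c y)) c)"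
    by (rule ck_on_compose[OF svf_smooth[OF X c(1)] ck_on_subset[OF transition_smooth[OF d c(1)]]])
      (use c d in \<open>auto simp: transition_apply\<close>)
  then have "ck_on \<infinity> (snd d ` (fst d \<inter> U)) (\<lambda>y. X (chart_inv c (transition d c y)) c \<bullet> i)"
    by (intro ck_on_inner ck_on_const)
  then show "ck_on \<infinity> (snd d ` (fst d \<inter> U)) ((\<lambda>q. X q c \<bullet> i) \<circ> chart_inv d)"
    by (rule iffD1[OF ck_on_cong, rotated]) (use c d in \<open>auto simp: transition_def chart_inv_left subset_iff\<close>)
qed

lemma ck_fun_on_diff:
  assumes "ck_fun_on k A U f" "1 \<le> k" "open U" "c \<in> A" "p \<in> U" "p \<in> fst c"
  shows "(f \<circ> chart_inv c) differentiable (at (snd c p))"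
  using assms unfolding ck_fun_on_def
  by (intro ck_on_differentiable[of k "snd c ` (fst c \<inter> U)"] open_image_Int) auto

text \<open>By the chain rule the chart \<open>chart_at A p\<close> fixed in the definition can be replaced by any other.\<close>

lemma dir_deriv_chart:
  assumes v: "v \<in> tangent_space A p" and c: "c \<in> A" "p \<in> fst c"
    and f: "(f \<circ> chart_inv (chart_at A p)) differentiable (at (snd (chart_at A p) p))"
  shows "dir_deriv A p v f = frechet_derivative (f \<circ> chart_inv c) (at (snd c p)) (v c)"
proof -
  define d where "d = chart_at A p"
  have d: "d \<in> A" "p \<in> fst d" unfolding d_def by (rule chart_at)+
  have D1: "(transition c d has_derivative frechet_derivative (transition c d) (at (snd c p))) (at (snd c p))"
    using transition_differentiable[of c d p] c d by (simp add: frechet_derivative_works)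
  have D2: "(f \<circ> chart_inv d has_derivative frechet_derivative (f \<circ> chart_inv d) (at (snd d p)))
      (at (transition c d (snd c p)))"
    using f c d by (simp add: frechet_derivative_works transition_apply flip: d_def)
  have "(f \<circ> chart_inv c has_derivative (\<lambda>e. frechet_derivative (f \<circ> chart_inv d) (at (snd d p))
      (frechet_derivative (transition c d) (at (snd c p)) e))) (at (snd c p))"
    by (rule has_derivative_transform_within_open[OF has_derivative_compose[OF D1 D2]
          open_image_Int[OF c(1) open_chart[OF d(1)]]])
      (use c d in \<open>auto simp: transition_apply chart_inv_left\<close>)
  from frechet_derivative_at[OF this]
  have "frechet_derivative (f \<circ> chart_inv c) (at (snd c p)) (v c) = frechet_derivative (f \<circ> chart_inv d) (at (snd d p))
      (frechet_derivative (transition c d) (at (snd c p)) (v c))" by metis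
  then show ?thesis
    using tangent_change[OF v c(1) d(1) c(2) d(2)] by (simp add: dir_deriv_def Let_def flip: d_def)
qed

end


section \<open>Connections in coordinates\<close>

locale connected_atlas = smooth_atlas A
  for A :: "('m::{t2_space, second_countable_topology}, 'e::euclidean_space) chart set" +
  fixes nabla :: "('m, 'e) connection"
  assumes connection: "affine_connection A nabla"
begin

context
  fixes U :: "'m set" assumes U: "open U"
begin

lemma nabla_svf: "X \<in> smooth_vector_fields A U \<Longrightarrow> Y \<in> smooth_vector_fields A U \<Longrightarrow>
    nabla X Y \<in> smooth_vector_fields A U"
  using connection[unfolded affine_connection_def, rule_format, OF U] by blast

lemma nabla_add:
  assumes "X \<in> smooth_vector_fields A U" "Y \<in> smooth_vector_fields A U" "Z \<in> smooth_vector_fields A U" "p \<in> U"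
  shows "nabla (\<lambda>q. X q + Z q) Y p = nabla X Y p + nabla Z Y p"
    and "nabla X (\<lambda>q. Y q + Z q) p = nabla X Y p + nabla X Z p"
  using connection[unfolded affine_connection_def, rule_format, OF U assms(1,2)] assms(3,4) by simp_all

lemma nabla_scale:
  assumes "X \<in> smooth_vector_fields A U" "Y \<in> smooth_vector_fields A U" "ck_fun_on \<infinity> A U f" "p \<in> U"
  shows "nabla (\<lambda>q. f q *\<^sub>R X q) Y p = f p *\<^sub>R nabla X Y p"
    and "nabla X (\<lambda>q. f q *\<^sub>R Y q) p = dir_deriv A p (X p) f *\<^sub>R Y p + f p *\<^sub>R nabla X Y p"
  using connection[unfolded affine_connection_def, rule_format, OF U assms(1,2)] assms(3,4) by simp_all

text \<open>Multiplying a field by the indicator function of \<open>U\<close> does not change its covariant derivatives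
  on \<open>U\<close>, but erases the field outside \<open>U\<close>: connections are local operators.\<close>

lemma indicator_smooth: "ck_fun_on \<infinity> A U (indicator U)"
  unfolding ck_fun_on_def
proof
  fix c assume c: "c \<in> A"
  show "ck_on \<infinity> (snd c ` (fst c \<inter> U)) (indicator U \<circ> chart_inv c)"
    by (rule iffD1[OF ck_on_cong ck_on_const[of _ _ 1]]) (use c in \<open>auto simp: chart_inv_left\<close>)
qed

lemma nabla_cong:
  assumes XY: "X \<in> smooth_vector_fields A U" "Y \<in> smooth_vector_fields A U"
    "X' \<in> smooth_vector_fields A U" "Y' \<in> smooth_vector_fields A U"
    and eq: "\<And>q. q \<in> U \<Longrightarrow> X q = X' q" "\<And>q. q \<in> U \<Longrightarrow> Y q = Y' q" and p: "p \<in> U"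
  shows "nabla X Y p = nabla X' Y' p"
proof -
  let ?f = "indicator U :: 'm \<Rightarrow> real"
  have "(\<lambda>q. ?f q *\<^sub>R X q) = (\<lambda>q. ?f q *\<^sub>R X' q)" "(\<lambda>q. ?f q *\<^sub>R Y q) = (\<lambda>q. ?f q *\<^sub>R Y' q)"
    using eq by (auto simp: fun_eq_iff indicator_def)
  then have "nabla X Y p = nabla X' Y p" "nabla X' Y p = nabla X' Y' p"
    using nabla_scale(1)[OF XY(1,2) indicator_smooth p] nabla_scale(1)[OF XY(3,2) indicator_smooth p]
      nabla_scale(2)[OF XY(3,2) indicator_smooth p] nabla_scale(2)[OF XY(3,4) indicator_smooth p] p eq(2)[OF p]
    by simp_all
  then show ?thesis by simp
qed

lemma nabla_zero:
  assumes X: "X \<in> smooth_vector_fields A U" and p: "p \<in> U"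
  shows "nabla (\<lambda>q. 0) X p = 0" "nabla X (\<lambda>q. 0) p = 0"
  using nabla_add(1)[OF svf_zero X svf_zero p] nabla_add(2)[OF X svf_zero svf_zero p] by simp_all

lemma nabla_sum_left:
  assumes "finite I" "\<And>i. i \<in> I \<Longrightarrow> X i \<in> smooth_vector_fields A U" "\<And>i. i \<in> I \<Longrightarrow> ck_fun_on \<infinity> A U (f i)"
    "Y \<in> smooth_vector_fields A U" "p \<in> U"
  shows "nabla (\<lambda>q. \<Sum>i\<in>I. f i q *\<^sub>R X i q) Y p = (\<Sum>i\<in>I. f i p *\<^sub>R nabla (X i) Y p)"
  using assms(1-3)
proof (induction I)
  case empty
  then show ?case using nabla_zero(1)[OF assms(4,5)] by (simp add: zero_fun_def)
next
  case (insert j I)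
  have "(\<lambda>q. \<Sum>i\<in>I. f i q *\<^sub>R X i q) \<in> smooth_vector_fields A U"
    by (intro svf_sum svf_scale) (use insert in auto)
  from nabla_add(1)[OF svf_scale[of "X j" U "f j"] assms(4) this assms(5)]
    nabla_scale(1)[of "X j" Y "f j", OF _ assms(4) _ assms(5)] insert
  show ?case by (simp only: sum.insert insert_iff simp_thms)
qed

lemma nabla_sum_right:
  assumes "finite I" "\<And>i. i \<in> I \<Longrightarrow> Y i \<in> smooth_vector_fields A U" "\<And>i. i \<in> I \<Longrightarrow> ck_fun_on \<infinity> A U (f i)"
    "X \<in> smooth_vector_fields A U" "p \<in> U"
  shows "nabla X (\<lambda>q. \<Sum>i\<in>I. f i q *\<^sub>R Y i q) p
    = (\<Sum>i\<in>I. dir_deriv A p (X p) (f i) *\<^sub>R Y i p + f i p *\<^sub>R nabla X (Y i) p)"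
  using assms(1-3)
proof (induction I)
  case empty
  then show ?case using nabla_zero(2)[OF assms(4,5)] by (simp add: zero_fun_def)
next
  case (insert j I)
  have "(\<lambda>q. \<Sum>i\<in>I. f i q *\<^sub>R Y i q) \<in> smooth_vector_fields A U"
    by (intro svf_sum svf_scale) (use insert in auto)
  from nabla_add(2)[OF assms(4) svf_scale[of "Y j" U "f j"] this assms(5)]
    nabla_scale(2)[of X "Y j" "f j", OF assms(4) _ _ assms(5)] insert
  show ?case by (simp only: sum.insert insert_iff simp_thms)
qed

end

text \<open>The Christoffel symbols of a chart, as a family of bilinear maps.\<close>

definition Gam :: "('m, 'e) chart \<Rightarrow> 'e \<Rightarrow> 'e \<Rightarrow> 'e \<Rightarrow> 'e" where
  "Gam c y u v = nabla (coord_field A c u) (coord_field A c v) (chart_inv c y) c"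

lemma svf_expand:
  assumes X: "X \<in> smooth_vector_fields A U" and c: "c \<in> A" "U \<subseteq> fst c" and q: "q \<in> U"
  shows "X q = (\<Sum>i\<in>Basis. (X q c \<bullet> i) *\<^sub>R coord_field A c i q)"
proof (rule tangent_eqI[OF svf_tangent[OF X q] _ c(1)])
  have qc: "q \<in> fst c" using c q by blast
  show "(\<Sum>i\<in>Basis. (X q c \<bullet> i) *\<^sub>R coord_field A c i q) \<in> tangent_space A q"
    by (intro tangent_sum tangent_scaleR coord_field_tangent c qc)
  show "q \<in> fst c" by fact
  show "X q c = (\<Sum>i\<in>Basis. (X q c \<bullet> i) *\<^sub>R coord_field A c i q) c"
    by (simp add: sum_fun_apply scaleR_fun_def coord_field_self c qc euclidean_representation)
qed

lemma dir_deriv_component: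
  assumes U: "open U" and Y: "Y \<in> smooth_vector_fields A U" and c: "c \<in> A" "U \<subseteq> fst c"
    and p: "p \<in> U" and v: "v \<in> tangent_space A p"
  shows "dir_deriv A p v (\<lambda>q. Y q c \<bullet> i)
    = frechet_derivative (\<lambda>y. Y (chart_inv c y) c) (at (snd c p)) (v c) \<bullet> i"
proof -
  have pc: "p \<in> fst c" using c p by blast
  have "(\<lambda>y. Y (chart_inv c y) c) differentiable (at (snd c p))"
    by (rule ck_on_differentiable[OF svf_smooth[OF Y c(1)] open_image_Int[OF c(1) U]]) (use p pc in auto)
  then have D: "((\<lambda>y. Y (chart_inv c y) c) has_derivative
      frechet_derivative (\<lambda>y. Y (chart_inv c y) c) (at (snd c p))) (at (snd c p))"
    by (simp add: frechet_derivative_works)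
  have "dir_deriv A p v (\<lambda>q. Y q c \<bullet> i)
      = frechet_derivative ((\<lambda>q. Y q c \<bullet> i) \<circ> chart_inv c) (at (snd c p)) (v c)"
    by (rule dir_deriv_chart[OF v c(1) pc ck_fun_on_diff[OF component_ck_fun_on[OF Y c] _ U chart_at(1) p chart_at(2)]])
      simp
  also have "\<dots> = frechet_derivative (\<lambda>y. Y (chart_inv c y) c) (at (snd c p)) (v c) \<bullet> i"
    unfolding o_def by (rule fun_cong[OF frechet_derivative_at[OF has_derivative_inner_left[OF D], symmetric]])
  finally show ?thesis .
qed

text \<open>Expand both fields in the coordinate fields of \<open>c\<close>: the connection is tensorial in \<open>X\<close> and satisfies the
  Leibniz rule in \<open>Y\<close>.\<close>

lemma nabla_expand:
  assumes U: "open U" and X: "X \<in> smooth_vector_fields A U" and Y: "Y \<in> smooth_vector_fields A U"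
    and c: "c \<in> A" "U \<subseteq> fst c" and p: "p \<in> U"
  shows "nabla X Y p c = frechet_derivative (\<lambda>y. Y (chart_inv c y) c) (at (snd c p)) (X p c)
    + (\<Sum>j\<in>Basis. \<Sum>i\<in>Basis. ((X p c \<bullet> i) * (Y p c \<bullet> j)) *\<^sub>R Gam c (snd c p) i j)"
proof -
  let ?E = "coord_field A c"
  have pc: "p \<in> fst c" using c p by blast
  have E: "?E i \<in> smooth_vector_fields A U" for i by (rule coord_field_svf[OF c])
  have X': "(\<lambda>q. \<Sum>i\<in>Basis. (X q c \<bullet> i) *\<^sub>R ?E i q) \<in> smooth_vector_fields A U"
    and Y': "(\<lambda>q. \<Sum>i\<in>Basis. (Y q c \<bullet> i) *\<^sub>R ?E i q) \<in> smooth_vector_fields A U"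
    by (intro svf_sum svf_scale E component_ck_fun_on[OF X c] component_ck_fun_on[OF Y c])+
  have left: "nabla X (?E j) p = (\<Sum>i\<in>Basis. (X p c \<bullet> i) *\<^sub>R nabla (?E i) (?E j) p)" for j
  proof -
    have "nabla X (?E j) p = nabla (\<lambda>q. \<Sum>i\<in>Basis. (X q c \<bullet> i) *\<^sub>R ?E i q) (?E j) p"
      by (rule nabla_cong[OF U X E X' E svf_expand[OF X c] refl p])
    also have "\<dots> = (\<Sum>i\<in>Basis. (X p c \<bullet> i) *\<^sub>R nabla (?E i) (?E j) p)"
      by (rule nabla_sum_left[OF U finite_Basis E component_ck_fun_on[OF X c] E p])
    finally show ?thesis .
  qed
  have "nabla X Y p = nabla X (\<lambda>q. \<Sum>i\<in>Basis. (Y q c \<bullet> i) *\<^sub>R ?E i q) p"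
    by (rule nabla_cong[OF U X Y X Y' refl svf_expand[OF Y c] p])
  also have "\<dots> = (\<Sum>j\<in>Basis. dir_deriv A p (X p) (\<lambda>q. Y q c \<bullet> j) *\<^sub>R ?E j p + (Y p c \<bullet> j) *\<^sub>R nabla X (?E j) p)"
    by (rule nabla_sum_right[OF U finite_Basis E component_ck_fun_on[OF Y c] X p])
  finally have "nabla X Y p c = (\<Sum>j\<in>Basis.
      (frechet_derivative (\<lambda>y. Y (chart_inv c y) c) (at (snd c p)) (X p c) \<bullet> j) *\<^sub>R j +
      (Y p c \<bullet> j) *\<^sub>R (\<Sum>i\<in>Basis. (X p c \<bullet> i) *\<^sub>R Gam c (snd c p) i j))"
    by (simp add: sum_fun_apply scaleR_fun_def left dir_deriv_component[OF U Y c p svf_tangent[OF X p]]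
        coord_field_self c pc Gam_def chart_inv_left)
  then show ?thesis
    by (simp add: sum.distrib euclidean_representation scaleR_sum_right mult.commute)
qed

lemma coord_field_component_derivative:
  assumes "c \<in> A" "p \<in> fst c"
  shows "frechet_derivative (\<lambda>y. coord_field A c e (chart_inv c y) c) (at (snd c p)) v = 0"
proof -
  have "((\<lambda>y. coord_field A c e (chart_inv c y) c) has_derivative (\<lambda>v. 0)) (at (snd c p))"
    by (rule has_derivative_transform_within_open[OF has_derivative_const open_image[OF assms(1)], of _ e])
      (use assms in \<open>auto simp: coord_field_self chart_inv_left\<close>)
  from frechet_derivative_at[OF this] show ?thesis by metis
qed

lemma Gam_expand:
  assumes "c \<in> A" "y \<in> snd c ` fst c"
  shows "Gam c y u v = (\<Sum>j\<in>Basis. \<Sum>i\<in>Basis. ((u \<bullet> i) * (v \<bullet> j)) *\<^sub>R Gam c y i j)"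
proof -
  obtain p where p: "p \<in> fst c" "y = snd c p" using assms by blast
  have E: "coord_field A c e \<in> smooth_vector_fields A (fst c)" for e by (rule coord_field_svf) (use assms in auto)
  show ?thesis
    using nabla_expand[OF open_chart[OF assms(1)] E E assms(1) subset_refl p(1), of u v]
    by (simp add: coord_field_component_derivative coord_field_self assms p(1) Gam_def chart_inv_left p(2))
qed

lemma Gam_bilinear:
  assumes "c \<in> A" "y \<in> snd c ` fst c"
  shows "bilinear (Gam c y)"
proof -
  define K where "K i j = Gam c y i j" for i j
  have "Gam c y = (\<lambda>u v. \<Sum>j\<in>Basis. \<Sum>i\<in>Basis. ((u \<bullet> i) * (v \<bullet> j)) *\<^sub>R K i j)"
    unfolding K_def by (intro ext Gam_expand assms)
  moreover have "bilinear (\<lambda>u v. \<Sum>j\<in>Basis. \<Sum>i\<in>Basis. ((u \<bullet> i) * (v \<bullet> j)) *\<^sub>R K i j)"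
    unfolding bilinear_def
    by (auto intro!: linearI simp: inner_add_left algebra_simps sum.distrib scaleR_sum_right)
  ultimately show ?thesis by simp
qed

text \<open>The familiar coordinate formula \<open>(\<nabla>\<^sub>X Y)\<^sup>k = X\<^sup>i \<partial>\<^sub>i Y\<^sup>k + \<Gamma>\<^sup>k\<^sub>i\<^sub>j X\<^sup>i Y\<^sup>j\<close>.\<close>

lemma nabla_in_chart:
  assumes "open U" "X \<in> smooth_vector_fields A U" "Y \<in> smooth_vector_fields A U"
    "c \<in> A" "U \<subseteq> fst c" "p \<in> U"
  shows "nabla X Y p c = frechet_derivative (\<lambda>y. Y (chart_inv c y) c) (at (snd c p)) (X p c)
    + Gam c (snd c p) (X p c) (Y p c)"
  using nabla_expand[OF assms] Gam_expand[of c "snd c p" "X p c" "Y p c"] assms(4-6) by auto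

lemma nabla_tangent:
  assumes "open U" "X \<in> smooth_vector_fields A U" "Y \<in> smooth_vector_fields A U" "p \<in> U"
  shows "nabla X Y p \<in> tangent_space A p"
  using svf_tangent[OF nabla_svf[OF assms(1-3)] assms(4)] .

lemma Gam_smooth:
  assumes c: "c \<in> A"
  shows "ck_on \<infinity> (snd c ` fst c) (\<lambda>y. Gam c y u v)"
  using svf_smooth[OF nabla_svf[OF open_chart[OF c] coord_field_svf[OF c subset_refl] coord_field_svf[OF c subset_refl]] c, of u v]
  by (simp add: Gam_def)

end


section \<open>The Levi-Civita connection in coordinates\<close>

locale riemannian_atlas = connected_atlas A nabla
  for A :: "('m::{t2_space, second_countable_topology}, 'e::euclidean_space) chart set"
    and nabla :: "('m, 'e) connection" +
  fixes g :: "('m, 'e) metric"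
  assumes metric: "riemannian_metric A g" and levi_civita: "levi_civita_connection A g nabla"
begin

text \<open>The coefficients of the metric in a chart, as a family of bilinear forms.\<close>

definition Gm :: "('m, 'e) chart \<Rightarrow> 'e \<Rightarrow> 'e \<Rightarrow> 'e \<Rightarrow> real" where
  "Gm c y u v = g (chart_inv c y) (coord_field A c u (chart_inv c y)) (coord_field A c v (chart_inv c y))"

context
  fixes p :: 'm and u v assumes u: "u \<in> tangent_space A p" and v: "v \<in> tangent_space A p"
begin
lemma g_sym: "g p u v = g p v u" using metric u v unfolding riemannian_metric_def by metis
lemma g_scale: "g p (r *\<^sub>R u) v = r * g p u v" using metric u v unfolding riemannian_metric_def by metis
lemma g_add: "w \<in> tangent_space A p \<Longrightarrow> g p (u + v) w = g p u w + g p v w"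
  using metric u v unfolding riemannian_metric_def by metis
lemma g_pos: "u \<noteq> 0 \<Longrightarrow> g p u u > 0" using metric u v unfolding riemannian_metric_def by metis
end

lemma g_in_chart:
  assumes "u \<in> tangent_space A p" "v \<in> tangent_space A p" "c \<in> A" "p \<in> fst c"
  shows "g p u v = Gm c (snd c p) (u c) (v c)"
  using assms by (simp add: Gm_def chart_inv_left coord_field_components)

lemma Gm_linear:
  assumes "c \<in> A" "y \<in> snd c ` fst c"
  shows "linear (\<lambda>u. Gm c y u v)"
proof -
  let ?p = "chart_inv c y"
  have p: "?p \<in> fst c" using assms by (rule chart_inv_in')
  note T = coord_field_tangent[OF assms(1) p]
  have add: "coord_field A c (u + u') ?p = coord_field A c u ?p + coord_field A c u' ?p" for u u'
    using linear_add[OF coord_field_linear[OF assms(1) p]] by auto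
  have scale: "coord_field A c (r *\<^sub>R u) ?p = r *\<^sub>R coord_field A c u ?p" for r u
    using linear_cmul[OF coord_field_linear[OF assms(1) p]] by (auto simp: scaleR_fun_def)
  show ?thesis
    unfolding Gm_def by (rule linearI) (simp_all add: add scale g_add[OF T T T] g_scale[OF T T])
qed

lemma Gm_sym: "c \<in> A \<Longrightarrow> y \<in> snd c ` fst c \<Longrightarrow> Gm c y u v = Gm c y v u"
  unfolding Gm_def by (rule g_sym; rule coord_field_tangent; simp add: chart_inv_in')

lemma Gm_bilinear:
  assumes "c \<in> A" "y \<in> snd c ` fst c"
  shows "bilinear (Gm c y)"
proof -
  have "(\<lambda>v. Gm c y w v) = (\<lambda>v. Gm c y v w)" for w by (rule ext) (rule Gm_sym[OF assms])
  then show ?thesis unfolding bilinear_def using Gm_linear[OF assms] by metis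
qed

lemma Gm_pos: 
  assumes "c \<in> A" "y \<in> snd c ` fst c" "u \<noteq> 0"
  shows "Gm c y u u > 0"
  unfolding Gm_def
proof (rule g_pos)
  have p: "chart_inv c y \<in> fst c" using assms(1,2) by (rule chart_inv_in')
  show "coord_field A c u (chart_inv c y) \<noteq> 0"
    using coord_field_self[OF assms(1) p, of u] assms(3) by auto
  show "coord_field A c u (chart_inv c y) \<in> tangent_space A (chart_inv c y)"
    by (rule coord_field_tangent[OF assms(1) p])
  then show "coord_field A c u (chart_inv c y) \<in> tangent_space A (chart_inv c y)" .
qed

lemma g_coord_smooth:
  assumes "c \<in> A"
  shows "ck_fun_on \<infinity> A (fst c) (\<lambda>p. g p (coord_field A c u p) (coord_field A c v p))"
  using metric open_chart[OF assms] coord_field_svf[OF assms subset_refl] unfolding riemannian_metric_def by metis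

lemma Gm_smooth:
  assumes "c \<in> A"
  shows "ck_on \<infinity> (snd c ` fst c) (\<lambda>y. Gm c y u v)"
  using g_coord_smooth[OF assms, of u v] assms unfolding ck_fun_on_def Gm_def o_def by fastforce

lemma torsion_free:
  assumes "open U" "X \<in> smooth_vector_fields A U" "Y \<in> smooth_vector_fields A U" "p \<in> U"
  shows "nabla X Y p - nabla Y X p = lie_bracket A X Y p"
  using conjunct2[OF levi_civita[unfolded levi_civita_connection_def], rule_format, OF assms(1-3)] assms(4-) by blast

lemma metric_compatible:
  assumes "open U" "X \<in> smooth_vector_fields A U" "Y \<in> smooth_vector_fields A U"
    "Z \<in> smooth_vector_fields A U" "p \<in> U"
  shows "dir_deriv A p (X p) (\<lambda>q. g q (Y q) (Z q)) = g p (nabla X Y p) (Z p) + g p (Y p) (nabla X Z p)"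
  using conjunct2[OF levi_civita[unfolded levi_civita_connection_def], rule_format, OF assms(1-3)] assms(4-) by blast

text \<open>As the torsion vanishes, the bracket is a difference of covariant derivatives and thus a tangent vector.
  Its component in \<open>c\<close> is zero because coordinate fields have constant components there.\<close>

lemma coord_fields_commute:
  assumes c: "c \<in> A" and p: "p \<in> fst c"
  shows "lie_bracket A (coord_field A c u) (coord_field A c v) p = 0"
proof -
  note E = coord_field_svf[OF c subset_refl] and U = open_chart[OF c]
  have "lie_bracket A (coord_field A c u) (coord_field A c v) p \<in> tangent_space A p"
    using tangent_diff[OF nabla_tangent[OF U E E p] nabla_tangent[OF U E E p]] torsion_free[OF U E E p] by metis
  then show ?thesis
    by (rule tangent_eqI[OF _ tangent_zero c p])
      (simp add: lie_bracket_def c p coord_field_component_derivative)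
qed

lemma Gam_sym:
  assumes c: "c \<in> A" "y \<in> snd c ` fst c"
  shows "Gam c y u v = Gam c y v u"
proof -
  have p: "chart_inv c y \<in> fst c" using c by (rule chart_inv_in')
  note E = coord_field_svf[OF c(1) subset_refl]
  have "nabla (coord_field A c u) (coord_field A c v) (chart_inv c y)
      - nabla (coord_field A c v) (coord_field A c u) (chart_inv c y) = 0"
    unfolding torsion_free[OF open_chart[OF c(1)] E E p] by (rule coord_fields_commute[OF c(1) p])
  then show ?thesis by (simp add: Gam_def)
qed

lemma Gm_compatible:
  assumes c: "c \<in> A" "y \<in> snd c ` fst c"
  shows "frechet_derivative (\<lambda>z. Gm c z u v) (at y) w = Gm c y (Gam c y w u) v + Gm c y u (Gam c y w v)"
proof -
  let ?p = "chart_inv c y" and ?E = "coord_field A c"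
  have p: "?p \<in> fst c" "snd c ?p = y" using c chart_inv_in' chart_inv_right by auto
  note E = coord_field_svf[OF c(1) subset_refl] and U = open_chart[OF c(1)]
  note T = coord_field_tangent[OF c(1) p(1)] and N = nabla_tangent[OF U E E p(1)]
  have "frechet_derivative (\<lambda>z. Gm c z u v) (at y) w
      = frechet_derivative ((\<lambda>q. g q (?E u q) (?E v q)) \<circ> chart_inv c) (at (snd c ?p)) (?E w ?p c)"
    by (simp add: Gm_def[abs_def] o_def p coord_field_self c)
  also have "\<dots> = dir_deriv A ?p (?E w ?p) (\<lambda>q. g q (?E u q) (?E v q))"
    by (rule dir_deriv_chart[OF T c(1) p(1) ck_fun_on_diff[OF g_coord_smooth[OF c(1)] _ U chart_at(1) p(1) chart_at(2)], symmetric])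
      simp
  also have "\<dots> = g ?p (nabla (?E w) (?E u) ?p) (?E v ?p) + g ?p (?E u ?p) (nabla (?E w) (?E v) ?p)"
    by (rule metric_compatible[OF U E E E p(1)])
  also have "\<dots> = Gm c y (Gam c y w u) v + Gm c y u (Gam c y w v)"
    by (simp add: g_in_chart[OF N T c(1) p(1)] g_in_chart[OF T N c(1) p(1)] p coord_field_self c Gam_def)
  finally show ?thesis .
qed

lemma coord_metric: "c \<in> A \<Longrightarrow> coord_metric (snd c ` fst c) (Gm c) (Gam c)"
  by unfold_locales
    (simp_all add: open_image Gm_bilinear Gm_pos Gm_smooth Gam_bilinear Gam_smooth Gm_compatible Gm_sym Gam_sym)

text \<open>The tensor is defined by the constant extensions in the chart \<open>c\<close>. Their bracket vanishes, and each of
  the two iterated covariant derivatives is a derivative of a Christoffel symbol plus a product of two.\<close>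

lemma curvature_in_chart:
  assumes "u \<in> tangent_space A p" "v \<in> tangent_space A p" "w \<in> tangent_space A p"
  defines "c \<equiv> chart_at A p"
  shows "curvature_tensor A nabla p u v w \<in> tangent_space A p"
    and "curvature_tensor A nabla p u v w c
      = coord_metric.Riem (Gam c) (snd c p) (u c) (v c) (w c)"
proof -
  have c: "c \<in> A" "p \<in> fst c" unfolding c_def by (rule chart_at)+
  interpret C: coord_metric "snd c ` fst c" "Gm c" "Gam c" by (rule coord_metric[OF c(1)])
  let ?E = "coord_field A c"
  note E = coord_field_svf[OF c(1) subset_refl] and U = open_chart[OF c(1)]
  let ?X = "?E (u c)" and ?Y = "?E (v c)" and ?Z = "?E (w c)"
  note N = nabla_svf[OF U E E]
  have L: "lie_bracket A ?X ?Y \<in> smooth_vector_fields A (fst c)"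
  proof (rule svfI)
    show "lie_bracket A ?X ?Y q \<in> tangent_space A q" if "q \<in> fst c" for q
      using coord_fields_commute[OF c(1) that] tangent_zero by simp
    show "ck_on \<infinity> (snd d ` (fst d \<inter> fst c)) (\<lambda>y. lie_bracket A ?X ?Y (chart_inv d y) d)" if "d \<in> A" for d
      by (rule iffD1[OF ck_on_cong ck_on_const[of _ _ 0]])
        (use that in \<open>auto simp: chart_inv_left coord_fields_commute[OF c(1)]\<close>)
  qed
  have L0: "nabla (lie_bracket A ?X ?Y) ?Z p = 0"
    using nabla_cong[OF U L E svf_zero E coord_fields_commute[OF c(1)] refl c(2)]
      nabla_zero(1)[OF U E c(2)] by simp
  have R: "curvature_tensor A nabla p u v w = nabla ?X (nabla ?Y ?Z) p - nabla ?Y (nabla ?X ?Z) p"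
    by (simp add: curvature_tensor_def curvature_field_def extend_tvec_def L0 flip: c_def)
  show "curvature_tensor A nabla p u v w \<in> tangent_space A p"
    unfolding R by (intro tangent_diff nabla_tangent[OF U] E N c)
  have "nabla (?E a) (nabla (?E b) ?Z) p c = C.dGam (snd c p) a b (w c) + Gam c (snd c p) a (Gam c (snd c p) b (w c))" for a b
    unfolding nabla_in_chart[OF U E N c(1) subset_refl c(2)] C.dGam_def
    by (simp add: coord_field_self c Gam_def[abs_def] chart_inv_left)
  then show "curvature_tensor A nabla p u v w c = C.Riem (snd c p) (u c) (v c) (w c)"
    unfolding R C.Riem_def by simp
qed

end


section \<open>Fields along curves\<close>

lemma ck_on_bilinear_family:
  fixes B :: "'e::euclidean_space \<Rightarrow> 'd::euclidean_space \<Rightarrow> 'd \<Rightarrow> 'c::real_normed_vector"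
    and z :: "'a::euclidean_space \<Rightarrow> 'e"
  assumes lin: "\<And>y. y \<in> U \<Longrightarrow> bilinear (B y)" and B: "\<And>e f. ck_on k U (\<lambda>y. B y e f)"
    and z: "ck_on k S z" "\<And>s. s \<in> S \<Longrightarrow> z s \<in> U" and u: "ck_on k S u" and v: "ck_on k S v"
  shows "ck_on k S (\<lambda>s. B (z s) (u s) (v s))"
proof -
  have "B (z s) (u s) (v s) = (\<Sum>i\<in>Basis. \<Sum>j\<in>Basis. ((u s \<bullet> i) * (v s \<bullet> j)) *\<^sub>R B (z s) i j)" if "s \<in> S" for s
    by (rule bilinear_family_expand[OF lin[OF z(2)[OF that]]])
  moreover have "ck_on k S (\<lambda>s. \<Sum>i\<in>Basis. \<Sum>j\<in>Basis. ((u s \<bullet> i) * (v s \<bullet> j)) *\<^sub>R B (z s) i j)"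
    by (intro ck_on_sum ck_on_scaleR ck_on_mult ck_on_inner ck_on_const u v ck_on_compose[OF B z(1)])
      (use z(2) in auto)
  ultimately show ?thesis
    by (rule iffD2[OF ck_on_cong])
qed

lemma ck_map_on_domain:
  assumes x: "ck_map_on k A S x" and c: "c \<in> A"
  obtains W where "open W" "{s\<in>S. x s \<in> fst c} = S \<inter> W"
proof -
  have "\<forall>s\<in>{s\<in>S. x s \<in> fst c}. \<exists>W. open W \<and> s \<in> W \<and> x ` (S \<inter> W) \<subseteq> fst c"
    using x c unfolding ck_map_on_def by blast
  then obtain W where W: "\<And>s. s \<in> {s\<in>S. x s \<in> fst c} \<Longrightarrow> open (W s) \<and> s \<in> W s \<and> x ` (S \<inter> W s) \<subseteq> fst c"
    by metis
  show thesis
    by (rule that[of "\<Union>s\<in>{s\<in>S. x s \<in> fst c}. W s"]) (use W in \<open>(force intro!: open_UN | blast)+\<close>)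
qed

lemma ck_map_on_chart:
  assumes x: "ck_map_on k A S x" and c: "c \<in> A"
  shows "ck_on k {s\<in>S. x s \<in> fst c} (\<lambda>s. snd c (x s))"
proof (rule ck_on_locally)
  fix p assume p: "p \<in> {s\<in>S. x s \<in> fst c}"
  then obtain W where W: "open W" "p \<in> W" "ck_on k (S \<inter> W) (snd c \<circ> x)"
    using x c unfolding ck_map_on_def by blast
  show "\<exists>W. open W \<and> p \<in> W \<and> ck_on k ({s \<in> S. x s \<in> fst c} \<inter> W) (\<lambda>s. snd c (x s))"
    using W by (intro exI[of _ W]) (auto simp: o_def intro: ck_on_subset)
qed

lemma ck_map_onI:
  assumes "\<And>c s. c \<in> A \<Longrightarrow> s \<in> S \<Longrightarrow> x s \<in> fst c \<Longrightarrow>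
    \<exists>W. open W \<and> s \<in> W \<and> x ` (S \<inter> W) \<subseteq> fst c \<and> ck_on k (S \<inter> W) (\<lambda>s. snd c (x s))"
  shows "ck_map_on k A S x"
  using assms unfolding ck_map_on_def o_def by blast

lemma ck_map_on_subset:
  assumes "ck_map_on k A S x" "T \<subseteq> S"
  shows "ck_map_on k A T x"
proof (rule ck_map_onI)
  fix c s assume "c \<in> A" "s \<in> T" "x s \<in> fst c"
  then obtain W where "open W" "s \<in> W" "x ` (S \<inter> W) \<subseteq> fst c" "ck_on k (S \<inter> W) (snd c \<circ> x)"
    using assms unfolding ck_map_on_def by (metis subsetD)
  then show "\<exists>W. open W \<and> s \<in> W \<and> x ` (T \<inter> W) \<subseteq> fst c \<and> ck_on k (T \<inter> W) (\<lambda>s. snd c (x s))"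
    using assms(2) ck_on_subset[of k "S \<inter> W" "snd c \<circ> x" "T \<inter> W"]
    by (intro exI[of _ W]) (auto simp: o_def)
qed

text \<open>Velocities and covariant derivatives are local: they depend only on the germ of the curve, of the
  field and of the parameter set.\<close>

context
  fixes W I I' :: "real set" and x x' :: "real \<Rightarrow> 'm::topological_space"
  assumes W: "open W" and I: "I \<inter> W = I' \<inter> W" and x: "\<And>s. s \<in> I \<inter> W \<Longrightarrow> x s = x' s"
begin

lemma vector_derivative_cong_germ:
  assumes "\<And>s. s \<in> I \<inter> W \<Longrightarrow> f s = f' s" "t \<in> I \<inter> W"
  shows "vector_derivative f (at t within I) = vector_derivative f' (at t within I')"
proof -
  have "at t within I = at t within I'"
    by (rule at_within_nhd[of t W]) (use assms W I in auto)
  moreover have "\<forall>\<^sub>F s in nhds t. s \<in> I \<longrightarrow> f s = f' s"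
    unfolding eventually_nhds using W assms by blast
  ultimately show ?thesis
    unfolding vector_derivative_def using has_vector_derivative_cong_ev[of I f f' t] assms by auto
qed

lemma velocity_cong:
  fixes A :: "('m, 'e::euclidean_space) chart set"
  assumes "t \<in> I \<inter> W"
  shows "velocity A I x t = velocity A I' x' t"
proof
  fix c :: "('m, 'e) chart"
  have "vector_derivative (\<lambda>s. snd c (x s)) (at t within I) = vector_derivative (\<lambda>s. snd c (x' s)) (at t within I')"
    by (rule vector_derivative_cong_germ) (use x assms in auto)
  then show "velocity A I x t c = velocity A I' x' t c"
    unfolding velocity_def using x[OF assms] by auto
qed

lemma curve_deriv_cong:
  fixes A :: "('m, 'e::euclidean_space) chart set"
  assumes "t \<in> I \<inter> W"
  shows "curve_deriv A nabla I x k t = curve_deriv A nabla I' x' k t"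
proof -
  have "(cov_deriv A nabla I x ^^ n) (velocity A I x) t = (cov_deriv A nabla I' x' ^^ n) (velocity A I' x') t"
    if "t \<in> I \<inter> W" for n t
    using that
  proof (induction n arbitrary: t)
    case 0
    then show ?case by (simp add: velocity_cong)
  next
    case (Suc n)
    show ?case
    proof
      fix c
      have "vector_derivative (\<lambda>s. (cov_deriv A nabla I x ^^ n) (velocity A I x) s c) (at t within I)
        = vector_derivative (\<lambda>s. (cov_deriv A nabla I' x' ^^ n) (velocity A I' x') s c) (at t within I')"
        by (rule vector_derivative_cong_germ) (use Suc in auto)
      then show "(cov_deriv A nabla I x ^^ Suc n) (velocity A I x) t c
          = (cov_deriv A nabla I' x' ^^ Suc n) (velocity A I' x') t c"
        unfolding funpow.simps o_def cov_deriv_def[of A nabla I x "(cov_deriv A nabla I x ^^ n) (velocity A I x)"]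
          cov_deriv_def[of A nabla I' x' "(cov_deriv A nabla I' x' ^^ n) (velocity A I' x')"]
        unfolding x[OF Suc.prems] Suc.IH[OF Suc.prems] velocity_cong[OF Suc.prems, of A] by simp
    qed
  qed
  then show ?thesis using assms by (simp add: curve_deriv_def)
qed

end

lemma curve_deriv_1: "curve_deriv A nabla I x (Suc 0) = velocity A I x"
  by (simp add: curve_deriv_def)

lemma curve_deriv_Suc: "curve_deriv A nabla I x (Suc (Suc k)) = cov_deriv A nabla I x (curve_deriv A nabla I x (Suc k))"
  by (simp add: curve_deriv_def)

context connected_atlas
begin

text \<open>Smoothness of a field along \<open>x\<close> is tested in every chart, on the relatively open set of parameters that
  \<open>x\<close> maps into its domain.\<close>

definition smooth_along :: "real set \<Rightarrow> (real \<Rightarrow> 'm) \<Rightarrow> (real \<Rightarrow> ('m, 'e) tvec) \<Rightarrow> bool" where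
  "smooth_along I x V \<longleftrightarrow> (\<forall>s\<in>I. V s \<in> tangent_space A (x s)) \<and>
     (\<forall>c\<in>A. ck_on \<infinity> {s\<in>I. x s \<in> fst c} (\<lambda>s. V s c))"

context
  fixes I :: "real set" and x :: "real \<Rightarrow> 'm" and k
  assumes lim: "\<And>t. t \<in> I \<Longrightarrow> at t within I \<noteq> bot" and x: "ck_map_on k A I x" and k: "1 \<le> k"
begin

lemma at_within_domain:
  assumes "c \<in> A" "t \<in> I" "x t \<in> fst c"
  shows "at t within {s\<in>I. x s \<in> fst c} = at t within I"
proof -
  obtain W where "open W" "{s\<in>I. x s \<in> fst c} = I \<inter> W" using ck_map_on_domain[OF x assms(1)] .
  then show ?thesis by (intro at_within_nhd[of t W]) (use assms in auto)
qed

lemma domain_eventually: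
  assumes "c \<in> A" "t \<in> I" "x t \<in> fst c"
  shows "\<forall>\<^sub>F s in nhds t. s \<in> I \<longrightarrow> x s \<in> fst c"
proof -
  obtain W where "open W" "{s\<in>I. x s \<in> fst c} = I \<inter> W" using ck_map_on_domain[OF x assms(1)] .
  then show ?thesis unfolding eventually_nhds using assms by blast
qed

lemma component_derivative:
  assumes V: "ck_on l {s\<in>I. x s \<in> fst c} f" and l: "1 \<le> l" and c: "c \<in> A" "t \<in> I" "x t \<in> fst c"
  shows "(f has_vector_derivative vector_derivative f (at t within I)) (at t within I)"
  using has_vector_derivative_within_ck_on[OF V _ l, of t] at_within_domain[OF c(1)] c lim by simp

lemma component_derivative_smooth:
  assumes V: "ck_on k' {s\<in>I. x s \<in> fst c} f" and c: "c \<in> A" and k': "1 \<le> k'"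
    and l: "\<And>n. enat n \<le> l \<Longrightarrow> enat (Suc n) \<le> k'"
  shows "ck_on l {s\<in>I. x s \<in> fst c} (\<lambda>t. vector_derivative f (at t within I))"
proof -
  have "ck_on l {s\<in>I. x s \<in> fst c} (\<lambda>t. vector_derivative f (at t within {s\<in>I. x s \<in> fst c}))"
    by (rule ck_on_vector_derivative(2)[OF V _ k' l]) (use at_within_domain[OF c] lim in auto)
  then show ?thesis
    by (rule iffD1[OF ck_on_cong, rotated]) (simp add: at_within_domain[OF c])
qed

lemma velocity_has_derivative:
  assumes "c \<in> A" "t \<in> I" "x t \<in> fst c"
  shows "((\<lambda>s. snd c (x s)) has_vector_derivative velocity A I x t c) (at t within I)"
  using component_derivative[OF ck_map_on_chart[OF x assms(1)] k assms] assms by (simp add: velocity_def)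

lemma velocity_component_smooth:
  assumes c: "c \<in> A" and l: "\<And>n. enat n \<le> l \<Longrightarrow> enat (Suc n) \<le> k"
  shows "ck_on l {s\<in>I. x s \<in> fst c} (\<lambda>s. velocity A I x s c)"
  by (rule iffD1[OF ck_on_cong component_derivative_smooth[OF ck_map_on_chart[OF x c] c k l]])
    (use c in \<open>auto simp: velocity_def\<close>)

lemma velocity_tangent:
  assumes t: "t \<in> I"
  shows "velocity A I x t \<in> tangent_space A (x t)"
proof (rule tangentI)
  fix c d assume cd: "c \<in> A" "d \<in> A" "x t \<in> fst c" "x t \<in> fst d"
  let ?D = "frechet_derivative (transition c d) (at (snd c (x t)))"
  have D: "(transition c d has_derivative ?D) (at (snd c (x t)))"
    using transition_differentiable[OF cd] by (simp add: frechet_derivative_works)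
  have "((\<lambda>s. transition c d (snd c (x s))) has_derivative (\<lambda>h. ?D (h *\<^sub>R velocity A I x t c))) (at t within I)"
    using has_derivative_compose[OF velocity_has_derivative[OF cd(1) t cd(3), unfolded has_vector_derivative_def] D] .
  then have "((\<lambda>s. transition c d (snd c (x s))) has_vector_derivative ?D (velocity A I x t c)) (at t within I)"
    by (simp add: has_vector_derivative_def linear_cmul[OF transition_linear[OF cd]])
  then have "((\<lambda>s. snd d (x s)) has_vector_derivative ?D (velocity A I x t c)) (at t within I)"
    by (rule has_vector_derivative_transform_eventually)
      (use domain_eventually[OF cd(1) t cd(3)] in \<open>auto elim!: eventually_mono simp: transition_apply cd\<close>)
  then show "velocity A I x t d = ?D (velocity A I x t c)"
    using vector_derivative_unique_within[OF lim[OF t] velocity_has_derivative[OF cd(2) t cd(4)]] by metis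
qed (auto simp: velocity_def)

lemma cov_deriv_component:
  assumes "c \<in> A" "x t \<in> fst c"
  shows "cov_deriv A nabla I x V t c = vector_derivative (\<lambda>s. V s c) (at t within I)
    + Gam c (snd c (x t)) (velocity A I x t c) (V t c)"
  using assms by (simp add: cov_deriv_def Gam_def chart_inv_left)

text \<open>The covariant derivative of \<open>V = V\<^sup>j \<partial>\<^sub>j\<close> is the tangent vector \<open>(V\<^sup>j)' \<partial>\<^sub>j + V\<^sup>j \<nabla> \<partial>\<^sub>j\<close>, whose
  definition uses one chart only; its component in another chart is obtained by differentiating the change of
  components and applying the coordinate formula for the connection to the transported coordinate fields.\<close>

lemma cov_deriv_tangent:
  assumes V: "smooth_along I x V" and t: "t \<in> I"
  shows "cov_deriv A nabla I x V t \<in> tangent_space A (x t)"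
proof -
  define d where "d = chart_at A (x t)"
  have d: "d \<in> A" "x t \<in> fst d" unfolding d_def by (rule chart_at)+
  have VT: "V s \<in> tangent_space A (x s)" if "s \<in> I" for s using V that by (simp add: smooth_along_def)
  have Vd: "((\<lambda>s. V s c) has_vector_derivative vector_derivative (\<lambda>s. V s c) (at t within I)) (at t within I)"
    if "c \<in> A" "x t \<in> fst c" for c
    by (rule component_derivative[where l=\<infinity>]) (use V that t in \<open>auto simp: smooth_along_def\<close>)
  define V' where "V' = vector_derivative (\<lambda>s. V s d) (at t within I)"
  define E where "E = coord_field A d"
  define Z where "Z = E V' (x t) + nabla (E (velocity A I x t d)) (E (V t d)) (x t)"
  have EU: "E e \<in> smooth_vector_fields A (fst d)" for e
    unfolding E_def using d by (intro coord_field_svf) auto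
  have "Z \<in> tangent_space A (x t)"
    unfolding Z_def
    by (intro tangent_add nabla_tangent[OF open_chart[OF d(1)] EU EU] d) (simp add: E_def coord_field_tangent d)
  moreover have "cov_deriv A nabla I x V t = Z"
  proof
    fix c
    show "cov_deriv A nabla I x V t c = Z c"
    proof (cases "c \<in> A \<and> x t \<in> fst c")
      case False
      then show ?thesis
        using tangent_off[OF \<open>Z \<in> tangent_space A (x t)\<close>, of c] by (auto simp: cov_deriv_def)
    next
      case True
      then have c: "c \<in> A" "x t \<in> fst c" by auto
      let ?U = "snd c ` (fst c \<inter> fst d)" and ?L = "\<lambda>z e. E e (chart_inv c z) c"
      have opU: "open ?U" by (intro open_image_Int open_chart c d)
      have "((\<lambda>s. ?L (snd c (x s)) (V s d)) has_vector_derivative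
         (frechet_derivative (\<lambda>z. ?L z (V t d)) (at (snd c (x t))) (velocity A I x t c)
          + ?L (snd c (x t)) V')) (at t within I)"
      proof (rule linear_family_derivative[OF opU _ _ velocity_has_derivative[OF c(1) t c(2)]])
        show "linear (\<lambda>e. ?L y e)" if "y \<in> ?U" for y
          unfolding E_def using chart_inv_in[OF c(1) that] by (intro coord_field_linear d) auto
        show "(\<lambda>y. ?L y e) differentiable at y" if "y \<in> ?U" for y e
          unfolding E_def by (rule ck_on_differentiable[OF coord_field_component_smooth[OF d(1) c(1)] opU that]) simp
        show "((\<lambda>s. V s d) has_vector_derivative V') (at t within I)" unfolding V'_def by (rule Vd[OF d])
      qed (use c d in auto)
      then have "((\<lambda>s. V s c) has_vector_derivative
         (frechet_derivative (\<lambda>z. ?L z (V t d)) (at (snd c (x t))) (velocity A I x t c)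
          + ?L (snd c (x t)) V')) (at t within I)"
      proof (rule has_vector_derivative_transform_eventually)
        have *: "?L (snd c (x s)) (V s d) = V s c" if "s \<in> I" "x s \<in> fst c" "x s \<in> fst d" for s
          using coord_field_components[OF VT[OF that(1)] d(1) that(3)] that by (simp add: E_def chart_inv_left c)
        show "\<forall>\<^sub>F s in nhds t. s \<in> I \<longrightarrow> ?L (snd c (x s)) (V s d) = V s c"
          using domain_eventually[OF c(1) t c(2)] domain_eventually[OF d(1) t d(2)]
          by eventually_elim (use * in blast)
        show "?L (snd c (x t)) (V t d) = V t c" by (rule *[OF t c(2) d(2)])
      qed
      then have V'c: "vector_derivative (\<lambda>s. V s c) (at t within I)
        = frechet_derivative (\<lambda>z. ?L z (V t d)) (at (snd c (x t))) (velocity A I x t c) + E V' (x t) c"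
        using vector_derivative_within[OF lim[OF t]] c by (simp add: chart_inv_left)
      have sv: "E e \<in> smooth_vector_fields A (fst c \<inter> fst d)" for e by (rule svf_subset[OF EU]) simp
      have "nabla (E (velocity A I x t d)) (E (V t d)) (x t) c
        = frechet_derivative (\<lambda>z. ?L z (V t d)) (at (snd c (x t))) (E (velocity A I x t d) (x t) c)
          + Gam c (snd c (x t)) (E (velocity A I x t d) (x t) c) (E (V t d) (x t) c)"
        by (rule nabla_in_chart[OF _ sv sv c(1)]) (use c d in \<open>auto intro: open_Int open_chart\<close>)
      then show ?thesis
        by (simp add: cov_deriv_component[OF c] V'c Z_def E_def add_ac
            coord_field_components[OF velocity_tangent[OF t] d] coord_field_components[OF VT[OF t] d])
    qed
  qed
  ultimately show ?thesis by simp
qed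

end

context
  fixes I :: "real set" and x :: "real \<Rightarrow> 'm"
  assumes lim: "\<And>t. t \<in> I \<Longrightarrow> at t within I \<noteq> bot" and x: "ck_map_on \<infinity> A I x"
begin

lemma smooth_along_velocity: "smooth_along I x (velocity A I x)"
  unfolding smooth_along_def
  using velocity_tangent[OF lim x] velocity_component_smooth[OF lim x] by auto

lemma smooth_along_cov_deriv:
  assumes V: "smooth_along I x V"
  shows "smooth_along I x (cov_deriv A nabla I x V)"
  unfolding smooth_along_def
proof (intro conjI ballI)
  show "cov_deriv A nabla I x V s \<in> tangent_space A (x s)" if "s \<in> I" for s
    by (rule cov_deriv_tangent[OF lim x _ V that]) simp_all
  fix c assume c: "c \<in> A"
  have Vc: "ck_on \<infinity> {s\<in>I. x s \<in> fst c} (\<lambda>s. V s c)" using V c by (simp add: smooth_along_def)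
  have "ck_on \<infinity> {s\<in>I. x s \<in> fst c} (\<lambda>s. vector_derivative (\<lambda>s. V s c) (at s within I)
    + Gam c (snd c (x s)) (velocity A I x s c) (V s c))"
    by (intro ck_on_add component_derivative_smooth[OF lim x _ Vc c]
        ck_on_bilinear_family[OF Gam_bilinear[OF c] Gam_smooth[OF c] ck_map_on_chart[OF x c] _
          velocity_component_smooth[OF lim x _ c] Vc]) auto
  then show "ck_on \<infinity> {s\<in>I. x s \<in> fst c} (\<lambda>s. cov_deriv A nabla I x V s c)"
    by (rule iffD1[OF ck_on_cong, rotated]) (use cov_deriv_component[OF lim x _ c, of _ V] in auto)
qed

lemma smooth_along_curve_deriv: "smooth_along I x (curve_deriv A nabla I x (Suc k))"
  by (induction k)
    (simp_all add: curve_deriv_1 curve_deriv_Suc smooth_along_velocity smooth_along_cov_deriv)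

lemma curve_deriv_tangent: "t \<in> I \<Longrightarrow> curve_deriv A nabla I x (Suc k) t \<in> tangent_space A (x t)"
  using smooth_along_curve_deriv by (simp add: smooth_along_def)

lemma curve_deriv_component_smooth:
  "c \<in> A \<Longrightarrow> ck_on \<infinity> {s\<in>I. x s \<in> fst c} (\<lambda>s. curve_deriv A nabla I x (Suc k) s c)"
  using smooth_along_curve_deriv by (simp add: smooth_along_def)

lemma curve_deriv_has_derivative:
  assumes "c \<in> A" "t \<in> I" "x t \<in> fst c"
  shows "((\<lambda>s. curve_deriv A nabla I x (Suc k) s c) has_vector_derivative
    vector_derivative (\<lambda>s. curve_deriv A nabla I x (Suc k) s c) (at t within I)) (at t within I)"
  by (rule component_derivative[OF lim x _ curve_deriv_component_smooth]) (use assms in auto)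

lemma curve_deriv_Suc_component:
  assumes "c \<in> A" "x t \<in> fst c"
  shows "curve_deriv A nabla I x (Suc (Suc k)) t c =
    vector_derivative (\<lambda>s. curve_deriv A nabla I x (Suc k) s c) (at t within I)
    + Gam c (snd c (x t)) (velocity A I x t c) (curve_deriv A nabla I x (Suc k) t c)"
  unfolding curve_deriv_Suc by (rule cov_deriv_component[OF lim x _ assms]) simp_all

end
end


section \<open>Gluing and bump functions on the line\<close>

lemma cn_on_open_real_SucI:
  fixes f :: "real \<Rightarrow> 'b::real_normed_vector"
  assumes W: "open W" and f: "\<And>x. x \<in> W \<Longrightarrow> (f has_vector_derivative f' x) (at x)" and f': "cn_on_open n W f'"
  shows "cn_on_open (Suc n) W f"
  unfolding cn_on_open.simps
proof (intro conjI ballI allI)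
  show "f differentiable (at x)" if "x \<in> W" for x
    using f[OF that] by (auto simp: has_vector_derivative_def differentiable_def)
  fix v
  have "cn_on_open n W (\<lambda>x. v *\<^sub>R f' x)"
    by (rule cn_on_open_bilinear[OF bounded_bilinear_scaleR W cn_on_open_const f'])
  moreover have "frechet_derivative f (at x) v = v *\<^sub>R f' x" if "x \<in> W" for x
    using frechet_derivative_at[OF f[OF that, unfolded has_vector_derivative_def]] by metis
  ultimately show "cn_on_open n W (\<lambda>x. frechet_derivative f (at x) v)"
    using cn_on_open_cong[OF W, of "\<lambda>x. frechet_derivative f (at x) v" "\<lambda>x. v *\<^sub>R f' x" n] by simp
qed

lemma cn_on_open_real_SucD:
  fixes f :: "real \<Rightarrow> 'b::real_normed_vector"
  assumes "cn_on_open (Suc n) W f"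
  defines "f' \<equiv> (\<lambda>x. frechet_derivative f (at x) 1)"
  shows "x \<in> W \<Longrightarrow> (f has_vector_derivative f' x) (at x)" and "cn_on_open n W f'"
proof -
  show "(f has_vector_derivative f' x) (at x)" if "x \<in> W"
    using frechet_derivative_line[of f 0 x 1 UNIV] assms(1) that unfolding f'_def by simp
  show "cn_on_open n W f'" using assms(1) unfolding f'_def by simp
qed

lemma has_vector_derivative_glue:
  fixes F :: "real \<Rightarrow> 'b::real_normed_vector"
  assumes "(F has_vector_derivative F' x) (at x)" "(G has_vector_derivative G' x) (at x)"
    and "F m = G m" "F' m = G' m"
  shows "((\<lambda>t. if t \<in> {..m} then F t else G t) has_vector_derivative
    (if x \<in> {..m} then F' x else G' x)) (at x)"
  by (rule has_vector_derivative_If_within_closures[where T="{m<..}"])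
    (use assms in \<open>auto intro: has_vector_derivative_at_within\<close>)

lemma cn_on_open_2_glue:
  fixes F G :: "real \<Rightarrow> 'b::real_normed_vector"
  assumes W: "open W"
    and F: "\<And>x. x \<in> W \<Longrightarrow> (F has_vector_derivative F' x) (at x)"
      "\<And>x. x \<in> W \<Longrightarrow> (F' has_vector_derivative F'' x) (at x)" "continuous_on W F''"
    and G: "\<And>x. x \<in> W \<Longrightarrow> (G has_vector_derivative G' x) (at x)"
      "\<And>x. x \<in> W \<Longrightarrow> (G' has_vector_derivative G'' x) (at x)" "continuous_on W G''"
    and m: "F m = G m" "F' m = G' m" "F'' m = G'' m"
  shows "cn_on_open 2 W (\<lambda>t. if t \<in> {..m} then F t else G t)"
proof -
  have "continuous_on W (\<lambda>t. if t \<le> m then F'' t else G'' t)"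
  proof -
    have "continuous_on ({t\<in>W. t \<le> m} \<union> {t\<in>W. m \<le> t}) (\<lambda>t. if t \<le> m then F'' t else G'' t)"
    proof (rule continuous_on_cases_local)
      show "closedin (top_of_set ({t\<in>W. t \<le> m} \<union> {t\<in>W. m \<le> t})) {t\<in>W. t \<le> m}"
        by (auto simp: closedin_closed intro!: exI[of _ "{..m}"])
      show "closedin (top_of_set ({t\<in>W. t \<le> m} \<union> {t\<in>W. m \<le> t})) {t\<in>W. m \<le> t}"
        by (auto simp: closedin_closed intro!: exI[of _ "{m..}"])
      show "continuous_on {t\<in>W. t \<le> m} F''" by (rule continuous_on_subset[OF F(3)]) auto
      show "continuous_on {t\<in>W. m \<le> t} G''" by (rule continuous_on_subset[OF G(3)]) auto
      show "F'' t = G'' t" if "t \<in> {t\<in>W. t \<le> m} \<and> \<not> t \<le> m \<or> t \<in> {t\<in>W. m \<le> t} \<and> t \<le> m" for t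
        using that m(3) by (cases "t = m") auto
    qed
    moreover have "{t\<in>W. t \<le> m} \<union> {t\<in>W. m \<le> t} = W" by auto
    ultimately show ?thesis by simp
  qed
  then have "cn_on_open (Suc (Suc 0)) W (\<lambda>t. if t \<in> {..m} then F t else G t)"
    by (intro cn_on_open_real_SucI[OF W has_vector_derivative_glue[where F=F and F'=F' and G=G and G'=G', OF F(1) G(1) m(1,2)]]
        cn_on_open_real_SucI[OF W has_vector_derivative_glue[where F=F' and F'=F'' and G=G' and G'=G'', OF F(2) G(2) m(2,3)]]) auto
  then show ?thesis by (simp only: numeral_2_eq_2)
qed

text \<open>The functions \<open>p(1/x) exp(-1/x)\<close> on \<open>x > 0\<close>, extended by \<open>0\<close>. The class is closed under
  differentiation, which gives smoothness at once.\<close>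

definition flat :: "real poly \<Rightarrow> real \<Rightarrow> real" where
  "flat p x = (if x > 0 then poly p (1 / x) * exp (- (1 / x)) else 0)"

text \<open>The additional power of \<open>u\<close> makes the induction on the polynomial work.\<close>

lemma poly_div_exp_tendsto_0: "((\<lambda>u. u ^ k * poly p u / exp u) \<longlongrightarrow> (0::real)) at_top"
proof (induction p arbitrary: k)
  case 0
  then show ?case by simp
next
  case (pCons a p)
  have "((\<lambda>u. a * (u ^ k / exp u) + u ^ Suc k * poly p u / exp u) \<longlongrightarrow> a * 0 + 0) at_top"
    by (intro tendsto_intros tendsto_power_div_exp_0 pCons.IH)
  then show ?case by (simp add: algebra_simps add_divide_distrib)
qed

lemma flat_has_derivative:
  "(flat p has_vector_derivative flat ((p - pderiv p) * [:0, 0, 1:]) x) (at x)"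
proof -
  let ?q = "(p - pderiv p) * [:0, 0, 1:]"
  consider "x > 0" | "x < 0" | "x = 0" by linarith
  then have "(flat p has_real_derivative flat ?q x) (at x)"
  proof cases
    case 1
    have "((\<lambda>x. poly p (1 / x) * exp (- (1 / x))) has_real_derivative flat ?q x) (at x)"
      using 1 by (auto intro!: derivative_eq_intros DERIV_chain2[OF poly_DERIV]
          simp: flat_def field_simps power2_eq_square)
    then show ?thesis
      by (rule has_field_derivative_transform_within_open[of _ _ _ "{0<..}"]) (use 1 in \<open>auto simp: flat_def\<close>)
  next
    case 2
    have "((\<lambda>x. 0) has_real_derivative flat ?q x) (at x)" using 2 by (simp add: flat_def)
    then show ?thesis
      by (rule has_field_derivative_transform_within_open[of _ _ _ "{..<0}"]) (use 2 in \<open>auto simp: flat_def\<close>)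
  next
    case 3
    \<comment> \<open>substitute \<open>h = 1/u\<close> with \<open>u\<close> tending to infinity\<close>
    have "((\<lambda>h. flat p h / h) \<longlongrightarrow> 0) (at_right 0)"
    proof -
      have "((\<lambda>h. (inverse h) ^ 1 * poly p (inverse h) / exp (inverse h)) \<longlongrightarrow> 0) (at_right (0::real))"
        by (rule filterlim_compose[OF poly_div_exp_tendsto_0 filterlim_inverse_at_top_right])
      moreover have "\<forall>\<^sub>F h in at_right (0::real). (inverse h) ^ 1 * poly p (inverse h) / exp (inverse h) = flat p h / h"
        unfolding eventually_at_right_field
        by (intro exI[of _ 1]) (auto simp: flat_def exp_minus field_simps)
      ultimately show ?thesis by (rule Lim_transform_eventually)
    qed
    moreover have "((\<lambda>h. flat p h / h) \<longlongrightarrow> 0) (at_left 0)"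
      by (rule Lim_transform_eventually[OF tendsto_const])
        (auto simp: eventually_at_left_field flat_def intro!: exI[of _ "-1"])
    ultimately have "((\<lambda>h. flat p h / h) \<longlongrightarrow> 0) (at 0)" by (simp add: filterlim_split_at)
    then show ?thesis using 3 by (simp add: DERIV_def flat_def)
  qed
  then show ?thesis by (simp add: has_real_derivative_iff_has_vector_derivative)
qed

lemma flat_smooth: "cn_on_open n UNIV (flat p)"
proof (induction n arbitrary: p)
  case 0
  show ?case
    using flat_has_derivative
    by (auto simp: continuous_on_eq_continuous_within intro: has_vector_derivative_continuous)
next
  case (Suc n)
  show ?case by (rule cn_on_open_real_SucI[OF open_UNIV flat_has_derivative Suc])
qed

definition bump :: "real \<Rightarrow> real \<Rightarrow> real \<Rightarrow> real" where
  "bump a b t = flat 1 (t - a) * flat 1 (b - t)"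

lemma bump_pos: "a < t \<Longrightarrow> t < b \<Longrightarrow> bump a b t > 0"
  by (simp add: bump_def flat_def)

lemma bump_zero: "t \<notin> {a<..<b} \<Longrightarrow> bump a b t = 0"
  by (auto simp: bump_def flat_def)

lemma bump_smooth: "ck_on \<infinity> UNIV (bump a b)"
proof -
  have f: "ck_on \<infinity> UNIV (flat 1)" using ck_on_open_iff[OF open_UNIV, of \<infinity> "flat 1"] flat_smooth by blast
  have 1: "ck_on \<infinity> UNIV (\<lambda>t. t + - a)" "ck_on \<infinity> UNIV (\<lambda>t. b + (- 1) * t)"
    by (intro ck_on_add ck_on_const ck_on_mult ck_on_bounded_linear[OF bounded_linear_ident])+
  show ?thesis
    unfolding bump_def[abs_def]
    using ck_on_mult[OF ck_on_compose[OF f 1(1)] ck_on_compose[OF f 1(2)]] by simp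
qed

lemma nonneg_integral_zero:
  fixes f :: "real \<Rightarrow> real"
  assumes "continuous_on {a..b} f" "\<And>t. t \<in> {a..b} \<Longrightarrow> 0 \<le> f t" "integral {a..b} f = 0" "t \<in> {a..b}" "a < b"
  shows "f t = 0"
proof -
  have "(f has_integral 0) (cbox a b)"
    using integrable_integral[OF integrable_continuous_interval[OF assms(1)]] assms(3) by (simp add: box_real)
  then show ?thesis
    using has_integral_0_cbox_imp_0[of a b f t] assms by (auto simp: box_real)
qed


section \<open>The energy density\<close>

context riemannian_atlas
begin

definition density :: "real \<Rightarrow> ('m \<Rightarrow> real) \<Rightarrow> real set \<Rightarrow> (real \<Rightarrow> 'm) \<Rightarrow> real \<Rightarrow> real" where
  "density \<sigma> w I x t = 1/2 *
     (g (x t) (curve_deriv A nabla I x 2 t) (curve_deriv A nabla I x 2 t)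
      + \<sigma> * g (x t) (velocity A I x t) (velocity A I x t) + w (x t))"

lemma density_cong:
  assumes "open W" "I \<inter> W = I' \<inter> W" "\<And>s. s \<in> I \<inter> W \<Longrightarrow> x s = x' s" "t \<in> I \<inter> W"
  shows "density \<sigma> w I x t = density \<sigma> w I' x' t"
  using curve_deriv_cong[OF assms, where A=A and nabla=nabla and k=2] velocity_cong[OF assms, where A=A] assms(3)[OF assms(4)]
  by (simp add: density_def)

text \<open>The left-hand side involves the two tangent vectors \<open>dx/dt\<close> and \<open>D\<^sup>2x/dt\<^sup>2\<close>, the right-hand side only their
  components in \<open>c\<close>; here it matters that both are tangent vectors, as the metric is bilinear on those only.\<close>

lemma density_in_chart:
  assumes lim: "\<And>t. t \<in> I \<Longrightarrow> at t within I \<noteq> bot" and x: "ck_map_on \<infinity> A I x"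
    and c: "c \<in> A" and t: "t \<in> I" "x t \<in> fst c"
  shows "density \<sigma> w I x t = coord_metric.Lag (Gm c) (Gam c) \<sigma> (w \<circ> chart_inv c) (snd c (x t))
    (velocity A I x t c) (vector_derivative (\<lambda>s. velocity A I x s c) (at t within I))"
proof -
  interpret C: coord_metric "snd c ` fst c" "Gm c" "Gam c" by (rule coord_metric[OF c])
  have D2: "curve_deriv A nabla I x 2 t \<in> tangent_space A (x t)"
    using curve_deriv_tangent[OF lim x t(1), of 1] by (simp add: numeral_2_eq_2)
  have D2c: "curve_deriv A nabla I x 2 t c = C.acc (snd c (x t)) (velocity A I x t c)
      (vector_derivative (\<lambda>s. velocity A I x s c) (at t within I))"
    using curve_deriv_Suc_component[OF lim x c t(2), of 0]
    by (simp add: numeral_2_eq_2 curve_deriv_1 C.acc_def)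
  have v: "velocity A I x t \<in> tangent_space A (x t)"
    by (rule velocity_tangent[OF lim x _ t(1)]) simp_all
  show ?thesis
    by (simp add: density_def C.Lag_def g_in_chart[OF D2 D2 c t(2)] g_in_chart[OF v v c t(2)] D2c chart_inv_left c t)
qed

lemma density_continuous:
  assumes lim: "\<And>t. t \<in> I \<Longrightarrow> at t within I \<noteq> bot" and x: "ck_map_on \<infinity> A I x"
    and w: "ck_fun_on k A UNIV w"
  shows "continuous_on I (density \<sigma> w I x)"
  unfolding continuous_on_eq_continuous_within
proof
  fix t assume t: "t \<in> I"
  define c where "c = chart_at A (x t)"
  have c: "c \<in> A" "x t \<in> fst c" unfolding c_def by (rule chart_at)+
  interpret C: coord_metric "snd c ` fst c" "Gm c" "Gam c" by (rule coord_metric[OF c(1)])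
  let ?J = "{s\<in>I. x s \<in> fst c}"
  have v: "ck_on \<infinity> ?J (\<lambda>s. velocity A I x s c)" by (rule velocity_component_smooth[OF lim x _ c(1)]) simp_all
  have a: "ck_on \<infinity> ?J (\<lambda>s. vector_derivative (\<lambda>s. velocity A I x s c) (at s within I))"
    by (rule component_derivative_smooth[OF lim x _ v c(1)]) simp_all
  have "continuous_on ?J (\<lambda>s. C.Lag \<sigma> (w \<circ> chart_inv c) (snd c (x s))
    (velocity A I x s c) (vector_derivative (\<lambda>s. velocity A I x s c) (at s within I)))"
  proof (rule C.continuous_Lag)
    have "ck_on k (snd c ` (fst c \<inter> UNIV)) (w \<circ> chart_inv c)"
      using w c(1) unfolding ck_fun_on_def by blast
    then show "continuous_on (snd c ` fst c) (w \<circ> chart_inv c)"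
      unfolding Int_UNIV_right by (rule ck_on_continuous)
  qed (use ck_on_continuous[OF v] ck_on_continuous[OF a] ck_on_continuous[OF ck_map_on_chart[OF x c(1)]] in auto)
  then have "continuous_on ?J (density \<sigma> w I x)"
    by (rule continuous_on_eq) (use density_in_chart[OF lim x c(1)] in auto)
  then show "continuous (at t within I) (density \<sigma> w I x)"
    using at_within_domain[OF lim x _ c(1) t c(2)] t c(2)
    by (auto simp: continuous_on_eq_continuous_within continuous_within)
qed

end


section \<open>Variations supported in a chart\<close>

lemma ck_map_on_slice:
  assumes "ck_map_on k A (R \<times> I) (\<lambda>(r, t). \<alpha> r t)" "r \<in> R"
  shows "ck_map_on k A I (\<alpha> r)"
proof (rule ck_map_onI)
  fix c s assume c: "c \<in> A" "s \<in> I" "\<alpha> r s \<in> fst c"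
  have "\<forall>p\<in>R \<times> I. (\<lambda>(r, t). \<alpha> r t) p \<in> fst c \<longrightarrow>
      (\<exists>W. open W \<and> p \<in> W \<and> (\<lambda>(r, t). \<alpha> r t) ` (R \<times> I \<inter> W) \<subseteq> fst c \<and> ck_on k (R \<times> I \<inter> W) (snd c \<circ> (\<lambda>(r, t). \<alpha> r t)))"
    using assms(1) c(1) unfolding ck_map_on_def by blast
  from bspec[OF this, of "(r, s)"] obtain W where W: "open W" "(r, s) \<in> W" "(\<lambda>(r, t). \<alpha> r t) ` (R \<times> I \<inter> W) \<subseteq> fst c"
    "ck_on k (R \<times> I \<inter> W) (snd c \<circ> (\<lambda>(r, t). \<alpha> r t))"
    using assms(2) c by auto
  have op: "open ((\<lambda>s. (r, s)) -` W)" by (intro open_vimage W(1) continuous_intros)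
  have aff: "ck_on k (I \<inter> (\<lambda>s. (r, s)) -` W) (\<lambda>s. (r, s))"
  proof -
    have "ck_on k (I \<inter> (\<lambda>s. (r, s)) -` W) (\<lambda>s. (r, 0) + (0, s))"
      by (intro ck_on_add ck_on_const ck_on_bounded_linear bounded_linear_Pair bounded_linear_zero bounded_linear_ident)
    then show ?thesis by simp
  qed
  have "ck_on k (I \<inter> (\<lambda>s. (r, s)) -` W) (\<lambda>s. (snd c \<circ> (\<lambda>(r, t). \<alpha> r t)) (r, s))"
    by (rule ck_on_compose[OF W(4) aff]) (use assms(2) in auto)
  moreover have "\<alpha> r ` (I \<inter> (\<lambda>s. (r, s)) -` W) \<subseteq> fst c"
    using W(3) assms(2) by force
  ultimately show "\<exists>W. open W \<and> s \<in> W \<and> \<alpha> r ` (I \<inter> W) \<subseteq> fst c \<and> ck_on k (I \<inter> W) (\<lambda>s. snd c (\<alpha> r s))"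
    using op W(2) by (intro exI[of _ "(\<lambda>s. (r, s)) -` W"]) simp
qed

text \<open>The coordinate displacement \<open>r \<eta>\<close> is applied on \<open>[a,b]\<close> only, where the curve is in the chart; elsewhere
  \<open>snd c\<close> has no meaning along it.\<close>

definition vary :: "('m, 'e::real_vector) chart \<Rightarrow> real \<Rightarrow> real \<Rightarrow> (real \<Rightarrow> 'e) \<Rightarrow> (real \<Rightarrow> 'm) \<Rightarrow> real \<Rightarrow> real \<Rightarrow> 'm" where
  "vary c a b \<eta> x r t = (if t \<in> {a..b} then chart_inv c (snd c (x t) + r *\<^sub>R \<eta> t) else x t)"

context smooth_atlas
begin

text \<open>Near a parameter in \<open>[a,b]\<close> the curve is still in the chart, even outside \<open>[a,b]\<close>, and the coordinate formula
  remains valid there because \<open>\<eta>\<close> vanishes. Away from \<open>[a,b]\<close> nothing is varied.\<close>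

lemma vary_smooth:
  assumes c: "c \<in> A" and x: "ck_map_on k A I x" and xc: "\<And>t. t \<in> I \<Longrightarrow> t \<in> {a..b} \<Longrightarrow> x t \<in> fst c"
    and \<eta>: "ck_on \<infinity> UNIV \<eta>" "\<And>t. t \<notin> {a<..<b} \<Longrightarrow> \<eta> t = 0"
    and R: "\<And>r t. r \<in> R \<Longrightarrow> t \<in> I \<Longrightarrow> t \<in> {a..b} \<Longrightarrow> snd c (x t) + r *\<^sub>R \<eta> t \<in> snd c ` fst c"
  shows "ck_map_on k A (R \<times> I) (\<lambda>(r, t). vary c a b \<eta> x r t)"
proof (rule ck_map_onI)
  let ?\<alpha> = "\<lambda>(r, t). vary c a b \<eta> x r t"
  fix d p assume d: "d \<in> A" and p: "p \<in> R \<times> I" and pd: "?\<alpha> p \<in> fst d"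
  obtain r t where rt: "p = (r, t)" "r \<in> R" "t \<in> I" using p by blast
  show "\<exists>W. open W \<and> p \<in> W \<and> ?\<alpha> ` (R \<times> I \<inter> W) \<subseteq> fst d \<and> ck_on k (R \<times> I \<inter> W) (\<lambda>p. snd d (?\<alpha> p))"
  proof (cases "t \<in> {a..b}")
    case False
    then have "x t \<in> fst d" using pd rt by (auto simp: vary_def split: if_splits)
    then obtain W where W: "open W" "t \<in> W" "x ` (I \<inter> W) \<subseteq> fst d" "ck_on k (I \<inter> W) (snd d \<circ> x)"
      using x d rt(3) unfolding ck_map_on_def by blast
    let ?W = "UNIV \<times> (W \<inter> - {a..b})"
    have eq: "?\<alpha> q = x (snd q)" if "q \<in> ?W" for q using that by (auto simp: vary_def)
    have "ck_on k (R \<times> I \<inter> ?W) (\<lambda>q. (snd d \<circ> x) (snd q))"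
      by (rule ck_on_compose[OF W(4) ck_on_bounded_linear[OF bounded_linear_snd]]) auto
    then have "ck_on k (R \<times> I \<inter> ?W) (\<lambda>q. snd d (?\<alpha> q))"
      by (rule iffD1[OF ck_on_cong, rotated]) (auto simp: vary_def)
    moreover have "?\<alpha> ` (R \<times> I \<inter> ?W) \<subseteq> fst d" using W(3) eq by fastforce
    moreover have "open ?W" "p \<in> ?W" using W False rt by (auto intro!: open_Times)
    ultimately show ?thesis by blast
  next
    case True
    obtain W0 where W0: "open W0" "{s\<in>I. x s \<in> fst c} = I \<inter> W0" using ck_map_on_domain[OF x c] .
    let ?S = "R \<times> (I \<inter> W0)" and ?z = "\<lambda>q. snd c (x (snd q)) + fst q *\<^sub>R \<eta> (snd q)"
    have y: "ck_on k (I \<inter> W0) (\<lambda>s. snd c (x s))" using ck_map_on_chart[OF x c] W0(2) by simp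
    have z: "ck_on k ?S ?z"
      by (intro ck_on_add ck_on_scaleR ck_on_bounded_linear[OF bounded_linear_fst]
          ck_on_compose[OF y ck_on_bounded_linear[OF bounded_linear_snd]]
          ck_on_compose[OF ck_on_mono[OF \<eta>(1)] ck_on_bounded_linear[OF bounded_linear_snd]]) auto
    have xW: "x s \<in> fst c" if "s \<in> I \<inter> W0" for s using W0(2) that by blast
    have zU: "?z q \<in> snd c ` fst c" if "q \<in> ?S" for q
    proof (cases "snd q \<in> {a..b}")
      case True
      then show ?thesis using R[of "fst q" "snd q"] that by auto
    next
      case False
      then have "\<eta> (snd q) = 0" by (intro \<eta>(2)) auto
      then show ?thesis using xW[of "snd q"] that by auto
    qed
    have eq: "?\<alpha> q = chart_inv c (?z q)" if "q \<in> ?S" for q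
    proof (cases "snd q \<in> {a..b}")
      case True
      then show ?thesis by (simp add: vary_def case_prod_beta)
    next
      case False
      then have "\<eta> (snd q) = 0" by (intro \<eta>(2)) auto
      then show ?thesis using xW[of "snd q"] that False by (auto simp: vary_def case_prod_beta chart_inv_left c)
    qed
    let ?T = "snd c ` (fst c \<inter> fst d)"
    have opT: "open ?T" by (rule open_image_Int[OF c open_chart[OF d]])
    have "openin (top_of_set ?S) (?S \<inter> ?z -` ?T)"
      by (rule continuous_openin_preimage_gen[OF ck_on_continuous[OF z] opT])
    then obtain W1 where W1: "open W1" "?S \<inter> ?z -` ?T = ?S \<inter> W1" unfolding openin_open by blast
    let ?W = "W1 \<inter> UNIV \<times> W0"
    have sub: "q \<in> ?S \<and> ?z q \<in> ?T" if "q \<in> R \<times> I \<inter> ?W" for q using that W1(2) by blast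
    have "ck_on k (R \<times> I \<inter> ?W) (\<lambda>q. transition c d (?z q))"
      by (rule ck_on_compose[OF ck_on_mono[OF transition_smooth[OF c d]] ck_on_subset[OF z]]) (use sub in auto)
    then have "ck_on k (R \<times> I \<inter> ?W) (\<lambda>q. snd d (?\<alpha> q))"
      by (rule iffD1[OF ck_on_cong, rotated]) (use sub eq in \<open>simp add: transition_def\<close>)
    moreover have "?\<alpha> ` (R \<times> I \<inter> ?W) \<subseteq> fst d"
    proof (rule image_subsetI)
      fix q assume q: "q \<in> R \<times> I \<inter> ?W"
      show "?\<alpha> q \<in> fst d" using eq[of q] sub[OF q] chart_inv_in[OF c, of "?z q" "fst d"] by metis
    qed
    moreover have "p \<in> ?W"
    proof -
      have pS: "p \<in> ?S" using rt True xc W0(2) by blast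
      obtain u where u: "u \<in> fst c" "?z p = snd c u" using zU[OF pS] by blast
      then have "u = ?\<alpha> p" using eq[OF pS] chart_inv_left[OF c u(1)] by simp
      then have "?z p \<in> ?T" using u pd by blast
      then show ?thesis using pS W1(2) by blast
    qed
    moreover have "open ?W" using W1 W0 by (auto intro!: open_Times)
    ultimately show ?thesis by blast
  qed
qed

text \<open>The compact set \<open>snd c ` x ` [a,b]\<close> has a positive distance to the complement of the open chart image.\<close>

lemma vary_stays_in_chart:
  fixes a b :: real
  assumes c: "c \<in> A" and x: "ck_map_on k A {a..b} x" and xc: "\<And>t. t \<in> {a..b} \<Longrightarrow> x t \<in> fst c"
    and \<eta>: "continuous_on {a..b} \<eta>"
  obtains \<epsilon> where "\<epsilon> > 0" "\<And>r t. \<bar>r\<bar> \<le> \<epsilon> \<Longrightarrow> t \<in> {a..b} \<Longrightarrow> snd c (x t) + r *\<^sub>R \<eta> t \<in> snd c ` fst c"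
proof -
  have "{s\<in>{a..b}. x s \<in> fst c} = {a..b}" using xc by auto
  then have cont: "continuous_on {a..b} (\<lambda>s. snd c (x s))"
    using ck_on_continuous[OF ck_map_on_chart[OF x c]] by simp
  have "compact ((\<lambda>s. snd c (x s)) ` {a..b})" by (intro compact_continuous_image cont compact_Icc)
  moreover have "(\<lambda>s. snd c (x s)) ` {a..b} \<subseteq> snd c ` fst c" using xc by auto
  ultimately obtain \<delta> where \<delta>: "\<delta> > 0" "(\<Union>y\<in>(\<lambda>s. snd c (x s)) ` {a..b}. ball y \<delta>) \<subseteq> snd c ` fst c"
    using compact_subset_open_imp_ball_epsilon_subset[OF _ open_image[OF c]] by metis
  have "bounded (\<eta> ` {a..b})" by (intro compact_imp_bounded compact_continuous_image \<eta> compact_Icc)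
  then obtain M where M: "M > 0" "\<And>t. t \<in> {a..b} \<Longrightarrow> norm (\<eta> t) \<le> M" unfolding bounded_pos by auto
  show thesis
  proof (rule that[of "\<delta> / (2 * M)"])
    show "\<delta> / (2 * M) > 0" using \<delta>(1) M(1) by simp
    fix r t assume r: "\<bar>r\<bar> \<le> \<delta> / (2 * M)" and t: "t \<in> {a..b}"
    have "norm (r *\<^sub>R \<eta> t) \<le> \<delta> / (2 * M) * M"
      unfolding norm_scaleR using r M(2)[OF t] M(1) \<delta>(1) by (intro mult_mono) auto
    also have "\<dots> < \<delta>" using M(1) \<delta>(1) by simp
    finally have "snd c (x t) + r *\<^sub>R \<eta> t \<in> ball (snd c (x t)) \<delta>" by (simp add: dist_norm)
    then show "snd c (x t) + r *\<^sub>R \<eta> t \<in> snd c ` fst c" using \<delta>(2) t by blast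
  qed
qed

end


section \<open>Stationarity of the energy\<close>

lemma derivative_zero_outside_support:
  fixes f :: "real \<Rightarrow> 'b::real_normed_vector"
  assumes f: "(f has_vector_derivative f') (at t)" and z: "\<And>s. s \<notin> {a<..<b} \<Longrightarrow> f s = 0" and t: "t \<notin> {a<..<b}"
  shows "f' = 0"
proof -
  have "\<exists>S. t \<in> S \<and> at t within S \<noteq> bot \<and> (\<forall>s\<in>S. s \<notin> {a<..<b})"
  proof (cases "t \<le> a")
    case True
    then show ?thesis by (intro exI[of _ "{t - 1..t}"]) (auto simp: trivial_limit_within)
  next
    case False
    then show ?thesis using t by (intro exI[of _ "{t..t + 1}"]) (auto simp: trivial_limit_within)
  qed
  then obtain S where S: "t \<in> S" "at t within S \<noteq> bot" "\<And>s. s \<in> S \<Longrightarrow> s \<notin> {a<..<b}" by blast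
  have "((\<lambda>s. 0) has_vector_derivative f') (at t within S)"
    by (rule has_vector_derivative_transform_eventually[OF has_vector_derivative_at_within[OF f]])
      (use S z t in \<open>auto intro: always_eventually\<close>)
  then show ?thesis using vector_derivative_unique_within[OF S(2) _ has_vector_derivative_const] by blast
qed

text \<open>The potentials enter only through their sum \<open>w\<close>.\<close>

locale obstacle_problem = riemannian_atlas A nabla g
  for A :: "('m::{t2_space, second_countable_topology}, 'e::euclidean_space) chart set"
    and nabla :: "('m, 'e) connection" and g :: "('m, 'e) metric" +
  fixes \<sigma> :: real and w :: "'m \<Rightarrow> real" and N :: nat and P :: "nat \<Rightarrow> 'm" and \<tau> :: "nat \<Rightarrow> real"
    and v0 vN :: "('m, 'e) tvec" and x :: "real \<Rightarrow> 'm"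
  assumes w: "ck_fun_on 2 A UNIV w" and N: "1 \<le> N" and \<tau>0: "\<tau> 0 = 0" and mono: "strict_mono_on {0..N} \<tau>"
    and admissible: "x \<in> admissible_curves A N \<tau> P v0 vN"
begin

abbreviation J :: "nat \<Rightarrow> real set" where "J i \<equiv> {\<tau> (i - 1)..\<tau> i}"

lemma \<tau>_less: "i < j \<Longrightarrow> j \<le> N \<Longrightarrow> \<tau> i < \<tau> j"
  using mono by (auto simp: strict_mono_on_def)

lemma \<tau>_le: "i \<le> j \<Longrightarrow> j \<le> N \<Longrightarrow> \<tau> i \<le> \<tau> j"
  using \<tau>_less[of i j] by (cases "i = j") auto

lemma \<tau>_piece: "i \<in> {1..N} \<Longrightarrow> \<tau> (i - 1) < \<tau> i"
  by (intro \<tau>_less) auto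

lemma piece_lim: "i \<in> {1..N} \<Longrightarrow> t \<in> J i \<Longrightarrow> at t within J i \<noteq> bot"
  using \<tau>_piece[of i] by (simp add: trivial_limit_within)

lemma piece_subset: "i \<in> {1..N} \<Longrightarrow> J i \<subseteq> {0..\<tau> N}"
  using \<tau>_le[of 0 "i - 1"] \<tau>_le[of i N] \<tau>0 by auto

lemma \<tau>N_pos: "0 < \<tau> N"
  using \<tau>_less[of 0 N] \<tau>0 N by simp

lemma x_C1: "ck_map_on 1 A {0..\<tau> N} x"
  using admissible by (simp add: admissible_curves_def)

lemma x_piece: "i \<in> {1..N} \<Longrightarrow> ck_map_on \<infinity> A (J i) x"
  using admissible by (simp add: admissible_curves_def)

lemma piece_exists:
  assumes "t \<in> {0..\<tau> N}"
  obtains i where "i \<in> {1..N}" "t \<in> J i"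
proof -
  have "\<exists>i\<in>{1..k}. t \<in> J i" if "1 \<le> k" "k \<le> N" "t \<le> \<tau> k" for k
    using that
  proof (induction k rule: dec_induct)
    case base
    then show ?case using assms \<tau>0 by auto
  next
    case (step k)
    then show ?case
      by (cases "t \<le> \<tau> k") (auto intro: bexI[of _ "Suc k"])
  qed
  from this[of N] show thesis using N assms that by auto
qed

text \<open>On each \<open>J i\<close> the density agrees, except at the two endpoints, with the continuous density that is
  formed with one-sided derivatives.\<close>

lemma density_integrable: "density \<sigma> w {0..\<tau> N} x integrable_on {0..\<tau> N}"
proof -
  have piece: "density \<sigma> w {0..\<tau> N} x integrable_on J i" if i: "i \<in> {1..N}" for i
  proof -
    have "density \<sigma> w (J i) x integrable_on cbox (\<tau> (i - 1)) (\<tau> i)"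
      unfolding box_real
      by (intro integrable_continuous_interval density_continuous[OF piece_lim[OF i] x_piece[OF i] w])
    then have "density \<sigma> w {0..\<tau> N} x integrable_on cbox (\<tau> (i - 1)) (\<tau> i)"
    proof (rule integrable_spike_interior[rotated])
      fix t assume "t \<in> box (\<tau> (i - 1)) (\<tau> i)"
      then show "density \<sigma> w {0..\<tau> N} x t = density \<sigma> w (J i) x t"
        by (intro density_cong[of "{\<tau> (i - 1)<..<\<tau> i}"]) (use piece_subset[OF i] in \<open>auto simp: box_real subset_iff\<close>)
    qed
    then show ?thesis by (simp add: box_real)
  qed
  have "density \<sigma> w {0..\<tau> N} x integrable_on {0..\<tau> k}" if "1 \<le> k" "k \<le> N" for k
    using that
  proof (induction k rule: dec_induct)
    case base
    then show ?case using piece[of 1] \<tau>0 N by simp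
  next
    case (step k)
    then show ?case
      using Henstock_Kurzweil_Integration.integrable_combine[OF _ _ step.IH, of "\<tau> (Suc k)"] piece[of "Suc k"]
        \<tau>_le[of 0 k] \<tau>_le[of k "Suc k"] \<tau>0 by simp
  qed
  then show ?thesis using N by simp
qed

text \<open>The Lagrangian along the coordinate variation \<open>y + r \<eta>\<close>, the weak Euler-Lagrange expression and the
  boundary term, all in the chart \<open>c\<close> and with derivatives taken within the \<open>i\<close>-th interval.\<close>

definition Lvar :: "('m, 'e) chart \<Rightarrow> nat \<Rightarrow> (real \<Rightarrow> 'e) \<Rightarrow> (real \<Rightarrow> 'e) \<Rightarrow> (real \<Rightarrow> 'e) \<Rightarrow> real \<Rightarrow> real \<Rightarrow> real" where
  "Lvar c i \<eta> \<eta>1 \<eta>2 r t = coord_metric.Lag (Gm c) (Gam c) \<sigma> (w \<circ> chart_inv c) (snd c (x t) + r *\<^sub>R \<eta> t)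
     (velocity A (J i) x t c + r *\<^sub>R \<eta>1 t)
     (vector_derivative (\<lambda>s. velocity A (J i) x s c) (at t within J i) + r *\<^sub>R \<eta>2 t)"

definition weak_EL :: "('m, 'e) chart \<Rightarrow> nat \<Rightarrow> real \<Rightarrow> 'e \<Rightarrow> real" where
  "weak_EL c i t = coord_metric.EL (Gm c) (Gam c) \<sigma> (w \<circ> chart_inv c) (snd c (x t)) (velocity A (J i) x t c)
     (curve_deriv A nabla (J i) x 2 t c) (curve_deriv A nabla (J i) x 4 t c)"

definition boundary :: "('m, 'e) chart \<Rightarrow> nat \<Rightarrow> real \<Rightarrow> 'e \<Rightarrow> 'e \<Rightarrow> real" where
  "boundary c i t = coord_metric.bdry (Gm c) (Gam c) \<sigma> (snd c (x t)) (velocity A (J i) x t c)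
     (curve_deriv A nabla (J i) x 2 t c) (curve_deriv A nabla (J i) x 3 t c)"

lemma chart_potential:
  assumes "c \<in> A"
  shows "ck_on 2 (snd c ` fst c) (w \<circ> chart_inv c)"
proof -
  have "ck_on 2 (snd c ` (fst c \<inter> UNIV)) (w \<circ> chart_inv c)"
    using w assms unfolding ck_fun_on_def by blast
  then show ?thesis by simp
qed

context
  fixes c i p q
  assumes c: "c \<in> A" and i: "i \<in> {1..N}" and pq: "\<tau> (i - 1) \<le> p" "p < q" "q \<le> \<tau> i"
    and xc: "\<And>t. t \<in> {p..q} \<Longrightarrow> x t \<in> fst c"
begin

lemma interval_subset: "{p..q} \<subseteq> J i" using pq by auto

lemma lim_piece: "t \<in> J i \<Longrightarrow> at t within J i \<noteq> bot" using piece_lim[OF i] .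

lemma y_deriv: "t \<in> {p..q} \<Longrightarrow>
    ((\<lambda>s. snd c (x s)) has_vector_derivative velocity A (J i) x t c) (at t within J i)"
  using velocity_has_derivative[OF lim_piece x_piece[OF i] _ c] interval_subset xc by auto

lemma v_smooth: "ck_on \<infinity> {s\<in>J i. x s \<in> fst c} (\<lambda>s. velocity A (J i) x s c)"
  by (rule velocity_component_smooth[OF lim_piece x_piece[OF i] _ c]) simp_all

lemma v_deriv: "t \<in> {p..q} \<Longrightarrow> ((\<lambda>s. velocity A (J i) x s c) has_vector_derivative
    vector_derivative (\<lambda>s. velocity A (J i) x s c) (at t within J i)) (at t within J i)"
  using component_derivative[OF lim_piece x_piece[OF i] _ v_smooth _ c] interval_subset xc by auto

lemma piece_first_variation:
  assumes \<eta>: "\<And>t. (\<eta> has_vector_derivative \<eta>1 t) (at t)" "\<And>t. (\<eta>1 has_vector_derivative \<eta>2 t) (at t)"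
      "continuous_on UNIV \<eta>2"
    and \<epsilon>: "\<epsilon> > 0" "\<And>r t. \<bar>r\<bar> \<le> \<epsilon> \<Longrightarrow> t \<in> {p..q} \<Longrightarrow> snd c (x t) + r *\<^sub>R \<eta> t \<in> snd c ` fst c"
  shows "((\<lambda>r. integral {p..q} (Lvar c i \<eta> \<eta>1 \<eta>2 r)) has_real_derivative
      (boundary c i q (\<eta> q) (\<eta>1 q) - boundary c i p (\<eta> p) (\<eta>1 p) + integral {p..q} (\<lambda>t. weak_EL c i t (\<eta> t)))) (at 0)"
    and "\<And>r. \<bar>r\<bar> \<le> \<epsilon> \<Longrightarrow> Lvar c i \<eta> \<eta>1 \<eta>2 r integrable_on {p..q}"
    and "continuous_on {p..q} (\<lambda>t. weak_EL c i t e)"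
proof -
  interpret C: coord_metric "snd c ` fst c" "Gm c" "Gam c" by (rule coord_metric[OF c])
  let ?D = "\<lambda>k t. curve_deriv A nabla (J i) x (Suc k) t c"
  have cd: "(?D k has_vector_derivative vector_derivative (?D k) (at t within J i)) (at t within {p..q})"
    if "t \<in> {p..q}" for k t
    using curve_deriv_has_derivative[OF lim_piece x_piece[OF i] c, of t k] interval_subset xc[OF that] that
    by (auto intro: has_vector_derivative_within_subset)
  have cS: "?D (Suc k) t = vector_derivative (?D k) (at t within J i) + Gam c (snd c (x t)) (velocity A (J i) x t c) (?D k t)"
    if "t \<in> {p..q}" for k t
    by (rule curve_deriv_Suc_component[OF lim_piece x_piece[OF i] c xc[OF that]])
  have cont: "continuous_on {p..q} f" if "ck_on \<infinity> {s\<in>J i. x s \<in> fst c} f" for f :: "real \<Rightarrow> 'e"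
    by (rule continuous_on_subset[OF ck_on_continuous[OF that]]) (use interval_subset xc in auto)
  have a: "continuous_on {p..q} (\<lambda>t. vector_derivative (\<lambda>s. velocity A (J i) x s c) (at t within J i))"
    by (rule cont, rule component_derivative_smooth[OF lim_piece x_piece[OF i] _ v_smooth c]) simp_all
  have within: "(f has_vector_derivative f') (at t within {p..q})" if "(f has_vector_derivative f') (at t within J i)"
    for f :: "real \<Rightarrow> 'e" and f' t
    using that interval_subset by (rule has_vector_derivative_within_subset)
  note fv = C.first_variation[where y="\<lambda>t. snd c (x t)" and v="\<lambda>t. velocity A (J i) x t c"
      and a="\<lambda>t. vector_derivative (\<lambda>s. velocity A (J i) x s c) (at t within J i)"
      and H="?D 1" and H'="\<lambda>t. vector_derivative (?D 1) (at t within J i)"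
      and ?D3.0="?D 2" and D3'="\<lambda>t. vector_derivative (?D 2) (at t within J i)" and ?D4.0="?D 3"
      and p=p and q=q and W="w \<circ> chart_inv c" and e=\<eta> and ?e1.0=\<eta>1 and ?e2.0=\<eta>2 and \<epsilon>=\<epsilon> and \<sigma>=\<sigma>,
      OF less_imp_le[OF pq(2)] chart_potential[OF c]]
  have acc: "?D 1 t = C.acc (snd c (x t)) (velocity A (J i) x t c) (vector_derivative (\<lambda>s. velocity A (J i) x s c) (at t within J i))"
    if "t \<in> {p..q}" for t
    using cS[OF that, of 0] by (simp add: C.acc_def curve_deriv_1)
  have prem: "snd c (x t) \<in> snd c ` fst c" if "t \<in> {p..q}" for t using xc[OF that] by simp
  have D3: "?D 2 t = vector_derivative (?D 1) (at t within J i) + Gam c (snd c (x t)) (velocity A (J i) x t c) (?D 1 t)"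
    if "t \<in> {p..q}" for t using cS[OF that, of 1] by (simp add: numeral_2_eq_2)
  have D4: "?D 3 t = vector_derivative (?D 2) (at t within J i) + Gam c (snd c (x t)) (velocity A (J i) x t c) (?D 2 t)"
    if "t \<in> {p..q}" for t using cS[OF that, of 2] by (simp add: numeral_3_eq_3 numeral_2_eq_2)
  note fv' = fv[OF prem within[OF y_deriv] within[OF v_deriv] a acc cd D3 cd D4
      cont[OF curve_deriv_component_smooth[OF lim_piece x_piece[OF i] c]]
      has_vector_derivative_at_within[OF \<eta>(1)] has_vector_derivative_at_within[OF \<eta>(2)]
      continuous_on_subset[OF \<eta>(3) subset_UNIV] \<epsilon>]
  have s: "Suc 2 = (3::nat)" "Suc 1 = (2::nat)" "Suc 3 = (4::nat)" by simp_all
  show "((\<lambda>r. integral {p..q} (Lvar c i \<eta> \<eta>1 \<eta>2 r)) has_real_derivative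
      (boundary c i q (\<eta> q) (\<eta>1 q) - boundary c i p (\<eta> p) (\<eta>1 p) + integral {p..q} (\<lambda>t. weak_EL c i t (\<eta> t)))) (at 0)"
    using fv'(1) unfolding Lvar_def[abs_def] boundary_def weak_EL_def s by simp
  show "Lvar c i \<eta> \<eta>1 \<eta>2 r integrable_on {p..q}" if "\<bar>r\<bar> \<le> \<epsilon>" for r
    using fv'(2)[of r] that unfolding Lvar_def[abs_def] by simp
  show "continuous_on {p..q} (\<lambda>t. weak_EL c i t e)"
    using fv'(3)[of e] unfolding weak_EL_def s by simp
qed

lemma density_of_variation:
  assumes \<eta>: "\<And>t. (\<eta> has_vector_derivative \<eta>1 t) (at t)" "\<And>t. (\<eta>1 has_vector_derivative \<eta>2 t) (at t)"
    and z: "ck_map_on \<infinity> A (J i) z"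
      "\<And>s. s \<in> {p<..<q} \<Longrightarrow> z s \<in> fst c \<and> snd c (z s) = snd c (x s) + r *\<^sub>R \<eta> s"
    and t: "t \<in> {p<..<q}"
  shows "density \<sigma> w {0..\<tau> N} z t = Lvar c i \<eta> \<eta>1 \<eta>2 r t"
proof -
  have ev: "\<forall>\<^sub>F s in nhds t. s \<in> {p<..<q}" if "t \<in> {p<..<q}" for t
    using that by (intro eventually_nhds_in_open) auto
  have v: "velocity A (J i) z t c = velocity A (J i) x t c + r *\<^sub>R \<eta>1 t" if t: "t \<in> {p<..<q}" for t
  proof -
    have tI: "t \<in> {p..q}" "t \<in> J i" using t interval_subset by auto
    have "((\<lambda>s. snd c (x s) + r *\<^sub>R \<eta> s) has_vector_derivative velocity A (J i) x t c + r *\<^sub>R \<eta>1 t) (at t within J i)"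
      using has_vector_derivative_at_within[OF \<eta>(1)]
      by (intro has_vector_derivative_add y_deriv tI bounded_linear.has_vector_derivative[OF bounded_linear_scaleR_right])
    then have "((\<lambda>s. snd c (z s)) has_vector_derivative velocity A (J i) x t c + r *\<^sub>R \<eta>1 t) (at t within J i)"
      by (rule has_vector_derivative_transform_eventually)
        (use ev[OF t] z(2) t in \<open>auto elim!: eventually_mono\<close>)
    then have "vector_derivative (\<lambda>s. snd c (z s)) (at t within J i) = velocity A (J i) x t c + r *\<^sub>R \<eta>1 t"
      by (rule vector_derivative_within[OF lim_piece[OF tI(2)]])
    moreover have "velocity A (J i) z t c = vector_derivative (\<lambda>s. snd c (z s)) (at t within J i)"
      using c z(2)[OF t] by (simp add: velocity_def)
    ultimately show ?thesis by simp
  qed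
  have tI: "t \<in> {p..q}" "t \<in> J i" using t interval_subset by auto
  have "((\<lambda>s. velocity A (J i) x s c + r *\<^sub>R \<eta>1 s) has_vector_derivative
      vector_derivative (\<lambda>s. velocity A (J i) x s c) (at t within J i) + r *\<^sub>R \<eta>2 t) (at t within J i)"
    using has_vector_derivative_at_within[OF \<eta>(2)]
    by (intro has_vector_derivative_add v_deriv tI bounded_linear.has_vector_derivative[OF bounded_linear_scaleR_right])
  then have "((\<lambda>s. velocity A (J i) z s c) has_vector_derivative
      vector_derivative (\<lambda>s. velocity A (J i) x s c) (at t within J i) + r *\<^sub>R \<eta>2 t) (at t within J i)"
    by (rule has_vector_derivative_transform_eventually)
      (use ev[OF t] v t in \<open>auto elim!: eventually_mono\<close>)
  then have a: "vector_derivative (\<lambda>s. velocity A (J i) z s c) (at t within J i)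
      = vector_derivative (\<lambda>s. velocity A (J i) x s c) (at t within J i) + r *\<^sub>R \<eta>2 t"
    by (rule vector_derivative_within[OF lim_piece[OF tI(2)]])
  have "density \<sigma> w {0..\<tau> N} z t = density \<sigma> w (J i) z t"
    by (rule density_cong[of "{p<..<q}"]) (use piece_subset[OF i] interval_subset t in auto)
  also have "\<dots> = Lvar c i \<eta> \<eta>1 \<eta>2 r t"
    using density_in_chart[OF lim_piece z(1) c tI(2)] z(2)[OF t] v[OF t] a by (simp add: Lvar_def)
  finally show ?thesis .
qed

end

end


context obstacle_problem
begin

lemma vary_admissible:
  assumes c: "c \<in> A" and ab: "0 < a" "a < b" "b < \<tau> N" and xc: "\<And>t. t \<in> {a..b} \<Longrightarrow> x t \<in> fst c"
    and \<eta>: "ck_on \<infinity> UNIV \<eta>" "\<And>t. t \<notin> {a<..<b} \<Longrightarrow> \<eta> t = 0" and knots: "\<And>j. j \<le> N \<Longrightarrow> \<eta> (\<tau> j) = 0"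
    and \<epsilon>: "\<epsilon> > 0" "\<And>r t. \<bar>r\<bar> \<le> \<epsilon> \<Longrightarrow> t \<in> {a..b} \<Longrightarrow> snd c (x t) + r *\<^sub>R \<eta> t \<in> snd c ` fst c"
  shows "admissible_variation A N \<tau> P v0 vN x \<epsilon> (vary c a b \<eta> x)"
proof -
  let ?R = "{-\<epsilon><..<\<epsilon>}" and ?\<alpha> = "vary c a b \<eta> x"
  have s: "ck_map_on k A (?R \<times> I) (\<lambda>(r, t). ?\<alpha> r t)" if "ck_map_on k A I x" for k I
    using \<epsilon>(2) by (intro vary_smooth[OF c that xc \<eta>]) auto
  have s1: "ck_map_on 1 A (?R \<times> {0..\<tau> N}) (\<lambda>(r, t). ?\<alpha> r t)" by (rule s[OF x_C1])
  have si: "ck_map_on \<infinity> A (?R \<times> J i) (\<lambda>(r, t). ?\<alpha> r t)" if "i \<in> {1..N}" for i by (rule s[OF x_piece[OF that]])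
  have x_adm: "x (\<tau> j) = P j" if "j \<le> N" for j
    using admissible that by (auto simp: admissible_curves_def)
  have fixed: "?\<alpha> r t = x t" if "\<eta> t = 0" for r t
    using xc[of t] that by (auto simp: vary_def chart_inv_left c)
  have "?\<alpha> r \<in> admissible_curves A N \<tau> P v0 vN" if r: "r \<in> ?R" for r
  proof -
    have "velocity A {0..\<tau> N} (?\<alpha> r) 0 = velocity A {0..\<tau> N} x 0"
      by (rule velocity_cong[of "{..<a}"]) (use ab in \<open>auto simp: vary_def\<close>)
    moreover have "velocity A {0..\<tau> N} (?\<alpha> r) (\<tau> N) = velocity A {0..\<tau> N} x (\<tau> N)"
      by (rule velocity_cong[of "{b<..}"]) (use ab in \<open>auto simp: vary_def\<close>)
    ultimately show ?thesis
      using admissible ck_map_on_slice[OF s1 r] ck_map_on_slice[OF si r] fixed[OF knots] x_adm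
      unfolding admissible_curves_def by auto
  qed
  moreover have "?\<alpha> 0 t = x t" for t
    using xc[of t] by (auto simp: vary_def chart_inv_left c)
  ultimately show ?thesis
    unfolding admissible_variation_def using \<epsilon>(1) s1 si by blast
qed

text \<open>Only the part of the energy over \<open>[a,b]\<close> depends on the variation parameter. Its derivative is known on
  \<open>[a,m]\<close> and on \<open>[m,b]\<close>, and the boundary terms at \<open>a\<close> and \<open>b\<close> vanish with the test function. The point \<open>m\<close>
  will be either a knot, with \<open>j = i + 1\<close>, or an arbitrary inner point of a single interval, with \<open>j = i\<close>.\<close>

lemma stationarity:
  assumes ext: "extremizer A N \<tau> P v0 vN (\<lambda>z. integral {0..\<tau> N} (density \<sigma> w {0..\<tau> N} z)) x"
    and c: "c \<in> A" and ij: "i \<in> {1..N}" "j \<in> {1..N}"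
    and ab: "0 < a" "\<tau> (i - 1) \<le> a" "a < m" "m \<le> \<tau> i" "\<tau> (j - 1) \<le> m" "m < b" "b \<le> \<tau> j" "b < \<tau> N"
    and xc: "\<And>t. t \<in> {a..b} \<Longrightarrow> x t \<in> fst c"
    and \<phi>: "ck_on \<infinity> UNIV \<phi>" "\<And>t. t \<notin> {a<..<b} \<Longrightarrow> \<phi> t = 0" and knots: "\<And>j. j \<le> N \<Longrightarrow> \<phi> (\<tau> j) = (0::real)"
  shows "boundary c i m (\<phi> m *\<^sub>R e) (vector_derivative \<phi> (at m) *\<^sub>R e)
      - boundary c j m (\<phi> m *\<^sub>R e) (vector_derivative \<phi> (at m) *\<^sub>R e)
      + integral {a..m} (\<lambda>t. weak_EL c i t (\<phi> t *\<^sub>R e)) + integral {m..b} (\<lambda>t. weak_EL c j t (\<phi> t *\<^sub>R e)) = 0"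
proof -
  interpret C: coord_metric "snd c ` fst c" "Gm c" "Gam c" by (rule coord_metric[OF c])
  define \<phi>1 where "\<phi>1 t = vector_derivative \<phi> (at t)" for t
  define \<phi>2 where "\<phi>2 t = vector_derivative \<phi>1 (at t)" for t
  have d1: "(\<phi> has_vector_derivative \<phi>1 t) (at t)" for t
    unfolding \<phi>1_def by (rule has_vector_derivative_within_ck_on[OF \<phi>(1)]) auto
  have s1: "ck_on \<infinity> UNIV \<phi>1" unfolding \<phi>1_def by (rule ck_on_vector_derivative(2)[OF \<phi>(1)]) auto
  have d2: "(\<phi>1 has_vector_derivative \<phi>2 t) (at t)" for t
    unfolding \<phi>2_def by (rule has_vector_derivative_within_ck_on[OF s1]) auto
  have s2: "ck_on \<infinity> UNIV \<phi>2" unfolding \<phi>2_def by (rule ck_on_vector_derivative(2)[OF s1]) auto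
  define \<eta> \<eta>1 \<eta>2 where "\<eta> t = \<phi> t *\<^sub>R e" and "\<eta>1 t = \<phi>1 t *\<^sub>R e" and "\<eta>2 t = \<phi>2 t *\<^sub>R e" for t
  have lin: "bounded_linear (\<lambda>r. r *\<^sub>R e)" by (rule bounded_linear_scaleR_left)
  have \<eta>: "(\<eta> has_vector_derivative \<eta>1 t) (at t)" "(\<eta>1 has_vector_derivative \<eta>2 t) (at t)" for t
    unfolding \<eta>_def \<eta>1_def \<eta>2_def
    using bounded_linear.has_vector_derivative[OF lin d1] bounded_linear.has_vector_derivative[OF lin d2] by auto
  have \<eta>2: "continuous_on UNIV \<eta>2"
    unfolding \<eta>2_def by (intro continuous_intros ck_on_continuous[OF s2])
  have \<eta>s: "ck_on \<infinity> UNIV \<eta>" unfolding \<eta>_def by (intro ck_on_scaleR ck_on_const \<phi>(1))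
  have \<eta>0: "\<eta> t = 0" if "t \<notin> {a<..<b}" for t using \<phi>(2)[OF that] by (simp add: \<eta>_def)
  have \<eta>10: "\<eta>1 t = 0" if "t \<notin> {a<..<b}" for t using derivative_zero_outside_support[OF \<eta>(1) \<eta>0 that] by simp
  have sub: "{a..b} \<subseteq> {0..\<tau> N}" using ab by auto
  have ab': "a < b" using ab by simp
  obtain \<epsilon> where \<epsilon>: "\<epsilon> > 0" "\<And>r t. \<bar>r\<bar> \<le> \<epsilon> \<Longrightarrow> t \<in> {a..b} \<Longrightarrow> snd c (x t) + r *\<^sub>R \<eta> t \<in> snd c ` fst c"
    using vary_stays_in_chart[OF c ck_map_on_subset[OF x_C1 sub] xc continuous_on_subset[OF ck_on_continuous[OF \<eta>s] subset_UNIV]]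
    by blast
  let ?\<alpha> = "vary c a b \<eta> x"
  have adm: "admissible_variation A N \<tau> P v0 vN x \<epsilon> ?\<alpha>"
    by (rule vary_admissible[OF c ab(1) ab' ab(8) xc \<eta>s \<eta>0 _ \<epsilon>]) (auto simp: \<eta>_def knots)
  have xca: "\<And>t. t \<in> {a..m} \<Longrightarrow> x t \<in> fst c" and xcb: "\<And>t. t \<in> {m..b} \<Longrightarrow> x t \<in> fst c" using xc ab by auto
  have \<epsilon>a: "\<And>r t. \<bar>r\<bar> \<le> \<epsilon> \<Longrightarrow> t \<in> {a..m} \<Longrightarrow> snd c (x t) + r *\<^sub>R \<eta> t \<in> snd c ` fst c"
    and \<epsilon>b: "\<And>r t. \<bar>r\<bar> \<le> \<epsilon> \<Longrightarrow> t \<in> {m..b} \<Longrightarrow> snd c (x t) + r *\<^sub>R \<eta> t \<in> snd c ` fst c" using \<epsilon>(2) ab by auto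
  note va = piece_first_variation[OF c ij(1) ab(2,3,4) xca \<eta> \<eta>2 \<epsilon>(1) \<epsilon>a]
  note vb = piece_first_variation[OF c ij(2) ab(5,6,7) xcb \<eta> \<eta>2 \<epsilon>(1) \<epsilon>b]
  let ?D = "density \<sigma> w {0..\<tau> N}" and ?L = "\<lambda>i. Lvar c i \<eta> \<eta>1 \<eta>2"
  define K where "K = integral {0..a} (?D x) + integral {b..\<tau> N} (?D x)"
  have split: "integral {0..\<tau> N} (?D (?\<alpha> r))
      = K + (integral {a..m} (?L i r) + integral {m..b} (?L j r))"
    if r: "r \<in> {-\<epsilon><..<\<epsilon>}" for r
  proof -
    have smooth: "ck_map_on \<infinity> A (J k) (?\<alpha> r)" if "k \<in> {1..N}" for k
      using adm r that unfolding admissible_variation_def admissible_curves_def by blast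
    have in_chart: "?\<alpha> r t \<in> fst c \<and> snd c (?\<alpha> r t) = snd c (x t) + r *\<^sub>R \<eta> t" if "t \<in> {a..b}" for t
      using \<epsilon>(2)[of r t] r that chart_inv_in'[OF c, of "snd c (x t) + r *\<^sub>R \<eta> t"]
        chart_inv_right[OF c, of "snd c (x t) + r *\<^sub>R \<eta> t"] by (auto simp: vary_def)
    have spike: "(?D (?\<alpha> r) has_integral integral {p..q} f) {p..q}"
      if "f integrable_on {p..q}" "\<And>t. t \<in> {p<..<q} \<Longrightarrow> ?D (?\<alpha> r) t = f t" for f p q
      using has_integral_spike_interior[of f "integral {p..q} f" p q "?D (?\<alpha> r)"] that
      by (simp add: box_real integrable_integral)
    have fixed: "?D (?\<alpha> r) t = ?D x t" if "t \<in> {0..\<tau> N}" "t \<notin> {a..b}" for t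
      by (rule density_cong[of "- {a..b}"]) (use that in \<open>auto simp: vary_def\<close>)
    have H: "(?D (?\<alpha> r) has_integral integral {0..a} (?D x)) {0..a}"
      "(?D (?\<alpha> r) has_integral integral {b..\<tau> N} (?D x)) {b..\<tau> N}"
      using ab by (auto intro!: spike fixed integrable_subinterval_real[OF density_integrable])
    have H2: "(?D (?\<alpha> r) has_integral integral {a..m} (?L i r)) {a..m}"
    proof (rule spike)
      show "?D (?\<alpha> r) t = ?L i r t" if "t \<in> {a<..<m}" for t
        by (rule density_of_variation[OF c ij(1) ab(2,3,4) xca \<eta> smooth[OF ij(1)]])
          (use that ab in_chart in auto)
    qed (use r in \<open>auto intro: va(2)\<close>)
    have H3: "(?D (?\<alpha> r) has_integral integral {m..b} (?L j r)) {m..b}"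
    proof (rule spike)
      show "?D (?\<alpha> r) t = ?L j r t" if "t \<in> {m<..<b}" for t
        by (rule density_of_variation[OF c ij(2) ab(5,6,7) xcb \<eta> smooth[OF ij(2)]])
          (use that ab in_chart in auto)
    qed (use r in \<open>auto intro: vb(2)\<close>)
    have "(?D (?\<alpha> r) has_integral (integral {0..a} (?D x) + integral {a..m} (?L i r)
        + integral {m..b} (?L j r) + integral {b..\<tau> N} (?D x))) {0..\<tau> N}"
      using has_integral_combine[OF _ _ has_integral_combine[OF _ _ has_integral_combine[OF _ _ H(1) H2] H3] H(2)] ab
      by simp
    from integral_unique[OF this] show ?thesis by (simp add: K_def)
  qed
  have b0: "boundary c k t 0 0 = 0" if "t \<in> {a..b}" for k t
  proof -
    have U: "snd c (x t) \<in> snd c ` fst c" using xc[OF that] by simp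
    show ?thesis by (simp add: boundary_def C.bdry_def C.Gam_simps[OF U] C.G_simps[OF U])
  qed
  let ?E = "boundary c i m (\<eta> m) (\<eta>1 m) - boundary c j m (\<eta> m) (\<eta>1 m)
      + integral {a..m} (\<lambda>t. weak_EL c i t (\<eta> t)) + integral {m..b} (\<lambda>t. weak_EL c j t (\<eta> t))"
  have "((\<lambda>r. integral {0..\<tau> N} (?D (?\<alpha> r))) has_real_derivative ?E) (at 0)"
  proof (rule has_field_derivative_transform_within_open)
    show "((\<lambda>r. K + (integral {a..m} (?L i r) + integral {m..b} (?L j r)))
        has_real_derivative ?E) (at 0)"
      using DERIV_add[OF DERIV_const[of K] DERIV_add[OF va(1) vb(1)]] b0[of a i] b0[of b j] ab
      by (simp add: \<eta>0 \<eta>10 algebra_simps)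
    show "K + (integral {a..m} (?L i r) + integral {m..b} (?L j r))
      = integral {0..\<tau> N} (?D (?\<alpha> r))" if "r \<in> {-\<epsilon><..<\<epsilon>}" for r
      using split[OF that] by simp
  qed (use \<epsilon>(1) in auto)
  moreover have "((\<lambda>r. integral {0..\<tau> N} (?D (?\<alpha> r))) has_real_derivative 0) (at 0)"
    using ext adm unfolding extremizer_def by blast
  ultimately have "?E = 0" by (rule DERIV_unique)
  then show ?thesis by (simp add: \<eta>_def \<eta>1_def \<phi>1_def)
qed

end


section \<open>The Euler-Lagrange equation\<close>

lemma small_radius:
  fixes t :: real
  assumes "\<delta> > 0" "lo < t" "t < hi"
  obtains d where "d > 0" "d \<le> \<delta>" "lo < t - d" "t + d < hi"
proof -
  define u where "u = min \<delta> (min (t - lo) (hi - t))"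
  have "u > 0" "u \<le> \<delta>" "u \<le> t - lo" "u \<le> hi - t" using assms unfolding u_def by auto
  then show thesis by (intro that[of "u / 2"]) auto
qed

context obstacle_problem
begin

lemma weak_EL_continuous:
  assumes "c \<in> A" "i \<in> {1..N}" "\<tau> (i - 1) \<le> p" "p < q" "q \<le> \<tau> i"
    and xc: "\<And>t. t \<in> {p..q} \<Longrightarrow> x t \<in> fst c"
  shows "continuous_on {p..q} (\<lambda>t. weak_EL c i t e)"
  by (rule piece_first_variation(3)[OF assms(1-5) xc, where \<eta>="\<lambda>_. 0" and ?\<eta>1.0="\<lambda>_. 0" and ?\<eta>2.0="\<lambda>_. 0" and \<epsilon>=1])
    (use xc in auto)

lemma weak_EL_linear:
  assumes c: "c \<in> A" "x t \<in> fst c"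
  shows "linear (weak_EL c i t)"
proof -
  interpret C: coord_metric "snd c ` fst c" "Gm c" "Gam c" by (rule coord_metric[OF c(1)])
  have U: "snd c (x t) \<in> snd c ` fst c" using c by simp
  have "(w \<circ> chart_inv c) differentiable (at (snd c (x t)))"
    by (rule ck_on_differentiable[OF chart_potential[OF c(1)] C.open_U U]) (simp add: one_enat_def numeral_eq_enat)
  note dw = linear_frechet_derivative[OF this]
  show ?thesis
    unfolding weak_EL_def C.EL_def[abs_def]
    by (rule linearI) (simp_all add: C.G_simps[OF U] linear_add[OF dw] linear_cmul[OF dw] algebra_simps)
qed

lemma chart_neighbourhood:
  assumes c: "c \<in> A" and t: "t \<in> {0..\<tau> N}" "x t \<in> fst c"
  obtains \<delta> where "\<delta> > 0" "\<And>s. s \<in> {0..\<tau> N} \<Longrightarrow> \<bar>s - t\<bar> \<le> \<delta> \<Longrightarrow> x s \<in> fst c"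
proof -
  obtain W where W: "open W" "{s\<in>{0..\<tau> N}. x s \<in> fst c} = {0..\<tau> N} \<inter> W" using ck_map_on_domain[OF x_C1 c] .
  then have "t \<in> W" using t by blast
  then obtain \<delta> where \<delta>: "\<delta> > 0" "cball t \<delta> \<subseteq> W" using W(1) open_contains_cball by metis
  show thesis
    by (rule that[OF \<delta>(1)]) (use W(2) \<delta>(2) in \<open>auto simp: subset_iff dist_real_def abs_minus_commute\<close>)
qed

lemma test_function_zero_at_knots:
  assumes "i \<in> {1..N}" "\<tau> (i - 1) \<le> a" "b \<le> \<tau> i" "\<And>t. t \<notin> {a<..<b} \<Longrightarrow> \<phi> t = (0::real)" "j \<le> N"
  shows "\<phi> (\<tau> j) = 0"
proof -
  have "\<tau> j \<notin> {a<..<b}"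
  proof (cases "j \<le> i - 1")
    case True
    then have "\<tau> j \<le> \<tau> (i - 1)" using assms(1) by (intro \<tau>_le) auto
    then show ?thesis using assms(2) by simp
  next
    case False
    then have "\<tau> i \<le> \<tau> j" using assms(5) by (intro \<tau>_le) auto
    then show ?thesis using assms(3) by simp
  qed
  then show ?thesis by (rule assms(4))
qed

context
  assumes ext: "extremizer A N \<tau> P v0 vN (\<lambda>z. integral {0..\<tau> N} (density \<sigma> w {0..\<tau> N} z)) x"
begin

text \<open>The fundamental lemma of the calculus of variations: where the Euler-Lagrange expression paired with
  \<open>e\<close> is non-zero it keeps its sign nearby, and a bump supported there contradicts stationarity.\<close>

lemma weak_EL_interior:
  assumes i: "i \<in> {1..N}" and c: "c \<in> A" and t: "t \<in> {\<tau> (i - 1)<..<\<tau> i}" "x t \<in> fst c"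
  shows "weak_EL c i t e = 0"
proof (rule ccontr)
  assume nz: "weak_EL c i t e \<noteq> 0"
  have tN: "t \<in> {0..\<tau> N}" using t(1) piece_subset[OF i] by auto
  obtain \<delta> where \<delta>: "\<delta> > 0" "\<And>s. s \<in> {0..\<tau> N} \<Longrightarrow> \<bar>s - t\<bar> \<le> \<delta> \<Longrightarrow> x s \<in> fst c"
    using chart_neighbourhood[OF c tN t(2)] by blast
  obtain d where d: "d > 0" "d \<le> \<delta>" "\<tau> (i - 1) < t - d" "t + d < \<tau> i"
    using small_radius[OF \<delta>(1), of "\<tau> (i - 1)" t "\<tau> i"] t(1) by auto
  have sub: "{t - d..t + d} \<subseteq> {0..\<tau> N}" using piece_subset[OF i] d by auto
  have xc: "x s \<in> fst c" if "s \<in> {t - d..t + d}" for s using \<delta>(2)[of s] sub d(2) that by (auto simp: abs_le_iff)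
  let ?h = "\<lambda>s. weak_EL c i s e"
  have h: "continuous_on {t - d..t + d} ?h"
    by (rule weak_EL_continuous[OF c i _ _ _ xc]) (use d in auto)
  then have "continuous (at t within {t - d..t + d}) ?h" using d by (simp add: continuous_on_eq_continuous_within)
  then obtain d2 where d2: "d2 > 0" "\<And>s. s \<in> {t - d..t + d} \<Longrightarrow> \<bar>s - t\<bar> < d2 \<Longrightarrow> \<bar>?h s - ?h t\<bar> < \<bar>?h t\<bar>"
    using nz unfolding continuous_within_eps_delta dist_real_def by (metis zero_less_abs_iff)
  define k where "k = min d d2 / 2"
  have k: "k > 0" "k < d2" "k < d" using d d2(1) unfolding k_def by (auto simp: min_def)
  \<comment> \<open>on \<open>[a,b]\<close> the expression has the sign of its value at \<open>t\<close>\<close>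
  define a b where "a = t - k" and "b = t + k"
  have ab: "a < t" "t < b" "{a..b} \<subseteq> {t - d..t + d}" "\<tau> (i - 1) \<le> a" "b \<le> \<tau> i" using k d by (auto simp: a_def b_def)
  have pos: "?h s * ?h t > 0" if "s \<in> {a..b}" for s
  proof -
    have "s \<in> {t - d..t + d}" using that ab(3) by blast
    moreover have "\<bar>s - t\<bar> < d2" using that k unfolding a_def b_def by auto
    ultimately have "\<bar>?h s - ?h t\<bar> < \<bar>?h t\<bar>" by (rule d2(2))
    then show ?thesis by (cases "?h t > 0") (auto simp: zero_less_mult_iff)
  qed
  let ?\<phi> = "bump a b"
  have "boundary c i t (?\<phi> t *\<^sub>R e) (vector_derivative ?\<phi> (at t) *\<^sub>R e)
      - boundary c i t (?\<phi> t *\<^sub>R e) (vector_derivative ?\<phi> (at t) *\<^sub>R e)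
      + integral {a..t} (\<lambda>s. weak_EL c i s (?\<phi> s *\<^sub>R e)) + integral {t..b} (\<lambda>s. weak_EL c i s (?\<phi> s *\<^sub>R e)) = 0"
  proof (rule stationarity[OF ext c i i])
    show "0 < a" using piece_subset[OF i] d k \<tau>_le[of 0 "i - 1"] i \<tau>0 unfolding a_def by auto
    show "b < \<tau> N" using \<tau>_le[of i N] i d k unfolding b_def by auto
    show "?\<phi> (\<tau> j) = 0" if "j \<le> N" for j
      by (rule test_function_zero_at_knots[OF i ab(4,5) bump_zero that])
  qed (use ab t xc bump_smooth bump_zero in auto)
  moreover have lin: "weak_EL c i s (?\<phi> s *\<^sub>R e) = ?\<phi> s * ?h s" if "s \<in> {a..b}" for s
    using linear_cmul[OF weak_EL_linear[OF c xc], of s i "?\<phi> s" e] that ab(3) by auto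
  ultimately have z: "integral {a..t} (\<lambda>s. ?\<phi> s * ?h s) + integral {t..b} (\<lambda>s. ?\<phi> s * ?h s) = 0"
  proof -
    have "integral {a..t} (\<lambda>s. weak_EL c i s (?\<phi> s *\<^sub>R e)) = integral {a..t} (\<lambda>s. ?\<phi> s * ?h s)"
      "integral {t..b} (\<lambda>s. weak_EL c i s (?\<phi> s *\<^sub>R e)) = integral {t..b} (\<lambda>s. ?\<phi> s * ?h s)"
      using ab by (auto intro!: integral_cong lin)
    then show ?thesis using \<open>boundary c i t _ _ - _ + _ + _ = 0\<close> by simp
  qed
  have cont: "continuous_on {a..b} (\<lambda>s. ?\<phi> s * ?h s)"
    by (intro continuous_intros continuous_on_subset[OF h ab(3)] continuous_on_subset[OF ck_on_continuous[OF bump_smooth]]) auto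
  have "integral {a..b} (\<lambda>s. ?\<phi> s * ?h s) = 0"
    using z Henstock_Kurzweil_Integration.integral_combine[OF less_imp_le[OF ab(1)] less_imp_le[OF ab(2)]
        integrable_continuous_interval[OF cont]] by simp
  then have "integral {a..b} (\<lambda>s. ?\<phi> s * ?h s * ?h t) = 0" by simp
  then have "?\<phi> t * ?h t * ?h t = 0"
  proof (rule nonneg_integral_zero[rotated 2])
    show "continuous_on {a..b} (\<lambda>s. ?\<phi> s * ?h s * ?h t)" by (intro continuous_intros cont)
    show "0 \<le> ?\<phi> s * ?h s * ?h t" if "s \<in> {a..b}" for s
    proof -
      have "0 \<le> ?\<phi> s" using bump_pos[of a s b] bump_zero[of s a b] by (cases "s \<in> {a<..<b}") auto
      then show ?thesis using pos[OF that] by (simp add: mult.assoc)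
    qed
  qed (use ab in auto)
  then show False using nz bump_pos[OF ab(1,2)] by simp
qed

lemma weak_EL_zero:
  assumes i: "i \<in> {1..N}" and c: "c \<in> A" and t: "t \<in> J i" "x t \<in> fst c"
  shows "weak_EL c i t e = 0"
proof -
  have tN: "t \<in> {0..\<tau> N}" using t(1) piece_subset[OF i] by auto
  obtain \<delta> where \<delta>: "\<delta> > 0" "\<And>s. s \<in> {0..\<tau> N} \<Longrightarrow> \<bar>s - t\<bar> \<le> \<delta> \<Longrightarrow> x s \<in> fst c"
    using chart_neighbourhood[OF c tN t(2)] by blast
  define p q where "p = max (\<tau> (i - 1)) (t - \<delta>)" and "q = min (\<tau> i) (t + \<delta>)"
  have pq: "\<tau> (i - 1) \<le> p" "p < q" "q \<le> \<tau> i" "t \<in> {p..q}"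
    using \<delta>(1) t(1) \<tau>_piece[OF i] unfolding p_def q_def by auto
  have xc: "x s \<in> fst c" if "s \<in> {p..q}" for s
    using \<delta>(2)[of s] that pq piece_subset[OF i] unfolding p_def q_def by (auto simp: abs_le_iff subset_iff)
  let ?h = "\<lambda>s. weak_EL c i s e"
  have h: "continuous_on {p..q} ?h"
    by (rule weak_EL_continuous[OF c i pq(1,2,3) xc])
  have "?h s = 0" if "s \<in> {p<..<q}" for s
    using weak_EL_interior[OF i c _ xc] that pq by auto
  moreover have "closure {p<..<q} = {p..q}" using pq(2) by simp
  ultimately show ?thesis
    using continuous_constant_on_closure[of "{p<..<q}" ?h 0 t] h pq(4) by auto
qed

text \<open>At an interior knot a variation with \<open>\<phi>(\<tau>\<^sub>i) = 0\<close> and \<open>\<phi>'(\<tau>\<^sub>i) \<noteq> 0\<close> respects the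
  interpolation condition, and isolates the jump of the covariant acceleration.\<close>

lemma acceleration_matches:
  assumes i: "1 \<le> i" "i < N" and c: "c \<in> A" and xm: "x (\<tau> i) \<in> fst c"
  shows "curve_deriv A nabla (J i) x 2 (\<tau> i) c = curve_deriv A nabla (J (Suc i)) x 2 (\<tau> i) c"
    and "velocity A (J i) x (\<tau> i) c = velocity A (J (Suc i)) x (\<tau> i) c"
proof -
  interpret C: coord_metric "snd c ` fst c" "Gm c" "Gam c" by (rule coord_metric[OF c])
  define m where "m = \<tau> i"
  have ij: "i \<in> {1..N}" "Suc i \<in> {1..N}" using i by auto
  have lt: "\<tau> (i - 1) < m" "m < \<tau> (Suc i)" "\<tau> 0 \<le> \<tau> (i - 1)" "\<tau> (Suc i) \<le> \<tau> N"
    unfolding m_def using \<tau>_piece[OF ij(1)] \<tau>_piece[OF ij(2)] \<tau>_le[of 0 "i - 1"] \<tau>_le[of "Suc i" N] i by auto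
  have mN: "m \<in> {0..\<tau> N}" using lt \<tau>0 by auto
  have U: "snd c (x m) \<in> snd c ` fst c" using xm by (simp add: m_def)
  show vel: "velocity A (J i) x (\<tau> i) c = velocity A (J (Suc i)) x (\<tau> i) c"
  proof -
    have lim: "t \<in> {0..\<tau> N} \<Longrightarrow> at t within {0..\<tau> N} \<noteq> bot" for t using \<tau>N_pos by (simp add: trivial_limit_within)
    have "velocity A (J k) x m c = velocity A {0..\<tau> N} x m c" if k: "k \<in> {1..N}" "m \<in> J k" for k
    proof -
      have "((\<lambda>s. snd c (x s)) has_vector_derivative velocity A {0..\<tau> N} x m c) (at m within J k)"
        using velocity_has_derivative[OF lim x_C1 _ c mN] xm piece_subset[OF k(1)]
        by (auto simp: m_def intro: has_vector_derivative_within_subset)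
      moreover have "((\<lambda>s. snd c (x s)) has_vector_derivative velocity A (J k) x m c) (at m within J k)"
        using velocity_has_derivative[OF piece_lim[OF k(1)] x_piece[OF k(1)] _ c k(2)] xm by (auto simp: m_def)
      ultimately show ?thesis using vector_derivative_unique_within[OF piece_lim[OF k]] by blast
    qed
    from this[OF ij(1)] this[OF ij(2)] show ?thesis using lt by (simp add: m_def)
  qed
  obtain \<delta> where \<delta>: "\<delta> > 0" "\<And>s. s \<in> {0..\<tau> N} \<Longrightarrow> \<bar>s - m\<bar> \<le> \<delta> \<Longrightarrow> x s \<in> fst c"
    using chart_neighbourhood[OF c mN] xm by (auto simp: m_def)
  obtain d where d: "d > 0" "d \<le> \<delta>" "\<tau> (i - 1) < m - d" "m + d < \<tau> (Suc i)"
    using small_radius[OF \<delta>(1) lt(1,2)] by auto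
  define a b where "a = m - d" and "b = m + d"
  have ab: "0 < a" "\<tau> (i - 1) \<le> a" "a < m" "m \<le> \<tau> i" "\<tau> (Suc i - 1) \<le> m" "m < b" "b \<le> \<tau> (Suc i)" "b < \<tau> N"
    using d lt \<tau>0 by (auto simp: a_def b_def m_def)
  have xc: "x s \<in> fst c" if "s \<in> {a..b}" for s
    using \<delta>(2)[of s] that ab d(2) by (auto simp: a_def b_def abs_le_iff)
  define \<phi> where "\<phi> t = (t - m) * bump a b t" for t
  have \<phi>s: "ck_on \<infinity> UNIV \<phi>"
  proof -
    have "ck_on \<infinity> UNIV (\<lambda>t. (t + - m) * bump a b t)"
      by (intro ck_on_mult ck_on_add ck_on_const ck_on_bounded_linear[OF bounded_linear_ident] bump_smooth)
    then show ?thesis unfolding \<phi>_def[abs_def] by simp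
  qed
  have \<phi>0: "\<phi> t = 0" if "t \<notin> {a<..<b}" for t using bump_zero[OF that] by (simp add: \<phi>_def)
  have \<phi>k: "\<phi> (\<tau> j) = 0" if "j \<le> N" for j
  proof -
    consider "j \<le> i - 1" | "j = i" | "Suc i \<le> j" by linarith
    then show ?thesis
    proof cases
      case 1
      then have "\<tau> j \<le> \<tau> (i - 1)" using i by (intro \<tau>_le) auto
      then have "\<tau> j \<notin> {a<..<b}" using ab(2) by simp
      then show ?thesis by (rule \<phi>0)
    next
      case 3
      then have "\<tau> j \<notin> {a<..<b}" using \<tau>_le[of "Suc i" j] that ab(7) by auto
      then show ?thesis by (rule \<phi>0)
    qed (simp add: \<phi>_def m_def)
  qed
  have \<phi>': "vector_derivative \<phi> (at m) = bump a b m"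
  proof -
    have "(bump a b has_vector_derivative vector_derivative (bump a b) (at m)) (at m)"
      by (rule has_vector_derivative_within_ck_on[OF bump_smooth]) auto
    then have "(bump a b has_real_derivative vector_derivative (bump a b) (at m)) (at m)"
      by (simp add: has_real_derivative_iff_has_vector_derivative)
    then have "(\<phi> has_real_derivative bump a b m) (at m)"
      unfolding \<phi>_def[abs_def] by (auto intro!: derivative_eq_intros)
    then show ?thesis by (simp add: has_real_derivative_iff_has_vector_derivative vector_derivative_at)
  qed
  let ?H = "curve_deriv A nabla (J i) x 2 m c" and ?H' = "curve_deriv A nabla (J (Suc i)) x 2 m c"
  have "?H - ?H' = 0"
  proof (rule ccontr)
    assume nz: "?H - ?H' \<noteq> 0"
    let ?e = "?H - ?H'"
    have EL0: "weak_EL c i s (\<phi> s *\<^sub>R ?e) = 0" if "s \<in> {a..m}" for s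
      using that ab by (intro weak_EL_zero[OF ij(1) c _ xc]) auto
    have EL1: "weak_EL c (Suc i) s (\<phi> s *\<^sub>R ?e) = 0" if "s \<in> {m..b}" for s
      using that ab by (intro weak_EL_zero[OF ij(2) c _ xc]) auto
    have "integral {a..m} (\<lambda>s. weak_EL c i s (\<phi> s *\<^sub>R ?e)) = 0"
      "integral {m..b} (\<lambda>s. weak_EL c (Suc i) s (\<phi> s *\<^sub>R ?e)) = 0"
      using integral_cong[OF EL0, of "{a..m}" "\<lambda>s. s"] integral_cong[OF EL1, of "{m..b}" "\<lambda>s. s"] by simp_all
    then have "boundary c i m 0 (bump a b m *\<^sub>R ?e) - boundary c (Suc i) m 0 (bump a b m *\<^sub>R ?e) = 0"
      using stationarity[OF ext c ij ab xc \<phi>s \<phi>0 \<phi>k, of ?e] by (simp add: \<phi>' \<phi>_def[of m])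
    then have "bump a b m * Gm c (snd c (x m)) ?e ?e = 0"
      by (simp add: boundary_def C.bdry_def C.Gam_simps[OF U] C.G_simps[OF U] algebra_simps)
    then show False using C.pos_G[OF U nz] bump_pos[OF ab(3,6)] by simp
  qed
  then show "curve_deriv A nabla (J i) x 2 (\<tau> i) c = curve_deriv A nabla (J (Suc i)) x 2 (\<tau> i) c"
    by (simp add: m_def)
qed

end
end


section \<open>Regularity at the knots and the equation\<close>

text \<open>Near a point a smooth map on \<open>S\<close> extends to an open set. The derivatives of the extension restrict to the
  derivatives within \<open>S\<close>.\<close>

lemma ck_on_two_jet:
  fixes f :: "real \<Rightarrow> 'b::real_normed_vector"
  assumes f: "ck_on \<infinity> S f" and lim: "\<And>t. t \<in> S \<Longrightarrow> at t within S \<noteq> bot" and m: "m \<in> S"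
  shows "\<exists>W F F' F''. open W \<and> m \<in> W \<and> (\<forall>q\<in>W. (F has_vector_derivative F' q) (at q)) \<and>
    (\<forall>q\<in>W. (F' has_vector_derivative F'' q) (at q)) \<and> continuous_on W F'' \<and>
    (\<forall>q\<in>S \<inter> W. F q = f q \<and> F' q = vector_derivative f (at q within S) \<and>
       F'' q = vector_derivative (\<lambda>s. vector_derivative f (at s within S)) (at q within S))"
proof -
  obtain W F where W: "open W" "m \<in> W" "\<And>n. enat n \<le> \<infinity> \<Longrightarrow> cn_on_open n W F"
    "\<And>q. q \<in> S \<Longrightarrow> q \<in> W \<Longrightarrow> F q = f q" using ck_onE[OF f m] by blast
  define F' where "F' x = frechet_derivative F (at x) 1" for x
  define F'' where "F'' x = frechet_derivative F' (at x) 1" for x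
  have F2: "cn_on_open (Suc (Suc 0)) W F" using W(3) by simp
  note F1 = cn_on_open_real_SucD[OF F2, folded F'_def]
  note F3 = cn_on_open_real_SucD[OF F1(2), folded F''_def]
  have tr: "vector_derivative h (at q within S) = k'"
    if "(k has_vector_derivative k') (at q)" "\<And>q. q \<in> S \<inter> W \<Longrightarrow> k q = h q" "q \<in> S \<inter> W" for h k :: "real \<Rightarrow> 'b" and k' q
  proof (rule vector_derivative_within[OF lim])
    show "(h has_vector_derivative k') (at q within S)"
    proof (rule has_vector_derivative_transform_eventually[OF has_vector_derivative_at_within[OF that(1)]])
      show "\<forall>\<^sub>F s in nhds q. s \<in> S \<longrightarrow> k s = h s" unfolding eventually_nhds using W(1) that by blast
    qed (use that in blast)
  qed (use that in blast)
  have e1: "F' q = vector_derivative f (at q within S)" if "q \<in> S \<inter> W" for q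
    using tr[OF F1(1), of q f] W(4) that by auto
  have e2: "F'' q = vector_derivative (\<lambda>s. vector_derivative f (at s within S)) (at q within S)" if "q \<in> S \<inter> W" for q
    using tr[OF F3(1), of q "\<lambda>s. vector_derivative f (at s within S)"] e1 that by auto
  show ?thesis
    by (intro exI[of _ W] exI[of _ F] exI[of _ F'] exI[of _ F''] conjI ballI)
      (use W F1 F3 e1 e2 in auto)
qed

context riemannian_atlas
begin

text \<open>The Riesz representation of \<open>df\<close> by the inner product at \<open>p\<close>.\<close>

lemma gradient_tangent:
  assumes f: "(f \<circ> chart_inv (chart_at A p)) differentiable (at (snd (chart_at A p) p))"
  shows "gradient A g f p \<in> tangent_space A p"
    and "v \<in> tangent_space A p \<Longrightarrow> g p (gradient A g f p) v = dir_deriv A p v f"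
proof -
  define c where "c = chart_at A p"
  have c: "c \<in> A" "p \<in> fst c" unfolding c_def by (rule chart_at)+
  interpret C: coord_metric "snd c ` fst c" "Gm c" "Gam c" by (rule coord_metric[OF c(1)])
  have U: "snd c p \<in> snd c ` fst c" using c by simp
  let ?G = "Gm c (snd c p)" and ?D = "frechet_derivative (f \<circ> chart_inv c) (at (snd c p))"
  have D: "linear ?D" using linear_frechet_derivative f by (simp add: c_def)
  define F where "F u = (\<Sum>i\<in>Basis. ?G u i *\<^sub>R i)" for u
  have "linear F"
    unfolding F_def by (rule linearI) (simp_all add: C.G_simps[OF U] algebra_simps sum.distrib scaleR_sum_right)
  moreover have G0: "?G u e = (\<Sum>i\<in>Basis. (e \<bullet> i) * ?G u i)" for u e
    using linear_family_expand[OF C.G_linear(1)[OF U], of u e] by simp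
  have "u = 0" if "F u = 0" for u
  proof -
    have "?G u i = 0" if "i \<in> Basis" for i
    proof -
      have "F u \<bullet> i = ?G u i"
        unfolding F_def using that by (simp add: inner_sum_left_Basis)
      then show ?thesis using \<open>F u = 0\<close> by simp
    qed
    then have "?G u u = 0" using G0[of u u] by simp
    then show ?thesis using C.pos_G[OF U, of u] by force
  qed
  ultimately have "surj F"
    by (intro linear_injective_imp_surjective) (auto simp: linear_injective_0)
  then obtain u where u: "F u = (\<Sum>i\<in>Basis. ?D i *\<^sub>R i)" by (metis surjD)
  have ui: "?G u i = ?D i" if "i \<in> Basis" for i
  proof -
    have "F u \<bullet> i = ?G u i" "(\<Sum>i\<in>Basis. ?D i *\<^sub>R i) \<bullet> i = ?D i"
      unfolding F_def using that by (simp_all add: inner_sum_left_Basis)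
    then show ?thesis using u by simp
  qed
  have uD: "?G u e = ?D e" for e
    using G0[of u e] ui linear_family_expand[OF D, of e] by simp
  let ?w = "coord_field A c u p"
  have wT: "?w \<in> tangent_space A p" by (rule coord_field_tangent[OF c])
  have dd: "dir_deriv A p v f = ?D (v c)" if "v \<in> tangent_space A p" for v
    by (simp add: dir_deriv_def Let_def c_def)
  have ex: "g p ?w v = dir_deriv A p v f" if "v \<in> tangent_space A p" for v
    by (simp add: g_in_chart[OF wT that c] coord_field_self c uD dd[OF that])
  have "gradient A g f p = ?w"
    unfolding gradient_def
  proof (rule the_equality)
    show "?w \<in> tangent_space A p \<and> (\<forall>v\<in>tangent_space A p. g p ?w v = dir_deriv A p v f)" using wT ex by blast
    fix w' assume w': "w' \<in> tangent_space A p \<and> (\<forall>v\<in>tangent_space A p. g p w' v = dir_deriv A p v f)"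
    show "w' = ?w"
    proof (rule tangent_eqI[OF _ wT c], goal_cases)
      case 2
      have "?G (w' c - u) e = 0" for e
      proof -
        have T: "coord_field A c e p \<in> tangent_space A p" by (rule coord_field_tangent[OF c])
        have "g p w' (coord_field A c e p) = g p ?w (coord_field A c e p)" using w' T ex by simp
        then show ?thesis
          using w' T wT by (simp add: g_in_chart[OF _ _ c] coord_field_self c C.G_simps[OF U])
      qed
      then have "w' c - u = 0" using C.pos_G[OF U, of "w' c - u"] by force
      then show ?case by (simp add: coord_field_self c)
    qed (use w' in blast)
  qed
  then show "gradient A g f p \<in> tangent_space A p"
    "v \<in> tangent_space A p \<Longrightarrow> g p (gradient A g f p) v = dir_deriv A p v f"
    using wT ex by simp_all
qed

end

context obstacle_problem
begin

context
  assumes ext: "extremizer A N \<tau> P v0 vN (\<lambda>z. integral {0..\<tau> N} (density \<sigma> w {0..\<tau> N} z)) x"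
begin

text \<open>Extend the two halves of the curve smoothly across the knot and glue the extensions. Their second
  derivatives agree there because the covariant accelerations and the velocities do.\<close>

lemma chart_curve_C2_at_knot:
  assumes i: "1 \<le> i" "i < N" and c: "c \<in> A" and xm: "x (\<tau> i) \<in> fst c"
  shows "\<exists>V. open V \<and> \<tau> i \<in> V \<and> ck_on 2 ({s\<in>{0..\<tau> N}. x s \<in> fst c} \<inter> V) (\<lambda>s. snd c (x s))"
proof -
  define m where "m = \<tau> i"
  have ij: "i \<in> {1..N}" "Suc i \<in> {1..N}" using i by auto
  have lt: "\<tau> (i - 1) < m" "m < \<tau> (Suc i)"
    unfolding m_def using \<tau>_piece[OF ij(1)] \<tau>_piece[OF ij(2)] by auto
  define two_jet where "two_jet k W F F' F'' \<longleftrightarrow> open W \<and> m \<in> W \<and>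
    (\<forall>q\<in>W. (F has_vector_derivative F' q) (at q)) \<and> (\<forall>q\<in>W. (F' has_vector_derivative F'' q) (at q)) \<and>
    continuous_on W F'' \<and> (\<forall>q\<in>J k \<inter> W. x q \<in> fst c \<longrightarrow> F q = snd c (x q)) \<and>
    F' m = velocity A (J k) x m c \<and>
    F'' m + Gam c (snd c (x m)) (velocity A (J k) x m c) (velocity A (J k) x m c) = curve_deriv A nabla (J k) x 2 m c"
    for k W F F' F''
  have jet: "\<exists>W F F' F''. two_jet k W F F' F''" if k: "k \<in> {1..N}" "m \<in> J k" for k
  proof -
    let ?S = "{s\<in>J k. x s \<in> fst c}"
    note K = piece_lim[OF k(1)] x_piece[OF k(1)]
    have aw: "at t within ?S = at t within J k" if "t \<in> ?S" for t
      using at_within_domain[OF K _ c, of t] that by simp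
    have vd: "vector_derivative (\<lambda>s. snd c (x s)) (at t within ?S) = velocity A (J k) x t c" if "t \<in> ?S" for t
      using aw[OF that] that c by (simp add: velocity_def)
    have mS: "m \<in> ?S" using k xm by (simp add: m_def)
    have "vector_derivative (\<lambda>s. vector_derivative (\<lambda>s. snd c (x s)) (at s within ?S)) (at m within ?S)
      = vector_derivative (\<lambda>s. velocity A (J k) x s c) (at m within ?S)"
      by (rule vector_derivative_cong_germ[of UNIV]) (use vd mS in auto)
    moreover have "curve_deriv A nabla (J k) x 2 m c = vector_derivative (\<lambda>s. velocity A (J k) x s c) (at m within J k)
        + Gam c (snd c (x m)) (velocity A (J k) x m c) (velocity A (J k) x m c)"
      using curve_deriv_Suc_component[OF K c, of m 0] mS by (simp add: numeral_2_eq_2 curve_deriv_1)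
    moreover obtain W F F' F'' where "open W" "m \<in> W" "\<forall>q\<in>W. (F has_vector_derivative F' q) (at q)"
      "\<forall>q\<in>W. (F' has_vector_derivative F'' q) (at q)" "continuous_on W F''"
      "\<forall>q\<in>?S \<inter> W. F q = snd c (x q) \<and> F' q = vector_derivative (\<lambda>s. snd c (x s)) (at q within ?S) \<and>
        F'' q = vector_derivative (\<lambda>s. vector_derivative (\<lambda>s. snd c (x s)) (at s within ?S)) (at q within ?S)"
      using ck_on_two_jet[OF ck_map_on_chart[OF K(2) c] _ mS] aw K(1) by (metis (no_types, lifting) mem_Collect_eq)
    ultimately show ?thesis
      unfolding two_jet_def using mS vd[OF mS] aw[OF mS] by (intro exI[of _ W] exI[of _ F] exI[of _ F'] exI[of _ F'']) auto
  qed
  have mJ: "m \<in> J i" "m \<in> J (Suc i)" using lt by (auto simp: m_def)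
  obtain W1 F F' F'' where "two_jet i W1 F F' F''" using jet[OF ij(1) mJ(1)] by blast
  then have F: "open W1" "m \<in> W1" "\<forall>q\<in>W1. (F has_vector_derivative F' q) (at q)"
    "\<forall>q\<in>W1. (F' has_vector_derivative F'' q) (at q)" "continuous_on W1 F''"
    "\<forall>q\<in>J i \<inter> W1. x q \<in> fst c \<longrightarrow> F q = snd c (x q)" "F' m = velocity A (J i) x m c"
    "F'' m + Gam c (snd c (x m)) (velocity A (J i) x m c) (velocity A (J i) x m c) = curve_deriv A nabla (J i) x 2 m c"
    unfolding two_jet_def by blast+
  obtain W2 H H' H'' where "two_jet (Suc i) W2 H H' H''" using jet[OF ij(2) mJ(2)] by blast
  then have H: "open W2" "m \<in> W2" "\<forall>q\<in>W2. (H has_vector_derivative H' q) (at q)"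
    "\<forall>q\<in>W2. (H' has_vector_derivative H'' q) (at q)" "continuous_on W2 H''"
    "\<forall>q\<in>J (Suc i) \<inter> W2. x q \<in> fst c \<longrightarrow> H q = snd c (x q)" "H' m = velocity A (J (Suc i)) x m c"
    "H'' m + Gam c (snd c (x m)) (velocity A (J (Suc i)) x m c) (velocity A (J (Suc i)) x m c)
      = curve_deriv A nabla (J (Suc i)) x 2 m c"
    unfolding two_jet_def by blast+
  define V where "V = W1 \<inter> W2 \<inter> {\<tau> (i - 1)<..<\<tau> (Suc i)}"
  have V: "open V" "m \<in> V" unfolding V_def using F(1,2) H(1,2) lt by auto
  have m0: "F m = H m" using F(2,6) H(2,6) mJ xm by (simp add: m_def)
  have "cn_on_open 2 V (\<lambda>t. if t \<in> {..m} then F t else H t)"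
  proof (rule cn_on_open_2_glue[OF V(1)])
    show "F m = H m" by (rule m0)
    show "F' m = H' m" using F(7) H(7) acceleration_matches(2)[OF ext i c xm] by (simp add: m_def)
    have "F'' m + Gam c (snd c (x m)) (velocity A (J i) x m c) (velocity A (J i) x m c)
      = H'' m + Gam c (snd c (x m)) (velocity A (J i) x m c) (velocity A (J i) x m c)"
      using F(8) H(8) acceleration_matches[OF ext i c xm] by (simp add: m_def)
    then show "F'' m = H'' m" by (rule add_right_imp_eq)
    show "continuous_on V F''" "continuous_on V H''"
      by (rule continuous_on_subset[OF F(5)], simp add: V_def le_infI1, rule continuous_on_subset[OF H(5)], auto simp: V_def)
  qed (use F(3,4) H(3,4) in \<open>auto simp: V_def\<close>)
  then have "cn_on_open n V (\<lambda>t. if t \<in> {..m} then F t else H t)" if "enat n \<le> 2" for n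
    by (rule cn_on_open_le) (use that in \<open>simp add: numeral_eq_enat\<close>)
  then have "ck_on 2 V (\<lambda>t. if t \<in> {..m} then F t else H t)" using ck_on_open_iff[OF V(1)] by blast
  then have glued: "ck_on 2 ({s\<in>{0..\<tau> N}. x s \<in> fst c} \<inter> V) (\<lambda>t. if t \<in> {..m} then F t else H t)"
    by (rule ck_on_subset) auto
  have agree: "(if t \<in> {..m} then F t else H t) = snd c (x t)" if "t \<in> {s\<in>{0..\<tau> N}. x s \<in> fst c} \<inter> V" for t
    using F(6) H(6) that by (auto simp: V_def m_def)
  have "ck_on 2 ({s\<in>{0..\<tau> N}. x s \<in> fst c} \<inter> V) (\<lambda>s. snd c (x s))"
    by (rule iffD1[OF ck_on_cong glued]) (rule agree)
  then show ?thesis using V by (auto simp: m_def)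
qed

lemma extremizer_C2: "ck_map_on 2 A {0..\<tau> N} x"
proof (rule ck_map_onI)
  fix c s assume c: "c \<in> A" and s: "s \<in> {0..\<tau> N}" "x s \<in> fst c"
  let ?D = "{s\<in>{0..\<tau> N}. x s \<in> fst c}" and ?y = "\<lambda>s. snd c (x s)"
  have "ck_on 2 ?D ?y"
  proof (rule ck_on_locally)
    fix p assume p: "p \<in> ?D"
    then obtain i where i: "i \<in> {1..N}" "p \<in> J i" using piece_exists by blast
    have smooth: "\<exists>V. open V \<and> p \<in> V \<and> ck_on 2 (?D \<inter> V) ?y"
      if V: "open V" "p \<in> V" "{0..\<tau> N} \<inter> V \<subseteq> J i" for V
    proof -
      have "ck_on 2 {s\<in>J i. x s \<in> fst c} ?y"
        by (rule ck_on_mono[OF ck_map_on_chart[OF x_piece[OF i(1)] c]]) simp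
      then have "ck_on 2 (?D \<inter> V) ?y" by (rule ck_on_subset) (use V(3) in auto)
      then show ?thesis using V by blast
    qed
    consider "\<tau> (i - 1) < p" "p < \<tau> i" | "p = \<tau> (i - 1)" | "p = \<tau> i" using i(2) by force
    then show "\<exists>V. open V \<and> p \<in> V \<and> ck_on 2 (?D \<inter> V) ?y"
    proof cases
      case 1
      then show ?thesis by (intro smooth[of "{\<tau> (i - 1)<..<\<tau> i}"]) auto
    next
      case 2
      show ?thesis
      proof (cases "i = 1")
        case True
        then show ?thesis using 2 \<tau>0 \<tau>_piece[OF i(1)] by (intro smooth[of "{..<\<tau> i}"]) auto
      next
        case False
        then show ?thesis using chart_curve_C2_at_knot[of "i - 1" c] 2 i(1) c p by auto
      qed
    next
      case 3
      show ?thesis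
      proof (cases "i = N")
        case True
        then show ?thesis using 3 \<tau>_piece[OF i(1)] by (intro smooth[of "{\<tau> (i - 1)<..}"]) auto
      next
        case False
        then show ?thesis using chart_curve_C2_at_knot[of i c] 3 i(1) c p by auto
      qed
    qed
  qed
  moreover obtain W where "open W" "?D = {0..\<tau> N} \<inter> W" using ck_map_on_domain[OF x_C1 c] .
  ultimately show "\<exists>W. open W \<and> s \<in> W \<and> x ` ({0..\<tau> N} \<inter> W) \<subseteq> fst c \<and> ck_on 2 ({0..\<tau> N} \<inter> W) ?y"
    using s by (intro exI[of _ W]) auto
qed

text \<open>The Euler-Lagrange expression is a tangent vector, so that it vanishes as soon as its component in the
  one chart does in which the curvature tensor and the gradient are computed.\<close>

lemma euler_lagrange:
  assumes i: "i \<in> {1..N}" and t: "t \<in> J i"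
    and w_sum: "w = (\<lambda>p. \<Sum>r=1..s. V r p)" and V: "\<forall>r\<in>{1..s}. ck_fun_on 2 A UNIV (V r)"
  shows "curve_deriv A nabla (J i) x 4 t
       + curvature_tensor A nabla (x t) (curve_deriv A nabla (J i) x 2 t)
           (curve_deriv A nabla (J i) x 1 t) (curve_deriv A nabla (J i) x 1 t)
       - \<sigma> *\<^sub>R curve_deriv A nabla (J i) x 2 t
       + (1/2) *\<^sub>R (\<Sum>r=1..s. gradient A g (V r) (x t)) = 0" (is "?X = 0")
proof -
  define c where "c = chart_at A (x t)"
  have c: "c \<in> A" "x t \<in> fst c" unfolding c_def by (rule chart_at)+
  interpret C: coord_metric "snd c ` fst c" "Gm c" "Gam c" by (rule coord_metric[OF c(1)])
  let ?y = "snd c (x t)"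
  have U: "?y \<in> snd c ` fst c" using c by simp
  let ?D = "\<lambda>k. curve_deriv A nabla (J i) x k t"
  note K = piece_lim[OF i] x_piece[OF i]
  have T: "?D k \<in> tangent_space A (x t)" if "k \<in> {1, 2, 4}" for k
  proof -
    have "Suc (k - 1) = k" using that by auto
    then show ?thesis using curve_deriv_tangent[OF K t, of "k - 1"] by (simp only:)
  qed
  have V1: "(V r \<circ> chart_inv c) differentiable (at ?y)" if "r \<in> {1..s}" for r
    by (rule ck_fun_on_diff[OF _ _ open_UNIV c(1) UNIV_I c(2)]) (use V that in \<open>auto simp: one_enat_def numeral_eq_enat\<close>)
  note grad = gradient_tangent[OF V1[unfolded c_def]]
  have T2: "?D 2 \<in> tangent_space A (x t)" and T1: "?D 1 \<in> tangent_space A (x t)" by (rule T; simp)+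
  note R = curvature_in_chart[OF T2 T1 T1, folded c_def]
  have XT: "?X \<in> tangent_space A (x t)"
    by (intro tangent_add tangent_diff tangent_scaleR tangent_sum T R(1) grad) auto
  have dw: "frechet_derivative (w \<circ> chart_inv c) (at ?y) e = (\<Sum>r=1..s. Gm c ?y (gradient A g (V r) (x t) c) e)" for e
  proof -
    have "((\<lambda>z. \<Sum>r=1..s. (V r \<circ> chart_inv c) z) has_derivative
        (\<lambda>h. \<Sum>r=1..s. frechet_derivative (V r \<circ> chart_inv c) (at ?y) h)) (at ?y)"
      by (intro has_derivative_sum iffD1[OF frechet_derivative_works] V1)
    from frechet_derivative_at[OF this]
    have "frechet_derivative (w \<circ> chart_inv c) (at ?y) e
      = (\<Sum>r=1..s. frechet_derivative (V r \<circ> chart_inv c) (at ?y) e)"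
      unfolding w_sum o_def by metis
    also have "\<dots> = (\<Sum>r=1..s. Gm c ?y (gradient A g (V r) (x t) c) e)"
    proof (rule sum.cong[OF refl])
      fix r assume r: "r \<in> {1..s}"
      have E: "coord_field A c e (x t) \<in> tangent_space A (x t)" by (rule coord_field_tangent[OF c])
      have "frechet_derivative (V r \<circ> chart_inv c) (at ?y) e = dir_deriv A (x t) (coord_field A c e (x t)) (V r)"
        by (simp add: dir_deriv_def Let_def coord_field_self c flip: c_def)
      also have "\<dots> = g (x t) (gradient A g (V r) (x t)) (coord_field A c e (x t))"
        using grad(2)[OF r E] by simp
      also have "\<dots> = Gm c ?y (gradient A g (V r) (x t) c) e"
        by (simp add: g_in_chart[OF grad(1)[OF r] E c] coord_field_self c)
      finally show "frechet_derivative (V r \<circ> chart_inv c) (at ?y) e = Gm c ?y (gradient A g (V r) (x t) c) e" .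
    qed
    finally show ?thesis .
  qed
  have sumG: "Gm c ?y (\<Sum>r=1..s. gradient A g (V r) (x t) c) e = (\<Sum>r=1..s. Gm c ?y (gradient A g (V r) (x t) c) e)" for e
    by (rule linear_sum[OF C.G_linear(2)[OF U]])
  have "Gm c ?y (?X c) e = 0" for e
  proof -
    have "Gm c ?y (?X c) e = weak_EL c i t e"
      unfolding weak_EL_def C.EL_def dw
      by (simp add: R(2)[unfolded One_nat_def curve_deriv_1] sum_fun_apply scaleR_fun_def curve_deriv_1 C.G_simps[OF U] sumG)
    then show ?thesis using weak_EL_zero[OF ext i c(1) t c(2)] by simp
  qed
  then have "?X c = 0" using C.pos_G[OF U, of "?X c"] by (metis less_irrefl)
  then show ?thesis by (intro tangent_eqI[OF XT tangent_zero c]) simp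
qed

end
end

theorem corollary3p3:
  fixes A :: "('m::{t2_space, second_countable_topology}, 'e::euclidean_space) chart set"
    and g :: "('m, 'e) metric" and nabla :: "('m, 'e) connection"
    and \<sigma> :: real and s N :: nat
    and V :: "nat \<Rightarrow> 'm \<Rightarrow> real" and S :: "nat \<Rightarrow> 'm set"
    and P :: "nat \<Rightarrow> 'm" and \<tau> :: "nat \<Rightarrow> real"
    and v0 vN :: "('m, 'e) tvec" and x :: "real \<Rightarrow> 'm"
  assumes "smooth_manifold A" and "riemannian_metric A g" and "levi_civita_connection A g nabla"
    and "\<sigma> > 0"
    and "\<forall>r\<in>{1..s}. ck_fun_on 2 A UNIV (V r)"
    and "\<forall>r\<in>{1..s}. regular_submanifold A (S r)"
    and "N \<ge> 1"
    and "inj_on P {0..N}"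
    and "\<forall>i\<in>{0..N}. \<forall>r\<in>{1..s}. P i \<notin> S r"
    and "\<tau> 0 = 0" and "strict_mono_on {0..N} \<tau>"
    and "v0 \<in> tangent_space A (P 0)" and "vN \<in> tangent_space A (P N)"
    and "extremizer A N \<tau> P v0 vN (obstacle_functional A g nabla \<sigma> s V (\<tau> N)) x"
  shows "ck_map_on 2 A {0..\<tau> N} x \<and>
    (\<forall>i\<in>{1..N}. \<forall>t\<in>{\<tau> (i - 1)..\<tau> i}.
       curve_deriv A nabla {\<tau> (i - 1)..\<tau> i} x 4 t
       + curvature_tensor A nabla (x t)
           (curve_deriv A nabla {\<tau> (i - 1)..\<tau> i} x 2 t)
           (curve_deriv A nabla {\<tau> (i - 1)..\<tau> i} x 1 t)
           (curve_deriv A nabla {\<tau> (i - 1)..\<tau> i} x 1 t)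
       - \<sigma> *\<^sub>R curve_deriv A nabla {\<tau> (i - 1)..\<tau> i} x 2 t
       + (1/2) *\<^sub>R (\<Sum>r=1..s. gradient A g (V r) (x t)) = 0)"
proof -
  let ?w = "\<lambda>p. \<Sum>r=1..s. V r p"
  have "ck_fun_on 2 A UNIV ?w"
    using assms(5) unfolding ck_fun_on_def o_def by (auto intro!: ck_on_sum)
  then interpret obstacle_problem A nabla g \<sigma> ?w N P \<tau> v0 vN x
    using assms by unfold_locales (auto simp: extremizer_def levi_civita_connection_def)
  have "obstacle_functional A g nabla \<sigma> s V (\<tau> N) = (\<lambda>z. integral {0..\<tau> N} (density \<sigma> ?w {0..\<tau> N} z))"
    by (simp add: fun_eq_iff obstacle_functional_def density_def[abs_def])
  then have ext: "extremizer A N \<tau> P v0 vN (\<lambda>z. integral {0..\<tau> N} (density \<sigma> ?w {0..\<tau> N} z)) x"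
    using assms(14) by simp
  show ?thesis
    using extremizer_C2[OF ext] euler_lagrange[OF ext _ _ refl assms(5)] by blast
qed

end
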